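(* Let $n\ge 2$ and $0<p<1$. The trace operator $\gamma_0$ is defined on $B^{\frac{n}{p}-n+1}_{p,q}(\mathbb{R}^n)$ for $0<q\le 1$, and it is continuous (bounded) $$\gamma_0\colon B^{\frac{n}{p}-n+1}_{p,q}(\mathbb{R}^n)\to B^{(n-1)(\frac1p-1)}_{p,\infty}(\mathbb{R}^{n-1})\quad\text{if } 0<q\le p<1,$$ whereas it is bounded $$\gamma_0\colon B^{\frac{n}{p}-n+1}_{p,q}(\mathbb{R}^n)\to B^{(n-1)(\frac1q-1)}_{q,\infty}(\mathbb{R}^{n-1})\quad\text{if } p<q\le 1.$$ Furthermore, in the case $p<q\le1$ the number $q$ is the smallest possible integral-exponent for the co-domain: if for some $t\in\mathbb{R}$ and $r\in\,]0,\infty]$ the operator $\gamma_0$ is bounded from $B^{\frac{n}{p}-n+1}_{p,q}(\mathbb{R}^n)$ to $B^{t}_{r,\infty}(\mathbb{R}^{n-1})$, then $r\ge q$.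
   Context: Besov spaces. Let $\Psi\colon\mathbb{R}\to\mathbb{R}$ be a $C^\infty$ function with $\Psi(t)=1$ for $t<11/10$ and $\Psi(t)=0$ for $t>13/10$. On $\mathbb{R}^n$ put $\Psi_j(\xi)=\Psi(2^{-j}|\xi|)$ for $j\ge0$, $\Phi_0=\Psi_0$ and $\Phi_j=\Psi_j-\Psi_{j-1}$ for $j\ge1$, so that $1=\sum_{j\ge0}\Phi_j$ (a Littlewood--Paley partition of unity). For $s\in\mathbb{R}$ and $p,q\in\,]0,\infty]$, $B^s_{p,q}(\mathbb{R}^n)$ is the set of tempered distributions $u\in\mathcal{S}'(\mathbb{R}^n)$ with $$\|u\|_{B^s_{p,q}}=\Big(\sum_{k=0}^\infty 2^{skq}\|\mathcal{F}^{-1}(\Phi_k\hat u)\|_{L_p}^q\Big)^{1/q}<\infty$$ (supremum over $k$ if $q=\infty$); here $\mathcal{F}u=\hat u$ is the Fourier transform. On $\mathbb{R}^{n-1}$ the partition of unity $\Phi_j'(\xi')=\Phi_j(\xi',0)$ is used. The exponent $p$ is called the integral-exponent and $q$ the sum-exponent. Trace. Write $x=(x',x_n)$ with $x'\in\mathbb{R}^{n-1}$. For $u\in\mathcal{S}'(\mathbb{R}^n)$, $$\gamma_0u=\sum_{j=0}^\infty \mathcal{F}^{-1}(\Phi_j\mathcal{F}u)\big|_{x_n=0}$$ whenever this series converges in $\mathcal{D}'(\mathbb{R}^{n-1})$; each summand $\mathcal{F}^{-1}(\Phi_j\mathcal{F}u)$ is an entire analytic function, so its restriction to $x_n=0$ makes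 sense. An operator between such quasi-normed spaces is continuous if and only if it is bounded, i.e. $\|\gamma_0u\|\le c\|u\|$ for some constant $c<\infty$ and all $u$ in the domain. *)

theory Defs
  imports "HOL-Analysis.Analysis" "HOL-Probability.Essential_Supremum"
begin

section \<open>Smooth functions, Schwartz functions and test functions\<close>

text \<open>
  A list of basis vectors plays the role of a multi-index: the length of the list is the order,
  and the order of the entries is irrelevant on smooth functions.
\<close>

primrec iter_deriv ::
  "'a list \<Rightarrow> ('a::euclidean_space \<Rightarrow> 'b::real_normed_vector) \<Rightarrow> 'a \<Rightarrow> 'b" where
  "iter_deriv [] f = f"
| "iter_deriv (b # bs) f = (\<lambda>x. frechet_derivative (iter_deriv bs f) (at x) b)"

definition multi_indices :: "'a::euclidean_space list set" where
  "multi_indices = {bs. set bs \<subseteq> Basis}"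

definition multi_indices_upto :: "nat \<Rightarrow> 'a::euclidean_space list set" where
  "multi_indices_upto N = {bs \<in> multi_indices. length bs \<le> N}"

definition smooth :: "('a::euclidean_space \<Rightarrow> 'b::real_normed_vector) \<Rightarrow> bool" where
  "smooth f \<longleftrightarrow> (\<forall>bs\<in>multi_indices. \<forall>x. iter_deriv bs f differentiable (at x))"

definition schwartz :: "('a::euclidean_space \<Rightarrow> complex) \<Rightarrow> bool" where
  "schwartz f \<longleftrightarrow> smooth f \<and>
     (\<forall>N. \<forall>bs\<in>multi_indices. bounded (range (\<lambda>x. (1 + norm x) ^ N *\<^sub>R iter_deriv bs f x)))"

definition schwartz_seminorm :: "nat \<Rightarrow> ('a::euclidean_space \<Rightarrow> complex) \<Rightarrow> real" where
  "schwartz_seminorm N f =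
     (\<Sum>bs\<in>multi_indices_upto N. SUP x. (1 + norm x) ^ N * norm (iter_deriv bs f x))"

definition test_function :: "('a::euclidean_space \<Rightarrow> complex) \<Rightarrow> bool" where
  "test_function f \<longleftrightarrow> smooth f \<and> compact (closure {x. f x \<noteq> 0})"

definition test_seminorm :: "nat \<Rightarrow> ('a::euclidean_space \<Rightarrow> complex) \<Rightarrow> real" where
  "test_seminorm N f = (\<Sum>bs\<in>multi_indices_upto N. SUP x. norm (iter_deriv bs f x))"


section \<open>Distributions\<close>

text \<open>
  Distributions are total functionals on functions; only their values on test functions, or
  on Schwartz functions in the tempered case, are meaningful. Restriction to test functions
  identifies tempered distributions with distributions.
\<close>

type_synonym 'a functional = "('a \<Rightarrow> complex) \<Rightarrow> complex"

definition linear_functional_on :: "('a \<Rightarrow> complex) set \<Rightarrow> 'a functional \<Rightarrow> bool" where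
  "linear_functional_on V u \<longleftrightarrow>
     (\<forall>f\<in>V. \<forall>g\<in>V. \<forall>a b. u (\<lambda>x. a * f x + b * g x) = a * u f + b * u g)"

definition tempered_distribution :: "'a::euclidean_space functional \<Rightarrow> bool" where
  "tempered_distribution u \<longleftrightarrow> linear_functional_on (Collect schwartz) u \<and>
     (\<exists>C N. \<forall>f. schwartz f \<longrightarrow> norm (u f) \<le> C * schwartz_seminorm N f)"

definition distribution :: "'a::euclidean_space functional \<Rightarrow> bool" where
  "distribution w \<longleftrightarrow> linear_functional_on (Collect test_function) w \<and>
     (\<forall>K. compact K \<longrightarrow> (\<exists>C N. \<forall>f. test_function f \<and> (\<forall>x. x \<notin> K \<longrightarrow> f x = 0)
        \<longrightarrow> norm (w f) \<le> C * test_seminorm N f))"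

definition regular_functional :: "('a::euclidean_space \<Rightarrow> complex) \<Rightarrow> 'a functional" where
  "regular_functional g = (\<lambda>f. LINT x|lborel. g x * f x)"

text \<open>
  A continuous function is determined by the distribution it induces. This operator is applied
  only to distributions with compactly supported Fourier transform, which do come from an
  (entire analytic) function.
\<close>

definition function_of :: "'a::euclidean_space functional \<Rightarrow> 'a \<Rightarrow> complex" where
  "function_of u = (THE g. continuous_on UNIV g \<and>
     (\<forall>f. test_function f \<longrightarrow> u f = regular_functional g f))"


section \<open>Fourier transform\<close>

definition fourier :: "('a::euclidean_space \<Rightarrow> complex) \<Rightarrow> 'a \<Rightarrow> complex" where
  "fourier f \<xi> = (LINT x|lborel. exp (- \<i> * of_real (x \<bullet> \<xi>)) * f x)"

definition inverse_fourier :: "('a::euclidean_space \<Rightarrow> complex) \<Rightarrow> 'a \<Rightarrow> complex" where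
  "inverse_fourier f x =
     (LINT \<xi>|lborel. exp (\<i> * of_real (x \<bullet> \<xi>)) * f \<xi>) / of_real ((2 * pi) ^ DIM('a))"

definition fourier_dist :: "'a::euclidean_space functional \<Rightarrow> 'a functional" where
  "fourier_dist u = (\<lambda>f. u (fourier f))"

definition inverse_fourier_dist :: "'a::euclidean_space functional \<Rightarrow> 'a functional" where
  "inverse_fourier_dist u = (\<lambda>f. u (inverse_fourier f))"

definition mult_dist :: "('a \<Rightarrow> real) \<Rightarrow> 'a functional \<Rightarrow> 'a functional" where
  "mult_dist m u = (\<lambda>f. u (\<lambda>x. of_real (m x) * f x))"


section \<open>Littlewood--Paley decomposition and Besov spaces\<close>

definition LP_cutoff :: "(real \<Rightarrow> real) \<Rightarrow> bool" where
  "LP_cutoff \<Psi> \<longleftrightarrow> smooth \<Psi> \<and> (\<forall>t. t < 11/10 \<longrightarrow> \<Psi> t = 1) \<and> (\<forall>t. t > 13/10 \<longrightarrow> \<Psi> t = 0)"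

definition LP_Psi :: "(real \<Rightarrow> real) \<Rightarrow> nat \<Rightarrow> 'a::euclidean_space \<Rightarrow> real" where
  "LP_Psi \<Psi> j \<xi> = \<Psi> (2 powr (- real j) * norm \<xi>)"

definition LP_Phi :: "(real \<Rightarrow> real) \<Rightarrow> nat \<Rightarrow> 'a::euclidean_space \<Rightarrow> real" where
  "LP_Phi \<Psi> j \<xi> = (if j = 0 then LP_Psi \<Psi> 0 \<xi> else LP_Psi \<Psi> j \<xi> - LP_Psi \<Psi> (j - 1) \<xi>)"

text \<open>
  The partition of unity on the hyperplane, obtained by restriction from the full space, is
  the same construction in the smaller space.
\<close>

lemma LP_Phi_hyperplane: "LP_Phi \<Psi> j (\<xi>', 0::real) = LP_Phi \<Psi> j \<xi>'"
  by (simp add: LP_Phi_def LP_Psi_def norm_Pair)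

definition LP_block ::
  "(real \<Rightarrow> real) \<Rightarrow> nat \<Rightarrow> 'a::euclidean_space functional \<Rightarrow> 'a \<Rightarrow> complex" where
  "LP_block \<Psi> j u =
     function_of (inverse_fourier_dist (mult_dist (LP_Phi \<Psi> j) (fourier_dist u)))"

text \<open>Only used for positive exponents.\<close>

definition ennreal_powr :: "ennreal \<Rightarrow> real \<Rightarrow> ennreal" where
  "ennreal_powr x a = (if x = \<infinity> then \<infinity> else ennreal (enn2real x powr a))"

definition Lp_norm :: "ennreal \<Rightarrow> ('a::euclidean_space \<Rightarrow> complex) \<Rightarrow> ennreal" where
  "Lp_norm p f =
     (if p = \<infinity> then esssup lborel (\<lambda>x. ennreal (norm (f x)))
      else ennreal_powr (\<integral>\<^sup>+x. ennreal (norm (f x) powr enn2real p) \<partial>lborel) (1 / enn2real p))"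

definition besov_norm ::
  "(real \<Rightarrow> real) \<Rightarrow> real \<Rightarrow> ennreal \<Rightarrow> ennreal \<Rightarrow> 'a::euclidean_space functional \<Rightarrow> ennreal" where
  "besov_norm \<Psi> s p q u =
     (if q = \<infinity> then SUP k. ennreal (2 powr (s * real k)) * Lp_norm p (LP_block \<Psi> k u)
      else ennreal_powr
        (\<Sum>k. ennreal (2 powr (s * real k * enn2real q)) *
              ennreal_powr (Lp_norm p (LP_block \<Psi> k u)) (enn2real q))
        (1 / enn2real q))"

definition besov ::
  "(real \<Rightarrow> real) \<Rightarrow> real \<Rightarrow> ennreal \<Rightarrow> ennreal \<Rightarrow> 'a::euclidean_space functional set" where
  "besov \<Psi> s p q = {u. tempered_distribution u \<and> besov_norm \<Psi> s p q u < \<infinity>}"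


section \<open>The trace on the hyperplane \<open>x\<^sub>n = 0\<close>\<close>

text \<open>
  Points of the full space are pairs of a point of the hyperplane and the last coordinate.
  \<open>has_trace \<Psi> u w\<close> says that the series defining the trace of \<open>u\<close> converges to \<open>w\<close> in the
  (weak) topology of distributions.
\<close>

definition has_trace ::
  "(real \<Rightarrow> real) \<Rightarrow> ('a::euclidean_space \<times> real) functional \<Rightarrow> 'a functional \<Rightarrow> bool" where
  "has_trace \<Psi> u w \<longleftrightarrow> distribution w \<and>
     (\<forall>f. test_function f \<longrightarrow>
        (\<lambda>j. regular_functional (\<lambda>x'. LP_block \<Psi> j u (x', 0)) f) sums w f)"

definition trace_defined ::
  "(real \<Rightarrow> real) \<Rightarrow> ('a::euclidean_space \<times> real) functional \<Rightarrow> bool" where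
  "trace_defined \<Psi> u \<longleftrightarrow> (\<exists>w. has_trace \<Psi> u w)"

text \<open>
  Boundedness of the trace from \<open>B\<^bsup>s\<^esup>\<close> with exponents \<open>p\<close>, \<open>q\<close> on the full space to
  \<open>B\<^bsup>t\<^esup>\<close> with exponents \<open>r\<close>, \<open>q'\<close> on the hyperplane \<open>'a\<close>. Since test functions are dense
  in the Schwartz space, the tempered distribution \<open>v\<close> representing the trace is unique.
\<close>

definition trace_bounded ::
  "'a::euclidean_space itself \<Rightarrow> (real \<Rightarrow> real) \<Rightarrow>
     real \<Rightarrow> ennreal \<Rightarrow> ennreal \<Rightarrow> real \<Rightarrow> ennreal \<Rightarrow> ennreal \<Rightarrow> bool" where
  "trace_bounded _ \<Psi> s p q t r q' \<longleftrightarrow>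
     (\<exists>c::real. \<forall>u \<in> besov \<Psi> s p q. \<exists>v :: 'a functional.
        v \<in> besov \<Psi> t r q' \<and> has_trace \<Psi> u v \<and>
        besov_norm \<Psi> t r q' v \<le> ennreal c * besov_norm \<Psi> s p q u)"

end

theory Submission
  imports Defs "HOL-Probability.Characteristic_Functions" "HOL-Probability.Sinc_Integral"
begin

text \<open>
  Let \<open>u_j\<close> be the blocks of \<open>u\<close> and \<open>w_j\<close> their restrictions to the hyperplane. Both satisfy a
  reproducing formula \<open>g = K * g\<close> with a kernel \<open>K\<close> of scale \<open>2 ^ (- j)\<close>, and Peetre's maximal function
  turns this into a pointwise bound of \<open>norm g powr p\<close> by an average of itself at that scale. This gives
  the inequalities of Nikolskii type relating the \<open>L_p\<close> size of \<open>u_j\<close> to the \<open>L_r\<close> size of \<open>w_j\<close> for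
  \<open>p \<le> r \<le> 1\<close>, and a bound for the convolution of \<open>w_j\<close> with the kernels of the blocks on the hyperplane.
  With \<open>r = 1\<close> the series of the \<open>w_j\<close> converges in \<open>L_1\<close>; with \<open>r = max p q\<close>, summing \<open>r\<close>-th powers gives
  boundedness in both cases. Optimality of \<open>q\<close> follows by testing with sums of blocks of different
  frequencies, one at each frequency, that are located at far apart points of the hyperplane.
\<close>

section \<open>Smooth functions\<close>

text \<open>For p < 1 the quasi-norm of L_p admits no convolution inequality for general functions,
  which is why every estimate goes through functions that reproduce themselves under convolution
  with a kernel of their own scale. Restriction to the hyperplane projects frequencies: the annulus
  of size 2 ^ j that carries u_j becomes a full ball of that size for w_j, so the k-th block of the
  trace receives contributions from all w_j with j \<ge> k - 1. The smoothness n / p - n + 1 is the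
  borderline value: the bound for such a contribution depends on k, but on j only through the norm
  of u_j. No geometric series helps; only the summability of the norms of the u_j does, which leads
  to r-th powers with q \<le> r \<le> 1, to the sum-exponent \<infinity> in the co-domain, and to
  the optimality of q. A further obstacle is that a block is extracted from a functional by a
  description operator, so a distribution has to be moved under an integral sign before anything can
  be estimated. The growth order found in this way depends on the distribution, whereas the
  constants of the theorem must not.\<close>

definition partial_deriv :: "'a::euclidean_space \<Rightarrow> ('a \<Rightarrow> 'b::real_normed_vector) \<Rightarrow> 'a \<Rightarrow> 'b" where
  "partial_deriv b f = (\<lambda>x. frechet_derivative f (at x) b)"

text \<open>
  Differentiability of order \<open>k\<close> at the points of an open set \<open>S\<close>; continuity of the derivatives of
  order \<open>k\<close> is not demanded, which is harmless because only all \<open>k\<close> together matter.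
\<close>

primrec Ck :: "nat \<Rightarrow> ('a::euclidean_space \<Rightarrow> 'b::real_normed_vector) \<Rightarrow> 'a set \<Rightarrow> bool" where
  "Ck 0 f S = True"
| "Ck (Suc k) f S = ((\<forall>x\<in>S. f differentiable (at x)) \<and> (\<forall>b\<in>Basis. Ck k (partial_deriv b f) S))"

lemma iter_deriv_Cons: "iter_deriv (b # bs) f = partial_deriv b (iter_deriv bs f)"
  by (simp add: partial_deriv_def)

lemma iter_deriv_snoc: "iter_deriv (bs @ [b]) f = iter_deriv bs (partial_deriv b f)"
  by (induction bs) (simp_all add: partial_deriv_def)

lemma partial_deriv_eq: "(f has_derivative f') (at x) \<Longrightarrow> partial_deriv b f x = f' b"
  using frechet_derivative_at by (fastforce simp: partial_deriv_def)

lemma Ck_cong: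
  assumes "open S" "\<And>x. x \<in> S \<Longrightarrow> f x = g x"
  shows "Ck k f S = Ck k g S"
  using assms(2)
proof (induction k arbitrary: f g)
  case (Suc k)
  have h: "(f has_derivative f') (at x) \<longleftrightarrow> (g has_derivative f') (at x)" if "x \<in> S" for x f'
    using has_derivative_transform_within_open[OF _ assms(1) that, of f f' UNIV g]
      has_derivative_transform_within_open[OF _ assms(1) that, of g f' UNIV f] Suc.prems by auto
  then have "partial_deriv b f x = partial_deriv b g x" if "x \<in> S" for x b
    using that by (simp add: partial_deriv_def frechet_derivative_def)
  with Suc.IH have "Ck k (partial_deriv b f) S = Ck k (partial_deriv b g) S" for b by blast
  with h show ?case by (auto simp: differentiable_def)
qed simp

lemma Ck_eqI:
  assumes "open S" "Ck k g S" "\<And>x. x \<in> S \<Longrightarrow> f x = g x"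
  shows "Ck k f S"
  using Ck_cong[of S f g k] assms by blast

lemma Ck_Suc_D: "Ck (Suc k) f S \<Longrightarrow> Ck k f S"
  by (induction k arbitrary: f) auto

lemma Ck_Un: "Ck k f S \<Longrightarrow> Ck k f T \<Longrightarrow> Ck k f (S \<union> T)"
  by (induction k arbitrary: f) auto

lemma differentiable_has_derivative:
  "f differentiable (at x) \<Longrightarrow> (f has_derivative frechet_derivative f (at x)) (at x)"
  by (simp add: frechet_derivative_works)

lemma partial_deriv_compose_linear:
  assumes "f differentiable at x" "bounded_linear T"
  shows "partial_deriv b (\<lambda>x. T (f x)) x = T (partial_deriv b f x)"
proof -
  have "((\<lambda>x. T (f x)) has_derivative (\<lambda>h. T (frechet_derivative f (at x) h))) (at x)"
    using bounded_linear.has_derivative[OF assms(2) differentiable_has_derivative[OF assms(1)]] .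
  from partial_deriv_eq[OF this] show ?thesis by (simp add: partial_deriv_def)
qed

lemma Ck_compose_linear:
  assumes "open S" "bounded_linear T"
  shows "Ck k f S \<Longrightarrow> Ck k (\<lambda>x. T (f x)) S"
proof (induction k arbitrary: f)
  case (Suc k)
  then have d: "f differentiable (at x)" if "x \<in> S" for x using that by simp
  have "Ck k (partial_deriv b (\<lambda>x. T (f x))) S" if "b \<in> Basis" for b
    using Suc that by (intro Ck_eqI[OF assms(1) _ partial_deriv_compose_linear[OF d assms(2)]]) auto
  moreover have "(\<lambda>x. T (f x)) differentiable (at x)" if "x \<in> S" for x
    using bounded_linear.has_derivative[OF assms(2) differentiable_has_derivative[OF d[OF that]]]
    by (auto simp: differentiable_def)
  ultimately show ?case by simp
qed simp

lemma partial_deriv_add: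
  assumes "f differentiable at x" "g differentiable at x"
  shows "partial_deriv b (\<lambda>x. f x + g x) x = partial_deriv b f x + partial_deriv b g x"
  using partial_deriv_eq[OF has_derivative_add[OF assms[THEN differentiable_has_derivative]]]
  by (simp add: partial_deriv_def)

lemma Ck_add:
  assumes "open S"
  shows "Ck k f S \<Longrightarrow> Ck k g S \<Longrightarrow> Ck k (\<lambda>x. f x + g x) S"
proof (induction k arbitrary: f g)
  case (Suc k)
  have "Ck k (partial_deriv b (\<lambda>x. f x + g x)) S" if "b \<in> Basis" for b
    using Suc that by (intro Ck_eqI[OF assms(1) _ partial_deriv_add]) auto
  then show ?case using Suc.prems by auto
qed simp

lemma Ck_const: "Ck k (\<lambda>x. c) S"
proof (induction k arbitrary: c)
  case (Suc k)
  have "partial_deriv b (\<lambda>x. c) = (\<lambda>x. 0)" for b :: 'a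
    by (rule ext) (simp add: partial_deriv_eq[OF has_derivative_const])
  then show ?case using Suc by simp
qed simp

lemma Ck_sum:
  assumes "open S" "finite A" "\<And>i. i \<in> A \<Longrightarrow> Ck k (f i) S"
  shows "Ck k (\<lambda>x. \<Sum>i\<in>A. f i x) S"
  using assms(2,3)
proof (induction A rule: finite_induct)
  case empty
  then show ?case by (simp add: Ck_const)
next
  case (insert i A)
  then show ?case using Ck_add[OF assms(1), of k "f i" "\<lambda>x. \<Sum>i\<in>A. f i x"] by simp
qed

text \<open>Stated for bounded bilinear maps, so that products and scalar multiples are instances of
  one rule.\<close>

lemma partial_deriv_bilinear:
  assumes "bounded_bilinear B" "f differentiable at x" "g differentiable at x"
  shows "partial_deriv b (\<lambda>x. B (f x) (g x)) x = B (partial_deriv b f x) (g x) + B (f x) (partial_deriv b g x)"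
  using partial_deriv_eq[OF bounded_bilinear.FDERIV[OF assms(1) assms(2,3)[THEN differentiable_has_derivative]]]
  by (simp add: partial_deriv_def add.commute)

lemma Ck_bilinear:
  assumes "open S" "bounded_bilinear B"
  shows "Ck k f S \<Longrightarrow> Ck k g S \<Longrightarrow> Ck k (\<lambda>x. B (f x) (g x)) S"
proof (induction k arbitrary: f g)
  case (Suc k)
  have "Ck k (partial_deriv b (\<lambda>x. B (f x) (g x))) S" if "b \<in> Basis" for b
  proof -
    have "Ck k (\<lambda>x. B (partial_deriv b f x) (g x) + B (f x) (partial_deriv b g x)) S"
      using Suc.IH[of "partial_deriv b f" g] Suc.IH[of f "partial_deriv b g"] Suc.prems that Ck_Suc_D[OF Suc.prems(1)] Ck_Suc_D[OF Suc.prems(2)]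
      by (intro Ck_add[OF assms(1)]) auto
    moreover have "partial_deriv b (\<lambda>x. B (f x) (g x)) x = B (partial_deriv b f x) (g x) + B (f x) (partial_deriv b g x)"
      if "x \<in> S" for x
      using Suc.prems that by (intro partial_deriv_bilinear[OF assms(2)]) auto
    ultimately show ?thesis by (rule Ck_eqI[OF assms(1)])
  qed
  moreover have "(\<lambda>x. B (f x) (g x)) differentiable (at x)" if "x \<in> S" for x
  proof -
    have "f differentiable (at x)" "g differentiable (at x)" using Suc.prems that by auto
    then show ?thesis
      using bounded_bilinear.FDERIV[OF assms(2) differentiable_has_derivative differentiable_has_derivative]
      unfolding differentiable_def by blast
  qed
  ultimately show ?case by simp
qed simp

lemmas Ck_mult = Ck_bilinear[OF _ bounded_bilinear_mult]
lemmas Ck_scaleR = Ck_bilinear[OF _ bounded_bilinear_scaleR]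

lemma Ck_uminus: "open S \<Longrightarrow> Ck k f S \<Longrightarrow> Ck k (\<lambda>x. - f x) S"
  by (rule Ck_compose_linear[OF _ bounded_linear_minus[OF bounded_linear_ident]])

lemma Ck_of_real:
  "open S \<Longrightarrow> Ck k f S \<Longrightarrow> Ck k (\<lambda>x. of_real (f x) :: 'b::{real_normed_algebra_1}) S"
  by (rule Ck_compose_linear[OF _ bounded_linear_of_real])

lemma Ck_linear:
  assumes "bounded_linear L"
  shows "Ck k L S"
proof (cases k)
  case (Suc j)
  have "(L has_derivative L) (at x)" for x
    by (rule bounded_linear_imp_has_derivative[OF assms])
  moreover from this have "partial_deriv b L = (\<lambda>x. L b)" for b by (auto simp: partial_deriv_eq)
  ultimately show ?thesis using Suc by (auto simp: Ck_const differentiable_def)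
qed simp

lemma partial_deriv_affine:
  fixes f :: "'a::euclidean_space \<Rightarrow> 'b::real_normed_vector" and L :: "'c::euclidean_space \<Rightarrow> 'a"
  assumes "f differentiable at (L x + a)" "bounded_linear L"
  shows "partial_deriv b (\<lambda>x. f (L x + a)) x = (\<Sum>c\<in>Basis. (L b \<bullet> c) *\<^sub>R partial_deriv c f (L x + a))"
proof -
  let ?F = "frechet_derivative f (at (L x + a))"
  have F: "(f has_derivative ?F) (at (L x + a))" using assms(1) by (rule differentiable_has_derivative)
  have "((\<lambda>x. L x + a) has_derivative L) (at x)"
    using has_derivative_add[OF bounded_linear_imp_has_derivative[OF assms(2)] has_derivative_const[of a]] by simp
  from has_derivative_compose[OF this F]
  have "partial_deriv b (\<lambda>x. f (L x + a)) x = ?F (L b)"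
    by (rule partial_deriv_eq)
  also have "\<dots> = ?F (\<Sum>c\<in>Basis. (L b \<bullet> c) *\<^sub>R c)" by (simp add: euclidean_representation)
  also have "\<dots> = (\<Sum>c\<in>Basis. (L b \<bullet> c) *\<^sub>R ?F c)"
    using has_derivative_bounded_linear[OF F]
    by (simp add: linear_sum bounded_linear.linear linear_cmul)
  finally show ?thesis by (simp add: partial_deriv_def)
qed

lemma Ck_affine:
  fixes f :: "'a::euclidean_space \<Rightarrow> 'b::real_normed_vector" and L :: "'c::euclidean_space \<Rightarrow> 'a"
  assumes "bounded_linear L"
  shows "Ck k f UNIV \<Longrightarrow> Ck k (\<lambda>x. f (L x + a)) UNIV"
proof (induction k arbitrary: f)
  case (Suc k)
  then have d: "f differentiable at x" for x by simp
  have "partial_deriv b (\<lambda>x. f (L x + a)) = (\<lambda>x. \<Sum>c\<in>Basis. (L b \<bullet> c) *\<^sub>R partial_deriv c f (L x + a))" for b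
    by (rule ext) (rule partial_deriv_affine[OF d assms])
  moreover have "Ck k (\<lambda>x. \<Sum>c\<in>Basis. (L b \<bullet> c) *\<^sub>R partial_deriv c f (L x + a)) UNIV" for b
    using Suc by (intro Ck_sum Ck_scaleR Ck_const) auto
  moreover have "(\<lambda>x. f (L x + a)) differentiable at x" for x
  proof -
    have "((\<lambda>x. L x + a) has_derivative L) (at x)"
      using has_derivative_add[OF bounded_linear_imp_has_derivative[OF assms] has_derivative_const[of a]] by simp
    from has_derivative_compose[OF this differentiable_has_derivative[OF d]]
    show ?thesis by (auto simp: differentiable_def)
  qed
  ultimately show ?case by simp
qed simp

lemma partial_deriv_real_compose:
  fixes h :: "real \<Rightarrow> 'b::real_normed_vector"
  assumes "h differentiable at (g x)" "g differentiable at x"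
  shows "partial_deriv b (\<lambda>x. h (g x)) x = partial_deriv b g x *\<^sub>R partial_deriv 1 h (g x)"
proof -
  let ?H = "frechet_derivative h (at (g x))"
  have H: "(h has_derivative ?H) (at (g x))" using assms(1) by (rule differentiable_has_derivative)
  from has_derivative_compose[OF differentiable_has_derivative[OF assms(2)] H]
  have "partial_deriv b (\<lambda>x. h (g x)) x = ?H (partial_deriv b g x *\<^sub>R 1)"
    by (subst partial_deriv_eq) (auto simp: partial_deriv_def)
  also have "\<dots> = partial_deriv b g x *\<^sub>R ?H 1"
    using has_derivative_bounded_linear[OF H] by (intro linear_cmul bounded_linear.linear)
  finally show ?thesis by (simp add: partial_deriv_def)
qed

text \<open>The chain rule yields \<open>partial_deriv b g\<close> times the composition of the
  derivative of \<open>h\<close> with the same \<open>g\<close>; the induction therefore runs over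
  all \<open>h\<close> with \<open>g\<close> fixed.\<close>

lemma Ck_real_compose:
  fixes h :: "real \<Rightarrow> 'b::real_normed_vector"
  assumes "open S"
  shows "Ck k h UNIV \<Longrightarrow> Ck k g S \<Longrightarrow> Ck k (\<lambda>x. h (g x)) S"
proof (induction k arbitrary: h)
  case (Suc k)
  have "Ck k (partial_deriv b (\<lambda>x. h (g x))) S" if "b \<in> Basis" for b
  proof -
    have "Ck k (\<lambda>x. partial_deriv b g x *\<^sub>R partial_deriv 1 h (g x)) S"
      using Suc.IH[of "partial_deriv 1 h"] Suc.prems that Ck_Suc_D[OF Suc.prems(2)]
      by (intro Ck_scaleR[OF assms]) auto
    then show ?thesis
      using Suc.prems by (intro Ck_eqI[OF assms(1) _ partial_deriv_real_compose]) auto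
  qed
  moreover have "(\<lambda>x. h (g x)) differentiable (at x)" if "x \<in> S" for x
  proof -
    have "g differentiable (at x)" "h differentiable (at (g x))" using Suc.prems that by auto
    then show ?thesis
      using has_derivative_compose[OF differentiable_has_derivative differentiable_has_derivative]
      unfolding differentiable_def by blast
  qed
  ultimately show ?case by simp
qed simp

text \<open>The derivative is built from the inverse itself and one derivative of \<open>g\<close>,
  so order \<open>k\<close> of the inverse yields order \<open>k + 1\<close>.\<close>

lemma Ck_inverse:
  fixes g :: "'a::euclidean_space \<Rightarrow> real"
  assumes "open S" "\<And>x. x \<in> S \<Longrightarrow> g x \<noteq> 0"
  shows "Ck k g S \<Longrightarrow> Ck k (\<lambda>x. inverse (g x)) S"
proof (induction k)
  case (Suc k)
  have D: "((\<lambda>x. inverse (g x)) has_derivative (\<lambda>h. - (inverse (g x) * frechet_derivative g (at x) h * inverse (g x)))) (at x)"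
    if "x \<in> S" for x
    using Deriv.has_derivative_inverse[OF _ differentiable_has_derivative, of g x] Suc.prems that assms(2) by auto
  have e: "partial_deriv b (\<lambda>x. inverse (g x)) x = - (inverse (g x) * partial_deriv b g x * inverse (g x))" if "x \<in> S" for b x
    using partial_deriv_eq[OF D[OF that]] by (simp add: partial_deriv_def)
  have "Ck k (partial_deriv b (\<lambda>x. inverse (g x))) S" if "b \<in> Basis" for b
  proof -
    have "Ck k (\<lambda>x. - (inverse (g x) * partial_deriv b g x * inverse (g x))) S"
      using Suc.IH Suc.prems that Ck_Suc_D[OF Suc.prems]
      by (intro Ck_uminus Ck_mult assms) auto
    then show ?thesis
      using Ck_cong[OF assms(1) e] by simp
  qed
  moreover have "(\<lambda>x. inverse (g x)) differentiable (at x)" if "x \<in> S" for x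
    using D[OF that] by (auto simp: differentiable_def)
  ultimately show ?case by simp
qed simp

text \<open>Away from the origin the derivative in direction \<open>b\<close> is (x \<bullet> b) /
  norm x. It contains the norm only through its inverse, so the induction hypothesis and
  \<open>Ck_inverse\<close> give the next order.\<close>

lemma Ck_norm: "Ck k norm (- {0 :: 'a::euclidean_space})"
proof (induction k)
  case (Suc k)
  have D: "(norm has_derivative (\<lambda>h. h \<bullet> sgn x)) (at x)" if "x \<noteq> 0" for x :: 'a
    using has_derivative_norm[OF that] by simp
  have e: "partial_deriv b norm x = (x \<bullet> b) * inverse (norm x)" if "x \<in> - {0}" for b x :: 'a
    using partial_deriv_eq[OF D[of x]] that by (simp add: sgn_div_norm inner_commute)
  have "Ck k (\<lambda>x. (x \<bullet> b) * inverse (norm x)) (- {0})" for b :: 'a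
    by (rule Ck_mult[OF _ Ck_linear[OF bounded_linear_inner_left] Ck_inverse[OF _ _ Suc]]) auto
  then have "Ck k (partial_deriv b norm) (- {0})" for b :: 'a
    by (rule Ck_eqI[rotated]) (use e in auto)
  moreover have "norm differentiable (at x)" if "x \<noteq> 0" for x :: 'a
    using D[OF that] by (auto simp: differentiable_def)
  ultimately show ?case by simp
qed simp

text \<open>\<open>iter_deriv\<close> adds the newest derivative on the outside, whereas an
  induction over the order removes the innermost one. Splitting a list at its last entry gives the
  recursion that matches \<open>Ck\<close>.\<close>

lemma smooth_partial_deriv_iff:
  "smooth f \<longleftrightarrow> (\<forall>x. f differentiable (at x)) \<and> (\<forall>b\<in>Basis. smooth (partial_deriv b f))"
proof
  assume f: "smooth f"
  have "[] \<in> multi_indices" by (simp add: multi_indices_def)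
  then have "f differentiable (at x)" for x
    using f unfolding smooth_def by (metis iter_deriv.simps(1))
  moreover have "smooth (partial_deriv b f)" if "b \<in> Basis" for b
    unfolding smooth_def
  proof (intro ballI allI)
    fix bs :: "'a list" and x assume "bs \<in> multi_indices"
    then have "bs @ [b] \<in> multi_indices" using that by (auto simp: multi_indices_def)
    then show "iter_deriv bs (partial_deriv b f) differentiable at x"
      using f iter_deriv_snoc unfolding smooth_def by metis
  qed
  ultimately show "(\<forall>x. f differentiable (at x)) \<and> (\<forall>b\<in>Basis. smooth (partial_deriv b f))" by blast
next
  assume f: "(\<forall>x. f differentiable (at x)) \<and> (\<forall>b\<in>Basis. smooth (partial_deriv b f))"
  show "smooth f" unfolding smooth_def
  proof (intro ballI allI)
    fix bs :: "'a list" and x assume bs: "bs \<in> multi_indices"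
    show "iter_deriv bs f differentiable at x"
    proof (cases bs rule: rev_cases)
      case Nil
      then show ?thesis using f by simp
    next
      case (snoc cs b)
      then have "cs \<in> multi_indices" "b \<in> Basis" using bs by (auto simp: multi_indices_def)
      then show ?thesis using f snoc by (auto simp: iter_deriv_snoc smooth_def)
    qed
  qed
qed

text \<open>Closure under sums, products and compositions is proved order by order for
  \<open>Ck\<close>; this equivalence transfers it to smooth functions.\<close>

lemma smooth_Ck: "smooth f \<longleftrightarrow> (\<forall>k. Ck k f UNIV)"
proof
  assume "smooth f"
  then have "Ck k f UNIV" for k
  proof (induction k arbitrary: f)
    case (Suc k)
    then show ?case using smooth_partial_deriv_iff[of f] by simp
  qed simp
  then show "\<forall>k. Ck k f UNIV" by blast
next
  assume f: "\<forall>k. Ck k f UNIV"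
  have "iter_deriv bs f differentiable at x" if "bs \<in> multi_indices" "\<forall>k. Ck k f UNIV" for bs x
    using that
  proof (induction bs arbitrary: f rule: rev_induct)
    case Nil
    then have "Ck 1 f UNIV" by blast
    then show ?case by simp
  next
    case (snoc b bs)
    then have b: "b \<in> Basis" "bs \<in> multi_indices" by (auto simp: multi_indices_def)
    have "Ck k (partial_deriv b f) UNIV" for k using snoc.prems(2)[rule_format, of "Suc k"] b by simp
    then show ?case using snoc.IH[of "partial_deriv b f"] b by (simp add: iter_deriv_snoc)
  qed
  then show "smooth f" using f by (simp add: smooth_def)
qed

lemma smooth_differentiable: "smooth f \<Longrightarrow> f differentiable (at x)"
  using smooth_partial_deriv_iff by blast

lemma smooth_partial_deriv: "smooth f \<Longrightarrow> b \<in> Basis \<Longrightarrow> smooth (partial_deriv b f)"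
  using smooth_partial_deriv_iff by blast

lemma smooth_iter_deriv: "smooth f \<Longrightarrow> bs \<in> multi_indices \<Longrightarrow> smooth (iter_deriv bs f)"
  by (induction bs) (auto simp: iter_deriv_Cons multi_indices_def smooth_partial_deriv simp del: iter_deriv.simps(2))

lemma smooth_continuous: "smooth f \<Longrightarrow> continuous_on S f"
  by (meson continuous_at_imp_continuous_on differentiable_imp_continuous_within smooth_differentiable)

lemma smooth_mult:
  fixes f g :: "'a::euclidean_space \<Rightarrow> 'b::real_normed_algebra"
  shows "smooth f \<Longrightarrow> smooth g \<Longrightarrow> smooth (\<lambda>x. f x * g x)"
  by (simp add: smooth_Ck Ck_mult)

lemma smooth_add: "smooth f \<Longrightarrow> smooth g \<Longrightarrow> smooth (\<lambda>x. f x + g x)"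
  by (simp add: smooth_Ck Ck_add)

lemma smooth_const: "smooth (\<lambda>x. c)"
  by (simp add: smooth_Ck Ck_const)

lemma smooth_sum: "(\<And>i. i \<in> A \<Longrightarrow> smooth (f i)) \<Longrightarrow> smooth (\<lambda>x. \<Sum>i\<in>A. f i x)"
  by (cases "finite A") (auto simp: smooth_Ck Ck_sum Ck_const)

lemma smooth_of_real:
  "smooth f \<Longrightarrow> smooth (\<lambda>x. of_real (f x) :: 'b::{real_normed_algebra_1})"
  by (simp add: smooth_Ck Ck_of_real)

lemma smooth_linear: "bounded_linear L \<Longrightarrow> smooth L"
  by (simp add: smooth_Ck Ck_linear)

lemma smooth_affine:
  "bounded_linear L \<Longrightarrow> smooth f \<Longrightarrow> smooth (\<lambda>x. f (L x + a))"
  by (simp add: smooth_Ck Ck_affine)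

lemma smooth_real_compose:
  fixes h :: "real \<Rightarrow> 'b::real_normed_vector"
  shows "smooth h \<Longrightarrow> smooth g \<Longrightarrow> smooth (\<lambda>x. h (g x))"
  by (simp add: smooth_Ck Ck_real_compose)

section \<open>Iterated derivatives of sums, linear images and dilates\<close>

lemma iter_deriv_add:
  assumes "smooth f" "smooth g" "bs \<in> multi_indices"
  shows "iter_deriv bs (\<lambda>x. f x + g x) = (\<lambda>x. iter_deriv bs f x + iter_deriv bs g x)"
  using assms(3)
proof (induction bs)
  case (Cons b bs)
  then have bs: "bs \<in> multi_indices" by (auto simp: multi_indices_def)
  show ?case unfolding iter_deriv_Cons Cons.IH[OF bs]
    by (rule ext, rule partial_deriv_add) (use assms(1,2) bs in \<open>auto simp: smooth_def\<close>)
qed simp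

lemma iter_deriv_compose_linear:
  assumes "smooth f" "bounded_linear T" "bs \<in> multi_indices"
  shows "iter_deriv bs (\<lambda>x. T (f x)) = (\<lambda>x. T (iter_deriv bs f x))"
  using assms(3)
proof (induction bs)
  case (Cons b bs)
  then have bs: "bs \<in> multi_indices" by (auto simp: multi_indices_def)
  show ?case unfolding iter_deriv_Cons Cons.IH[OF bs]
    by (rule ext, rule partial_deriv_compose_linear) (use assms(1,2) bs in \<open>auto simp: smooth_def\<close>)
qed simp

lemma partial_deriv_scaled:
  assumes "f differentiable at (c *\<^sub>R x + a)" "b \<in> Basis"
  shows "partial_deriv b (\<lambda>x. f (c *\<^sub>R x + a)) x = c *\<^sub>R partial_deriv b f (c *\<^sub>R x + a)"
proof -
  have "partial_deriv b (\<lambda>x. f (c *\<^sub>R x + a)) x = (\<Sum>d\<in>Basis. ((c *\<^sub>R b) \<bullet> d) *\<^sub>R partial_deriv d f (c *\<^sub>R x + a))"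
    by (rule partial_deriv_affine[OF assms(1) bounded_linear_scaleR_right])
  also have "\<dots> = (\<Sum>d\<in>Basis. if d = b then c *\<^sub>R partial_deriv d f (c *\<^sub>R x + a) else 0)"
    by (intro sum.cong) (auto simp: inner_Basis assms(2))
  also have "\<dots> = c *\<^sub>R partial_deriv b f (c *\<^sub>R x + a)"
    by (simp add: assms(2))
  finally show ?thesis .
qed

lemma iter_deriv_scaled:
  fixes f :: "'a::euclidean_space \<Rightarrow> 'b::real_normed_vector"
  assumes "smooth f" "bs \<in> multi_indices"
  shows "iter_deriv bs (\<lambda>x. f (c *\<^sub>R x + a)) = (\<lambda>x. c ^ length bs *\<^sub>R iter_deriv bs f (c *\<^sub>R x + a))"
  using assms(2)
proof (induction bs)
  case (Cons b bs)
  then have bs: "bs \<in> multi_indices" and b: "b \<in> Basis" by (auto simp: multi_indices_def)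
  have d: "iter_deriv bs f differentiable at x" for x using assms(1) bs by (auto simp: smooth_def)
  have D: "(\<lambda>x. iter_deriv bs f (c *\<^sub>R x + a)) differentiable at x" for x
    using smooth_differentiable[OF smooth_affine[OF bounded_linear_scaleR_right smooth_iter_deriv[OF assms(1) bs]]] .
  show ?case unfolding iter_deriv_Cons Cons.IH[OF bs]
    by (rule ext, subst partial_deriv_compose_linear[OF D bounded_linear_scaleR_right])
       (simp add: partial_deriv_scaled[OF d b])
qed simp

text \<open>The norm is not differentiable at the origin, but near it the function is constant; the
  punctured space and a ball around the origin are open sets that cover everything.\<close>

lemma smooth_radial:
  fixes h :: "real \<Rightarrow> real"
  assumes "smooth h" "\<And>t. t < d \<Longrightarrow> h t = c" "0 < d"
  shows "smooth (\<lambda>x::'a::euclidean_space. h (norm x))"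
  unfolding smooth_Ck
proof
  fix k
  have "Ck k (\<lambda>x::'a. h (norm x)) (- {0})"
    by (rule Ck_real_compose[OF _ _ Ck_norm]) (use assms(1) smooth_Ck in auto)
  moreover have "Ck k (\<lambda>x::'a. h (norm x)) (ball 0 d)"
    using Ck_cong[of "ball 0 d" "\<lambda>x::'a. h (norm x)" "\<lambda>_. c" k] Ck_const assms(2) by auto
  ultimately have "Ck k (\<lambda>x::'a. h (norm x)) (- {0} \<union> ball 0 d)" by (rule Ck_Un)
  moreover have "- {0} \<union> ball 0 d = (UNIV :: 'a set)" using assms(3) by auto
  ultimately show "Ck k (\<lambda>x::'a. h (norm x)) UNIV" by simp
qed

section \<open>Smoothness and supports of the Littlewood-Paley functions\<close>

lemma smooth_scaled: "smooth f \<Longrightarrow> smooth (\<lambda>x. f (c *\<^sub>R x + a))"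
  by (rule smooth_affine[OF bounded_linear_scaleR_right])

lemma LP_Psi_eq_1: "LP_cutoff \<Psi> \<Longrightarrow> norm \<xi> < 11/10 * 2 ^ j \<Longrightarrow> LP_Psi \<Psi> j \<xi> = 1"
  by (simp add: LP_cutoff_def LP_Psi_def powr_minus powr_realpow field_simps)

lemma LP_Psi_eq_0: "LP_cutoff \<Psi> \<Longrightarrow> norm \<xi> > 13/10 * 2 ^ j \<Longrightarrow> LP_Psi \<Psi> j \<xi> = 0"
  by (simp add: LP_cutoff_def LP_Psi_def powr_minus powr_realpow field_simps)

lemma smooth_LP_Psi:
  assumes "LP_cutoff \<Psi>"
  shows "smooth (LP_Psi \<Psi> j :: 'a::euclidean_space \<Rightarrow> real)"
proof -
  let ?c = "2 powr (- real j) :: real"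
  have "smooth (\<lambda>x::'a. \<Psi> (norm x))"
    using assms by (intro smooth_radial[of \<Psi> "11/10" 1]) (auto simp: LP_cutoff_def)
  from smooth_scaled[OF this, of ?c 0] show ?thesis
    by (simp add: LP_Psi_def[abs_def])
qed

lemma smooth_LP_Phi:
  assumes "LP_cutoff \<Psi>"
  shows "smooth (LP_Phi \<Psi> j :: 'a::euclidean_space \<Rightarrow> real)"
proof (cases "j = 0")
  case True
  then show ?thesis using smooth_LP_Psi[OF assms] by (simp add: LP_Phi_def[abs_def])
next
  case False
  have "smooth (\<lambda>x::'a. LP_Psi \<Psi> j x + (-1) * LP_Psi \<Psi> (j - 1) x)"
    by (intro smooth_add smooth_mult smooth_const smooth_LP_Psi[OF assms])
  then show ?thesis using False by (simp add: LP_Phi_def[abs_def])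
qed

text \<open>Above 13/10 * 2 ^ j every \<open>LP_Psi\<close> term involved vanishes. Below 11/20 * 2
  ^ j = 11/10 * 2 ^ (j - 1) both terms are 1 and cancel.\<close>

lemma LP_Phi_support:
  assumes "LP_cutoff \<Psi>" "LP_Phi \<Psi> j \<xi> \<noteq> 0"
  shows "norm \<xi> \<le> 13/10 * 2 ^ j" "j > 0 \<Longrightarrow> norm \<xi> \<ge> 11/20 * 2 ^ j"
proof -
  have "LP_Phi \<Psi> j \<xi> = 0" if "norm \<xi> > 13/10 * 2 ^ j"
  proof -
    have "(2::real) ^ (j - 1) \<le> 2 ^ j" by simp
    then have "norm \<xi> > 13/10 * 2 ^ (j - 1)" using that by linarith
    then show ?thesis
      using that assms(1) by (auto simp: LP_Phi_def LP_Psi_eq_0)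
  qed
  then show "norm \<xi> \<le> 13/10 * 2 ^ j" using assms(2) not_le by blast
  assume j: "j > 0"
  have "(2::real) ^ j = 2 * 2 ^ (j - 1)" using j by (cases j) auto
  have "LP_Phi \<Psi> j \<xi> = 0" if "norm \<xi> < 11/20 * 2 ^ j"
  proof -
    have "norm \<xi> < 11/10 * 2 ^ j" "norm \<xi> < 11/10 * 2 ^ (j - 1)"
      using that \<open>2 ^ j = 2 * 2 ^ (j - 1)\<close> norm_ge_zero[of \<xi>] by linarith+
    then show ?thesis
      using that j assms(1) by (auto simp: LP_Phi_def LP_Psi_eq_1)
  qed
  then show "norm \<xi> \<ge> 11/20 * 2 ^ j" using assms(2) not_le by blast
qed

section \<open>Rapidly decreasing functions and oscillatory integrals\<close>

text \<open>The exponent is twice the dimension because the function is then dominated by the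
  product over the coordinates of 1 / (1 + t^2).\<close>

lemma integrable_inverse_one_plus_norm:
  "integrable lborel (\<lambda>x::'a::euclidean_space. inverse ((1 + norm x) ^ (2 * DIM('a))))"
proof -
  have one: "integrable lborel (\<lambda>t::real. inverse (1 + t\<^sup>2))"
    using integrable_inverse_1_plus_square by (simp add: set_integrable_def einterval_def)
  have fin: "(\<integral>\<^sup>+t. ennreal (inverse (1 + t\<^sup>2)) \<partial>lborel) < \<infinity>"
    using one by (subst nn_integral_eq_integral) (auto intro: add_nonneg_nonneg)
  have "inverse ((1 + norm x) ^ (2 * DIM('a))) \<le> (\<Prod>b\<in>Basis. inverse (1 + (x \<bullet> b)\<^sup>2))" for x :: 'a
  proof -
    have "(\<Prod>b\<in>Basis. 1 + (x \<bullet> b)\<^sup>2) \<le> (\<Prod>b\<in>(Basis::'a set). (1 + norm x)\<^sup>2)"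
    proof (intro prod_mono conjI)
      fix b :: 'a assume "b \<in> Basis"
      then have "(x \<bullet> b)\<^sup>2 \<le> (norm x)\<^sup>2"
        using Basis_le_norm[of b x] by (metis abs_ge_zero power2_abs power_mono)
      then show "1 + (x \<bullet> b)\<^sup>2 \<le> (1 + norm x)\<^sup>2"
        using norm_ge_zero[of x] unfolding power2_sum by (simp del: norm_ge_zero)
    qed (simp add: add_nonneg_nonneg)
    also have "\<dots> = (1 + norm x) ^ (2 * DIM('a))" by (simp add: power_mult)
    finally have "(\<Prod>b\<in>Basis. 1 + (x \<bullet> b)\<^sup>2) \<le> (1 + norm x) ^ (2 * DIM('a))" .
    moreover have "(\<Prod>b\<in>Basis. 1 + (x \<bullet> b)\<^sup>2) > 0" by (intro prod_pos) (simp add: add_pos_nonneg)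
    ultimately show ?thesis by (simp add: prod_inversef[unfolded comp_def] le_imp_inverse_le)
  qed
  then have "(\<integral>\<^sup>+x. ennreal (inverse ((1 + norm x) ^ (2 * DIM('a)))) \<partial>(lborel :: 'a measure))
      \<le> (\<integral>\<^sup>+x. (\<Prod>b\<in>Basis. ennreal (inverse (1 + (x \<bullet> b)\<^sup>2))) \<partial>(lborel :: 'a measure))"
    by (intro nn_integral_mono) (auto simp: prod_ennreal add_nonneg_nonneg intro!: ennreal_leI)
  also have "\<dots> = (\<Prod>b\<in>(Basis::'a set). (\<integral>\<^sup>+t. ennreal (inverse (1 + t\<^sup>2)) \<partial>lborel))"
    by (rule nn_integral_lborel_prod) auto
  also have "\<dots> < \<infinity>"
    using fin by (simp add: power_less_top_ennreal)
  finally show ?thesis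
    by (intro integrableI_nonneg) auto
qed

text \<open>Schwartz decay without derivatives: enough for Fourier integrals to exist and to be
  differentiated, and stable under multiplication by continuous functions of polynomial
  growth.\<close>

definition rapid :: "('a::euclidean_space \<Rightarrow> complex) \<Rightarrow> bool" where
  "rapid f \<longleftrightarrow> continuous_on UNIV f \<and> (\<forall>N. \<exists>C. \<forall>x. (1 + norm x) ^ N * norm (f x) \<le> C)"

lemma rapid_continuous: "rapid f \<Longrightarrow> continuous_on S f"
  using continuous_on_subset by (auto simp: rapid_def)

lemma rapidE:
  assumes "rapid f"
  obtains C where "C > 0" "\<And>x. (1 + norm x) ^ N * norm (f x) \<le> C"
proof -
  obtain C where C: "\<And>x. (1 + norm x) ^ N * norm (f x) \<le> C"
    using assms by (auto simp: rapid_def)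
  have "(1 + norm x) ^ N * norm (f x) \<le> max C 1" for x using C[of x] by linarith
  then show ?thesis using that[of "max C 1"] by auto
qed

lemma rapid_mult:
  assumes "rapid f" "continuous_on UNIV g" "\<And>x. norm (g x) \<le> C * (1 + norm x) ^ M"
  shows "rapid (\<lambda>x. g x * f x)"
  unfolding rapid_def
proof (intro conjI allI)
  show "continuous_on UNIV (\<lambda>x. g x * f x)"
    using assms rapid_continuous by (intro continuous_intros) auto
  fix N
  obtain D where D: "\<And>x. (1 + norm x) ^ (M + N) * norm (f x) \<le> D"
    using assms(1) by (auto simp: rapid_def)
  have "(1 + norm x) ^ N * norm (g x * f x) \<le> C * D" for x
  proof -
    have C: "C \<ge> 0" using assms(3)[of 0] norm_ge_zero[of "g 0"] by (simp del: norm_ge_zero)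
    have "(1 + norm x) ^ N * norm (g x * f x) = (1 + norm x) ^ N * (norm (g x) * norm (f x))"
      by (simp add: norm_mult)
    also have "\<dots> \<le> (1 + norm x) ^ N * ((C * (1 + norm x) ^ M) * norm (f x))"
      using assms(3)[of x] by (intro mult_left_mono mult_right_mono) auto
    also have "\<dots> = C * ((1 + norm x) ^ (M + N) * norm (f x))" by (simp add: power_add)
    also have "\<dots> \<le> C * D" using D C by (intro mult_left_mono) auto
    finally show ?thesis .
  qed
  then show "\<exists>C. \<forall>x. (1 + norm x) ^ N * norm (g x * f x) \<le> C" by blast
qed

lemma borel_measurable_continuous: "continuous_on UNIV f \<Longrightarrow> f \<in> borel_measurable lborel"
  using borel_measurable_continuous_onI by simp

lemma rapid_integrable:
  assumes "rapid f"
  shows "integrable lborel f"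
proof -
  obtain C where C: "\<And>x. (1 + norm x) ^ (2 * DIM('a)) * norm (f x) \<le> C"
    using assms by (auto simp: rapid_def)
  show ?thesis
  proof (rule Bochner_Integration.integrable_bound)
    show "integrable lborel (\<lambda>x::'a. C * inverse ((1 + norm x) ^ (2 * DIM('a))))"
      using integrable_inverse_one_plus_norm by (rule integrable_mult_right)
    show "f \<in> borel_measurable lborel"
      using assms by (simp add: rapid_def borel_measurable_continuous del: measurable_lborel1 measurable_lborel2)
    have "norm (f x) \<le> norm (C * inverse ((1 + norm x) ^ (2 * DIM('a))))" for x
    proof -
      have p: "(1 + norm x) ^ (2 * DIM('a)) > 0" by (simp add: add_pos_nonneg)
      then have "norm (f x) \<le> C / (1 + norm x) ^ (2 * DIM('a))"
        using C[of x] by (simp add: pos_le_divide_eq mult.commute)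
      then show ?thesis by (simp add: divide_inverse)
    qed
    then show "AE x in lborel. norm (f x) \<le> norm (C * inverse ((1 + norm x) ^ (2 * DIM('a))))" by simp
  qed
qed

text \<open>The Fourier integral with positive sign and without normalisation.
  \<open>fourier\<close> is its reflection and \<open>inverse_fourier\<close> a multiple of it, so
  the analysis is done for this one operator.\<close>

definition osc_int :: "('a::euclidean_space \<Rightarrow> complex) \<Rightarrow> 'a \<Rightarrow> complex" where
  "osc_int \<psi> x = (LINT \<xi>|lborel. exp (\<i> * of_real (x \<bullet> \<xi>)) * \<psi> \<xi>)"

lemma norm_exp_i_real [simp]: "norm (exp (\<i> * of_real t)) = 1"
  by (simp add: norm_exp_i_times)

lemma rapid_exp_mult: "rapid f \<Longrightarrow> rapid (\<lambda>\<xi>. exp (\<i> * of_real (x \<bullet> \<xi>)) * f \<xi>)"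
  by (rule rapid_mult[where C=1 and M=0]) (auto intro!: continuous_intros)

lemma rapid_inner_mult: "rapid f \<Longrightarrow> rapid (\<lambda>\<xi>. (\<i> * of_real (h \<bullet> \<xi>)) * f \<xi>)"
proof (rule rapid_mult[where C="norm h" and M=1])
  show "norm (\<i> * complex_of_real (h \<bullet> x)) \<le> norm h * (1 + norm x) ^ 1" for x
    using Cauchy_Schwarz_ineq2[of h x] norm_ge_zero[of h]
    by (simp add: norm_mult algebra_simps del: norm_ge_zero)
qed (auto intro!: continuous_intros)

lemma rapid_norm_power: "rapid f \<Longrightarrow> rapid (\<lambda>\<xi>. of_real (norm \<xi> ^ M) * f \<xi>)"
  by (rule rapid_mult[where C=1 and M=M]) (auto intro!: continuous_intros power_mono simp: norm_power)

text \<open>A non-integrable \<open>f\<close> has integral 0 by convention, and the majorant is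
  non-negative, so that case is covered as well.\<close>

lemma norm_integral_le:
  fixes f :: "'a \<Rightarrow> 'b::{banach, second_countable_topology}"
  assumes "integrable M g" "\<And>x. norm (f x) \<le> g x"
  shows "norm (\<integral>x. f x \<partial>M) \<le> (\<integral>x. g x \<partial>M)"
proof (cases "integrable M f")
  case True
  then have "(\<integral>x. norm (f x) \<partial>M) \<le> (\<integral>x. g x \<partial>M)"
    using assms by (intro integral_mono) auto
  then show ?thesis using integral_norm_bound[of M f] by linarith
next
  case False
  have "0 \<le> g x" for x using assms(2)[of x] norm_ge_zero[of "f x"] by linarith
  then show ?thesis using False by (simp add: not_integrable_integral_eq)
qed

text \<open>The Taylor bound for the exponential leaves a remainder of at most the square of
  \<open>norm h\<close> times the second absolute moment \<open>K\<close> of \<open>\<psi>\<close>,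
  so the derivative is found without a limit theorem for integrals.\<close>

lemma osc_int_has_derivative:
  assumes "rapid \<psi>"
  shows "(osc_int \<psi> has_derivative (\<lambda>h. osc_int (\<lambda>\<xi>. (\<i> * of_real (h \<bullet> \<xi>)) * \<psi> \<xi>) x)) (at x)"
proof -
  define D where "D = (\<lambda>h. osc_int (\<lambda>\<xi>. (\<i> * of_real (h \<bullet> \<xi>)) * \<psi> \<xi>) x)"
  define A where "A = (LINT \<xi>|lborel. norm (of_real (norm \<xi> ^ 1) * \<psi> \<xi>))"
  define K where "K = (LINT \<xi>|lborel. norm (of_real (norm \<xi> ^ 2) * \<psi> \<xi>))"
  note int = rapid_integrable[OF rapid_exp_mult[OF assms]]
  note intD = rapid_integrable[OF rapid_exp_mult[OF rapid_inner_mult[OF assms]]]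
  have "bounded_linear D"
  proof (rule bounded_linear_intro[where K=A])
    show "D (h + k) = D h + D k" for h k
      unfolding D_def osc_int_def
      by (subst Bochner_Integration.integral_add[OF intD intD, symmetric])
         (simp add: inner_add_left algebra_simps)
    show "D (r *\<^sub>R h) = r *\<^sub>R D h" for r h
      unfolding D_def osc_int_def integral_scaleR_right[symmetric]
      by (intro Bochner_Integration.integral_cong) (auto simp: scaleR_conv_of_real)
    show "norm (D h) \<le> norm h * A" for h
    proof -
      have "norm (D h) \<le> (LINT \<xi>|lborel. norm (exp (\<i> * of_real (x \<bullet> \<xi>)) * (\<i> * of_real (h \<bullet> \<xi>) * \<psi> \<xi>)))"
        unfolding D_def osc_int_def by (rule integral_norm_bound)
      also have "\<dots> \<le> (LINT \<xi>|lborel. norm h * norm (of_real (norm \<xi> ^ 1) * \<psi> \<xi>))"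
        using intD rapid_integrable[OF rapid_norm_power[OF assms, of 1]] Cauchy_Schwarz_ineq2[of h]
        by (intro integral_mono integrable_norm integrable_mult_right)
           (auto simp: norm_mult mult_right_mono mult.assoc[symmetric])
      finally show ?thesis by (simp add: A_def)
    qed
  qed
  moreover have "norm (osc_int \<psi> (x + h) - osc_int \<psi> x - D h) \<le> (norm h)\<^sup>2 * K" for h
  proof -
    have eq: "osc_int \<psi> (x + h) - osc_int \<psi> x - D h = (LINT \<xi>|lborel.
        exp (\<i> * of_real (x \<bullet> \<xi>)) * (exp (\<i> * of_real (h \<bullet> \<xi>)) - 1 - \<i> * of_real (h \<bullet> \<xi>)) * \<psi> \<xi>)"
      (is "_ = (LINT \<xi>|_. ?g \<xi>)")
    proof -
      note int1 = rapid_integrable[OF rapid_exp_mult[OF assms, of "x + h"]]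
      note i1 = Bochner_Integration.integral_diff[OF Bochner_Integration.integrable_diff[OF int1 int] intD]
      note i2 = Bochner_Integration.integral_diff[OF int1 int]
      show ?thesis unfolding D_def osc_int_def i2[symmetric] i1[symmetric]
        by (rule Bochner_Integration.integral_cong[OF refl])
           (simp add: inner_add_left exp_add algebra_simps)
    qed
    have b: "norm (?g \<xi>) \<le> (norm h)\<^sup>2 * norm (of_real (norm \<xi> ^ 2) * \<psi> \<xi>)" for \<xi>
    proof -
      have "norm (exp (\<i> * of_real (h \<bullet> \<xi>)) - 1 - \<i> * of_real (h \<bullet> \<xi>)) \<le> \<bar>h \<bullet> \<xi>\<bar>\<^sup>2 / 2"
        using iexp_approx1[of "h \<bullet> \<xi>" 1] by (simp add: algebra_simps eval_nat_numeral)
      also have "\<dots> \<le> (norm h * norm \<xi>)\<^sup>2 / 1"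
        using Cauchy_Schwarz_ineq2[of h \<xi>] by (intro frac_le power_mono) auto
      finally show ?thesis
        by (simp add: norm_mult norm_power power_mult_distrib mult_right_mono mult.assoc[symmetric])
    qed
    have "integrable lborel (\<lambda>\<xi>. (norm h)\<^sup>2 * norm (of_real (norm \<xi> ^ 2) * \<psi> \<xi>))"
      using rapid_integrable[OF rapid_norm_power[OF assms]] by (intro integrable_mult_right integrable_norm)
    from norm_integral_le[OF this b]
    have "norm (LINT \<xi>|lborel. ?g \<xi>) \<le> (LINT \<xi>|lborel. (norm h)\<^sup>2 * norm (of_real (norm \<xi> ^ 2) * \<psi> \<xi>))" .
    then show ?thesis unfolding eq K_def by simp
  qed
  note rem = this
  have "((\<lambda>h. norm (osc_int \<psi> (x + h) - osc_int \<psi> x - D h) / norm h) \<longlongrightarrow> 0) (at 0)"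
  proof (rule Lim_null_comparison)
    show "\<forall>\<^sub>F h in at 0. norm (norm (osc_int \<psi> (x + h) - osc_int \<psi> x - D h) / norm h) \<le> norm h * K"
      using rem by (auto simp: eventually_at_filter divide_le_eq power2_eq_square mult_ac)
    show "((\<lambda>h::'a. norm h * K) \<longlongrightarrow> 0) (at 0)"
      by (rule tendsto_eq_intros | simp)+
  qed
  ultimately show ?thesis unfolding has_derivative_at D_def by simp
qed

text \<open>The Fourier symbol of \<open>iter_deriv bs\<close>.\<close>

definition i_monomial :: "'a::euclidean_space list \<Rightarrow> 'a \<Rightarrow> complex" where
  "i_monomial bs \<xi> = prod_list (map (\<lambda>b. \<i> * of_real (b \<bullet> \<xi>)) bs)"

lemma i_monomial_Cons: "i_monomial (b # bs) \<xi> = (\<i> * of_real (b \<bullet> \<xi>)) * i_monomial bs \<xi>"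
  by (simp add: i_monomial_def)

lemma rapid_i_monomial_mult: "rapid \<psi> \<Longrightarrow> rapid (\<lambda>\<xi>. i_monomial bs \<xi> * \<psi> \<xi>)"
  by (induction bs) (auto simp: i_monomial_Cons mult.assoc rapid_inner_mult[unfolded mult.assoc] i_monomial_def[of "[]"])

lemma partial_deriv_osc_int: "rapid \<psi> \<Longrightarrow> partial_deriv b (osc_int \<psi>) = osc_int (\<lambda>\<xi>. (\<i> * of_real (b \<bullet> \<xi>)) * \<psi> \<xi>)"
  using partial_deriv_eq[OF osc_int_has_derivative] by blast

lemma iter_deriv_osc_int: "rapid \<psi> \<Longrightarrow> iter_deriv bs (osc_int \<psi>) = osc_int (\<lambda>\<xi>. i_monomial bs \<xi> * \<psi> \<xi>)"
proof (induction bs)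
  case (Cons b bs)
  then show ?case
    by (simp only: iter_deriv_Cons Cons.IH partial_deriv_osc_int[OF rapid_i_monomial_mult] i_monomial_Cons mult.assoc)
qed (simp add: i_monomial_def)

lemma smooth_osc_int: "rapid \<psi> \<Longrightarrow> smooth (osc_int \<psi>)"
  unfolding smooth_def iter_deriv_osc_int
  using osc_int_has_derivative[OF rapid_i_monomial_mult] by (auto simp: iter_deriv_osc_int differentiable_def)

section \<open>Test functions\<close>

lemma test_functionI:
  assumes "smooth f" "\<And>x. norm x > R \<Longrightarrow> f x = 0"
  shows "test_function f"
proof -
  have "{x. f x \<noteq> 0} \<subseteq> cball 0 R" using assms(2) by (force simp: not_less[symmetric])
  then show ?thesis
    using assms(1) by (simp add: test_function_def) (meson bounded_cball bounded_subset)
qed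

lemma test_functionE:
  assumes "test_function f"
  obtains R where "R > 0" "\<And>x. norm x > R \<Longrightarrow> f x = 0"
proof -
  have "bounded (closure {x. f x \<noteq> 0})" using assms by (simp add: test_function_def compact_imp_bounded)
  then obtain R where "R > 0" "\<And>x. x \<in> closure {x. f x \<noteq> 0} \<Longrightarrow> norm x \<le> R"
    by (auto simp: bounded_pos)
  then show ?thesis using that[of R] closure_subset[of "{x. f x \<noteq> 0}"]
    by (metis (mono_tags, lifting) mem_Collect_eq not_le subsetD)
qed

lemma test_function_smooth: "test_function f \<Longrightarrow> smooth f"
  by (simp add: test_function_def)

lemma test_function_mult:
  assumes "test_function f" "smooth g"
  shows "test_function (\<lambda>x. g x * f x)"
proof -
  obtain R where R: "\<And>x. norm x > R \<Longrightarrow> f x = 0" using test_functionE[OF assms(1)] by metis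
  show ?thesis
    by (rule test_functionI[of _ R]) (use assms R smooth_mult test_function_smooth in auto)
qed

lemma test_function_partial_deriv:
  assumes "test_function f" "b \<in> Basis"
  shows "test_function (partial_deriv b f)"
proof -
  obtain R where R: "\<And>x. norm x > R \<Longrightarrow> f x = 0" using test_functionE[OF assms(1)] by metis
  show ?thesis
  proof (rule test_functionI[of _ R])
    show "smooth (partial_deriv b f)" using assms test_function_smooth smooth_partial_deriv by blast
    fix x :: 'a assume x: "norm x > R"
    have "(f has_derivative (\<lambda>_. 0)) (at x)"
      by (rule has_derivative_transform_within_open[of "\<lambda>_. 0" _ _ _ "- cball 0 R"]) (use x R in auto)
    then show "partial_deriv b f x = 0" by (rule partial_deriv_eq)
  qed
qed

lemma test_function_rapid:
  assumes "test_function f"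
  shows "rapid f"
  unfolding rapid_def
proof (intro conjI allI)
  have c: "continuous_on UNIV f" by (rule smooth_continuous[OF test_function_smooth[OF assms]])
  then show "continuous_on UNIV f" .
  fix N
  obtain R where R: "\<And>x. norm x > R \<Longrightarrow> f x = 0" using test_functionE[OF assms] by metis
  have "continuous_on (cball 0 R) (\<lambda>x. (1 + norm x) ^ N * norm (f x))"
    using continuous_on_subset[OF c] by (intro continuous_intros) auto
  then have "compact ((\<lambda>x. (1 + norm x) ^ N * norm (f x)) ` cball 0 R)"
    by (rule compact_continuous_image) simp
  from compact_imp_bounded[OF this]
  obtain C where C: "C > 0" "\<forall>y\<in>(\<lambda>x. (1 + norm x) ^ N * norm (f x)) ` cball 0 R. norm y \<le> C"
    unfolding bounded_pos by blast
  have "(1 + norm x) ^ N * norm (f x) \<le> C" for x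
    using C R[of x] by (cases "norm x \<le> R") auto
  then show "\<exists>C. \<forall>x. (1 + norm x) ^ N * norm (f x) \<le> C" by blast
qed

section \<open>Change of variables and integration by parts\<close>

lemma lborel_integral_affine:
  fixes f :: "'a::euclidean_space \<Rightarrow> 'b::{banach, second_countable_topology}"
  assumes [measurable]: "f \<in> borel_measurable borel" and "c \<noteq> 0"
  shows "(LINT x|lborel. f x) = \<bar>c\<bar> ^ DIM('a) *\<^sub>R (LINT x|lborel. f (t + c *\<^sub>R x))"
  by (subst lborel_affine[OF assms(2), of t])
     (simp add: integral_density integral_distr)

lemma lborel_nn_integral_affine:
  fixes f :: "'a::euclidean_space \<Rightarrow> ennreal"
  assumes [measurable]: "f \<in> borel_measurable borel" and "c \<noteq> 0"
  shows "(\<integral>\<^sup>+x. f x \<partial>lborel) = ennreal (\<bar>c\<bar> ^ DIM('a)) * (\<integral>\<^sup>+x. f (t + c *\<^sub>R x) \<partial>lborel)"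
  by (subst lborel_affine[OF assms(2), of t])
     (simp add: nn_integral_density nn_integral_distr nn_integral_cmult)

lemma lborel_integrable_affine:
  fixes f :: "'a::euclidean_space \<Rightarrow> 'b::{banach, second_countable_topology}"
  assumes "integrable lborel f" and "c \<noteq> 0"
  shows "integrable lborel (\<lambda>x. f (t + c *\<^sub>R x))"
proof -
  have [measurable]: "f \<in> borel_measurable borel"
    using borel_measurable_integrable[OF assms(1)] by simp
  have "(\<integral>\<^sup>+x. norm (f x) \<partial>lborel) < \<infinity>" using assms(1) by (simp add: integrable_iff_bounded)
  then have "(\<integral>\<^sup>+x. norm (f (t + c *\<^sub>R x)) \<partial>lborel) < \<infinity>"
    using lborel_nn_integral_affine[of "\<lambda>x. norm (f x)" c t] assms(2)
    by (auto simp: ennreal_mult_less_top)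
  then show ?thesis by (simp add: integrable_iff_bounded)
qed

text \<open>By translation invariance the integral of every difference quotient of \<open>g\<close>
  vanishes; dominated convergence passes to the derivative.\<close>

lemma integral_partial_deriv_eq_0:
  assumes g: "test_function g" and b: "b \<in> Basis"
  shows "(LINT x|lborel. partial_deriv b g x) = 0"
proof -
  obtain R where R: "R > 0" "\<And>x. norm x > R \<Longrightarrow> g x = 0" using test_functionE[OF g] by metis
  obtain C where C: "C > 0" "\<And>x. norm (partial_deriv b g x) \<le> C"
    using rapidE[OF test_function_rapid[OF test_function_partial_deriv[OF g b]], of 0] by auto
  have cont: "continuous_on UNIV g" by (rule smooth_continuous[OF test_function_smooth[OF g]])
  then have [measurable]: "g \<in> borel_measurable borel" by (rule borel_measurable_continuous_onI)
  have [measurable]: "partial_deriv b g \<in> borel_measurable borel"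
    by (intro borel_measurable_continuous_onI smooth_continuous test_function_smooth test_function_partial_deriv g b)
  have int: "integrable lborel g" by (rule rapid_integrable[OF test_function_rapid[OF g]])
  let ?h = "\<lambda>n. inverse (real (Suc n))"
  let ?F = "\<lambda>n x. real (Suc n) *\<^sub>R (g (x + ?h n *\<^sub>R b) - g x)"
  have vd: "((\<lambda>s. g (x + s *\<^sub>R b)) has_vector_derivative partial_deriv b g (x + s *\<^sub>R b)) (at s)" for x s
  proof -
    have 1: "((\<lambda>s. x + s *\<^sub>R b) has_derivative (\<lambda>t. t *\<^sub>R b)) (at s)"
      by (auto intro!: derivative_eq_intros)
    have 2: "(g has_derivative frechet_derivative g (at (x + s *\<^sub>R b))) (at (x + s *\<^sub>R b))"
      by (rule differentiable_has_derivative[OF smooth_differentiable[OF test_function_smooth[OF g]]])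
    show ?thesis using has_derivative_compose[OF 1 2]
      unfolding has_vector_derivative_def partial_deriv_def
      using linear_cmul[OF bounded_linear.linear[OF has_derivative_bounded_linear[OF 2]]] by simp
  qed
  \<comment> \<open>The quotients are bounded by the bound \<open>C\<close> of the derivative. As
    the increments have length at most 1, they vanish outside the ball of radius
    \<open>R + 1\<close>.\<close>
  have "(\<lambda>n. LINT x|lborel. ?F n x) \<longlonglongrightarrow> (LINT x|lborel. partial_deriv b g x)"
  proof (rule integral_dominated_convergence[where w="\<lambda>x. C * indicator (cball 0 (R + 1)) x"])
    show "partial_deriv b g \<in> borel_measurable lborel" by simp
    show "(\<lambda>x. real (Suc i) *\<^sub>R (g (x + inverse (real (Suc i)) *\<^sub>R b) - g x)) \<in> borel_measurable lborel" for i
      by simp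
    show "integrable lborel (\<lambda>x::'a. C * indicator (cball 0 (R + 1)) x)"
      by (intro integrable_mult_right integrable_real_indicator)
         (use emeasure_lborel_cball_finite in auto)
    have "(\<lambda>n. ?F n x) \<longlonglongrightarrow> partial_deriv b g x" for x
    proof -
      have "((\<lambda>h. norm (g (x + h *\<^sub>R b) - g x - h *\<^sub>R partial_deriv b g x) / norm h) \<longlongrightarrow> 0) (at 0)"
        using vd[of x 0] unfolding has_vector_derivative_def has_derivative_at by simp
      moreover have "filterlim ?h (at 0) sequentially"
        unfolding filterlim_at using LIMSEQ_inverse_real_of_nat by auto
      ultimately have "(\<lambda>n. norm (g (x + ?h n *\<^sub>R b) - g x - ?h n *\<^sub>R partial_deriv b g x) / norm (?h n)) \<longlonglongrightarrow> 0"
        by (rule filterlim_compose)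
      moreover have "norm (g (x + ?h n *\<^sub>R b) - g x - ?h n *\<^sub>R partial_deriv b g x) / norm (?h n) = norm (?F n x - partial_deriv b g x)" for n
      proof -
        have "norm (g (x + ?h n *\<^sub>R b) - g x - ?h n *\<^sub>R partial_deriv b g x) / norm (?h n)
            = norm (real (Suc n) *\<^sub>R (g (x + ?h n *\<^sub>R b) - g x - ?h n *\<^sub>R partial_deriv b g x))"
          by (simp add: divide_inverse)
        also have "real (Suc n) *\<^sub>R (g (x + ?h n *\<^sub>R b) - g x - ?h n *\<^sub>R partial_deriv b g x) = ?F n x - partial_deriv b g x"
          unfolding scaleR_diff_right by simp
        finally show ?thesis .
      qed
      ultimately have "(\<lambda>n. norm (?F n x - partial_deriv b g x)) \<longlonglongrightarrow> 0" by simp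
      from LIM_zero_cancel[OF tendsto_norm_zero_cancel[OF this]] show ?thesis .
    qed
    then show "AE x in lborel. (\<lambda>n. ?F n x) \<longlonglongrightarrow> partial_deriv b g x" by simp
    have "norm (?F n x) \<le> C * indicator (cball 0 (R + 1)) x" for n x
    proof (cases "norm x \<le> R + 1")
      case True
      have "norm (g (x + ?h n *\<^sub>R b) - g (x + 0 *\<^sub>R b)) \<le> C * norm (?h n - 0)"
      proof (rule differentiable_bound[of UNIV])
        show "((\<lambda>s. g (x + s *\<^sub>R b)) has_derivative (\<lambda>t. t *\<^sub>R partial_deriv b g (x + s *\<^sub>R b))) (at s within UNIV)" for s
          using vd by (simp add: has_vector_derivative_def)
        show "onorm (\<lambda>t. t *\<^sub>R partial_deriv b g (x + s *\<^sub>R b)) \<le> C" for s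
          using mult_right_mono[OF C(2) abs_ge_zero] by (intro onorm_le) (simp add: mult.commute)
      qed auto
      then have "real (Suc n) * norm (g (x + ?h n *\<^sub>R b) - g x) \<le> real (Suc n) * (C * ?h n)"
        by (intro mult_left_mono) simp_all
      moreover have "real (Suc n) * (C * ?h n) = C" by (simp del: of_nat_Suc)
      ultimately have "norm (?F n x) \<le> C"
        by (simp only: norm_scaleR abs_of_nat)
      then show ?thesis using True by simp
    next
      case False
      have "norm (?h n *\<^sub>R b) \<le> 1" using b by (simp add: field_simps)
      then have "norm (x + ?h n *\<^sub>R b) > R"
        using False norm_triangle_ineq4[of "x + ?h n *\<^sub>R b" "?h n *\<^sub>R b"] by simp
      then show ?thesis using False R by simp
    qed
    then show "AE x in lborel. norm (?F n x) \<le> C * indicator (cball 0 (R + 1)) x" for n by simp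
  qed
  moreover have "(LINT x|lborel. ?F n x) = 0" for n
  proof -
    have "(LINT x|lborel. g (x + ?h n *\<^sub>R b)) = (LINT x|lborel. g x)"
      using lborel_integral_affine[of g 1 "?h n *\<^sub>R b"] by (simp add: add.commute)
    moreover have "integrable lborel (\<lambda>x. g (x + ?h n *\<^sub>R b))"
      using lborel_integrable_affine[OF int, of 1 "?h n *\<^sub>R b"] by (simp add: add.commute)
    ultimately show ?thesis using int by simp
  qed
  ultimately have "(\<lambda>n. 0) \<longlonglongrightarrow> (LINT x|lborel. partial_deriv b g x)" by simp
  then show ?thesis by (simp add: LIMSEQ_const_iff)
qed

lemma exp_i_has_derivative:
  "((\<lambda>t::real. exp (\<i> * of_real t)) has_derivative (\<lambda>h. h *\<^sub>R (\<i> * exp (\<i> * of_real t)))) (at t)"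
proof -
  have "((\<lambda>z. exp (\<i> * z)) has_field_derivative (\<i> * exp (\<i> * of_real t))) (at (of_real t))"
    by (auto intro!: derivative_eq_intros)
  from has_vector_derivative_real_field[OF this, of UNIV] show ?thesis
    by (simp add: has_vector_derivative_def)
qed

lemma smooth_exp_inner: "smooth (\<lambda>\<xi>::'a::euclidean_space. exp (\<i> * of_real (x \<bullet> \<xi>)))"
proof -
  let ?h = "\<lambda>t::real. exp (\<i> * of_real t)"
  have D: "(?h has_derivative (\<lambda>h. h *\<^sub>R (\<i> * ?h t))) (at t)" for t
    by (rule exp_i_has_derivative)
  have "Ck k ?h UNIV" for k
  proof (induction k)
    case (Suc k)
    have "partial_deriv 1 ?h = (\<lambda>t. \<i> * ?h t)" using partial_deriv_eq[OF D] by auto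
    then show ?case using Suc D by (auto simp: differentiable_def intro!: Ck_mult Ck_const)
  qed simp
  then have "smooth ?h" by (simp add: smooth_Ck)
  then show ?thesis
    by (rule smooth_real_compose) (rule smooth_linear[OF bounded_linear_inner_right])
qed

text \<open>Integration by parts: the derivative of the exponential times \<open>\<psi>\<close> has
  integral 0, and differentiating the exponential produces the factor x \<bullet> b.\<close>

lemma osc_int_partial_deriv:
  assumes "test_function \<psi>" "b \<in> Basis"
  shows "of_real (x \<bullet> b) * osc_int \<psi> x = \<i> * osc_int (partial_deriv b \<psi>) x"
proof -
  let ?e = "\<lambda>\<xi>. exp (\<i> * of_real (x \<bullet> \<xi>))"
  have De: "(?e has_derivative (\<lambda>h. \<i> * of_real (x \<bullet> h) * ?e \<xi>)) (at \<xi>)" for \<xi>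
    using has_derivative_compose[OF bounded_linear_imp_has_derivative[OF bounded_linear_inner_right] exp_i_has_derivative]
    by (simp add: scaleR_conv_of_real mult_ac)
  have "partial_deriv b (\<lambda>\<xi>. ?e \<xi> * \<psi> \<xi>) \<xi> = (\<i> * of_real (x \<bullet> b)) * (?e \<xi> * \<psi> \<xi>) + ?e \<xi> * partial_deriv b \<psi> \<xi>" for \<xi>
    unfolding partial_deriv_bilinear[OF bounded_bilinear_mult smooth_differentiable[OF smooth_exp_inner]
        smooth_differentiable[OF test_function_smooth[OF assms(1)]]]
    using partial_deriv_eq[OF De[of \<xi>]] by (simp add: mult.assoc)
  then have "(LINT \<xi>|lborel. (\<i> * of_real (x \<bullet> b)) * (?e \<xi> * \<psi> \<xi>) + ?e \<xi> * partial_deriv b \<psi> \<xi>) = 0"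
    using integral_partial_deriv_eq_0[OF test_function_mult[OF assms(1) smooth_exp_inner] assms(2), of x] by simp
  moreover have "integrable lborel (\<lambda>\<xi>. ?e \<xi> * \<psi> \<xi>)" "integrable lborel (\<lambda>\<xi>. ?e \<xi> * partial_deriv b \<psi> \<xi>)"
    by (intro rapid_integrable rapid_exp_mult test_function_rapid test_function_partial_deriv assms)+
  ultimately have "(\<i> * of_real (x \<bullet> b)) * osc_int \<psi> x + osc_int (partial_deriv b \<psi>) x = 0"
    by (simp add: osc_int_def)
  then have "\<i> * ((\<i> * of_real (x \<bullet> b)) * osc_int \<psi> x + osc_int (partial_deriv b \<psi>) x) = 0" by simp
  then show ?thesis by (simp add: algebra_simps)
qed

text \<open>Each factor \<open>1 + norm x\<close> is paid for by one derivative of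
  \<open>\<psi>\<close>, so the induction over \<open>N\<close> is for all test functions at
  once.\<close>

lemma osc_int_decay:
  assumes "test_function \<psi>"
  shows "\<exists>C. \<forall>x. (1 + norm x) ^ N * norm (osc_int \<psi> x) \<le> C"
  using assms
proof (induction N arbitrary: \<psi>)
  case 0
  have "norm (osc_int \<psi> x) \<le> (LINT \<xi>|lborel. norm (\<psi> \<xi>))" for x
    unfolding osc_int_def by (rule order_trans[OF integral_norm_bound]) (simp add: norm_mult)
  then show ?case by auto
next
  case (Suc N)
  have "\<exists>C. \<forall>x. (1 + norm x) ^ N * norm (osc_int (partial_deriv b \<psi>) x) \<le> C" if "b \<in> Basis" for b
    using Suc that test_function_partial_deriv by blast
  then obtain C where C: "\<And>b x. b \<in> Basis \<Longrightarrow> (1 + norm x) ^ N * norm (osc_int (partial_deriv b \<psi>) x) \<le> C b" by metis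
  obtain D where D: "\<And>x. (1 + norm x) ^ N * norm (osc_int \<psi> x) \<le> D" using Suc by blast
  have "(1 + norm x) ^ Suc N * norm (osc_int \<psi> x) \<le> D + sum C Basis" for x
  proof -
    have "(1 + norm x) ^ Suc N * norm (osc_int \<psi> x) =
        (1 + norm x) ^ N * norm (osc_int \<psi> x) + (1 + norm x) ^ N * (norm x * norm (osc_int \<psi> x))"
      by (simp add: algebra_simps)
    also have "norm x * norm (osc_int \<psi> x) \<le> (\<Sum>b\<in>Basis. \<bar>x \<bullet> b\<bar>) * norm (osc_int \<psi> x)"
      by (intro mult_right_mono norm_le_l1) auto
    also have "\<dots> = (\<Sum>b\<in>Basis. norm (of_real (x \<bullet> b) * osc_int \<psi> x))"
      by (simp add: sum_distrib_right norm_mult)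
    also have "\<dots> = (\<Sum>b\<in>Basis. norm (osc_int (partial_deriv b \<psi>) x))"
      using osc_int_partial_deriv[OF Suc.prems] by (intro sum.cong) (auto simp: norm_mult)
    also have "(1 + norm x) ^ N * (\<Sum>b\<in>Basis. norm (osc_int (partial_deriv b \<psi>) x)) \<le> sum C Basis"
      unfolding sum_distrib_left using C by (intro sum_mono) auto
    finally show ?thesis using D[of x] by (simp add: mult_left_mono)
  qed
  then show ?case by blast
qed

section \<open>Schwartz functions\<close>

lemma schwartzI:
  assumes "smooth f" "\<And>N bs. bs \<in> multi_indices \<Longrightarrow> \<exists>C. \<forall>x. (1 + norm x) ^ N * norm (iter_deriv bs f x) \<le> C"
  shows "schwartz f"
  using assms unfolding schwartz_def bounded_iff by (fastforce simp: add_nonneg_nonneg)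

lemma schwartzE:
  assumes "schwartz f" "bs \<in> multi_indices"
  obtains C where "C > 0" "\<And>x. (1 + norm x) ^ N * norm (iter_deriv bs f x) \<le> C"
proof -
  have "bounded (range (\<lambda>x. (1 + norm x) ^ N *\<^sub>R iter_deriv bs f x))"
    using assms unfolding schwartz_def by blast
  then obtain C where "C > 0" "\<forall>x. norm ((1 + norm x) ^ N *\<^sub>R iter_deriv bs f x) \<le> C"
    unfolding bounded_pos by auto
  then show ?thesis using that by (simp add: add_nonneg_nonneg)
qed

lemma test_function_i_monomial_mult:
  assumes "test_function \<psi>"
  shows "test_function (\<lambda>\<xi>. i_monomial bs \<xi> * \<psi> \<xi>)"
proof (rule test_function_mult[OF assms])
  show "smooth (i_monomial bs)"
  proof (induction bs)
    case Nil
    then show ?case using smooth_const[of 1] by (simp add: i_monomial_def[abs_def])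
  next
    case (Cons b bs)
    then show ?case unfolding i_monomial_Cons[abs_def]
      by (intro smooth_mult smooth_const smooth_of_real smooth_linear[OF bounded_linear_inner_right])
  qed
qed

lemma schwartz_osc_int:
  assumes "test_function \<psi>"
  shows "schwartz (osc_int \<psi>)"
  by (rule schwartzI)
     (simp_all add: smooth_osc_int test_function_rapid assms iter_deriv_osc_int osc_int_decay test_function_i_monomial_mult)

lemma test_function_schwartz:
  assumes "test_function f"
  shows "schwartz f"
proof (rule schwartzI)
  show "smooth f" by (rule test_function_smooth[OF assms])
  fix N and bs :: "'a list" assume "bs \<in> multi_indices"
  then have "test_function (iter_deriv bs f)"
  proof (induction bs)
    case (Cons b bs)
    then have b: "b \<in> Basis" "bs \<in> multi_indices" by (auto simp: multi_indices_def)
    show ?case unfolding iter_deriv_Cons by (rule test_function_partial_deriv[OF Cons.IH[OF b(2)] b(1)])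
  qed (simp add: assms)
  from test_function_rapid[OF this] show "\<exists>C. \<forall>x. (1 + norm x) ^ N * norm (iter_deriv bs f x) \<le> C"
    by (simp add: rapid_def)
qed

lemma schwartz_smooth: "schwartz f \<Longrightarrow> smooth f"
  by (simp add: schwartz_def)

lemma Nil_multi_indices [simp]: "[] \<in> multi_indices"
  by (simp add: multi_indices_def)

lemma schwartz_rapid: "schwartz f \<Longrightarrow> rapid f"
  unfolding rapid_def
  using schwartzE[of f "[]"] smooth_continuous[OF schwartz_smooth]
  by (metis Nil_multi_indices iter_deriv.simps(1))

section \<open>Fourier inversion\<close>

context
begin

interpretation product_sigma_finite "\<lambda>_::'a. lborel :: real measure" ..

lemma integral_lborel_prod:
  fixes f :: "'a::euclidean_space \<Rightarrow> real \<Rightarrow> complex"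
  assumes "\<And>b. b \<in> Basis \<Longrightarrow> integrable lborel (f b)"
  shows "(LINT x|lborel. (\<Prod>b\<in>Basis. f b (x \<bullet> b))) = (\<Prod>b\<in>Basis. (LINT t|lborel. f b t))"
proof -
  have [measurable]: "f b \<in> borel_measurable borel" if "b \<in> Basis" for b
    using borel_measurable_integrable[OF assms[OF that]] by simp
  have "(LINT x|lborel. (\<Prod>b\<in>Basis. f b (x \<bullet> b)))
      = (LINT x|(\<Pi>\<^sub>M b\<in>Basis. lborel). (\<Prod>b\<in>Basis. f b ((\<Sum>c\<in>Basis. x c *\<^sub>R c) \<bullet> b)))"
    by (subst lborel_eq) (simp add: integral_distr)
  also have "\<dots> = (LINT x|(\<Pi>\<^sub>M b\<in>Basis. lborel). (\<Prod>b\<in>Basis. f b (x b)))"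
    by (intro Bochner_Integration.integral_cong prod.cong refl) simp
  also have "\<dots> = (\<Prod>b\<in>Basis. (LINT t|lborel. f b t))"
    by (rule product_integral_prod) (use assms in auto)
  finally show ?thesis .
qed

end

text \<open>Normalised such that its Fourier integral is a constant multiple of itself, which suits
  its role as regulariser in the inversion formula.\<close>

definition gaussian :: "'a::euclidean_space \<Rightarrow> real" where
  "gaussian x = exp (- (norm x)\<^sup>2 / 2)"

lemma gaussian_prod: "gaussian x = (\<Prod>b\<in>Basis. exp (- (x \<bullet> b)\<^sup>2 / 2))"
proof -
  have "(norm x)\<^sup>2 = (\<Sum>b\<in>Basis. (x \<bullet> b)\<^sup>2)"
    unfolding power2_norm_eq_inner by (subst euclidean_inner) (simp add: power2_eq_square)
  then show ?thesis
    by (simp add: gaussian_def exp_sum[symmetric] sum_negf sum_divide_distrib)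
qed

lemma integrable_exp_square: "integrable lborel (\<lambda>t::real. exp (- t\<^sup>2 / 2))"
proof -
  have "integrable lborel (\<lambda>t. sqrt (2 * pi) * std_normal_density t)" by simp
  then show ?thesis by (simp add: std_normal_density_def)
qed

lemma continuous_gaussian [continuous_intros]: "continuous_on S f \<Longrightarrow> continuous_on S (\<lambda>x. gaussian (f x))"
  unfolding gaussian_def by (intro continuous_intros) auto

lemma gaussian_measurable [measurable]: "gaussian \<in> borel_measurable borel"
  by (rule borel_measurable_continuous_onI) (intro continuous_intros)

lemma gaussian_bounds: "0 < gaussian x" "gaussian x \<le> 1"
  by (auto simp: gaussian_def)

lemma integrable_gaussian: "integrable lborel (gaussian :: 'a::euclidean_space \<Rightarrow> real)"
proof (rule integrableI_nonneg)
  have fin: "(\<integral>\<^sup>+t. ennreal (exp (- t\<^sup>2 / 2)) \<partial>lborel) < \<infinity>"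
    using integrable_exp_square by (subst nn_integral_eq_integral) auto
  have "(\<integral>\<^sup>+x. ennreal (gaussian x) \<partial>(lborel :: 'a measure)) =
      (\<integral>\<^sup>+x. (\<Prod>b\<in>Basis. ennreal (exp (- (x \<bullet> b)\<^sup>2 / 2))) \<partial>(lborel :: 'a measure))"
    by (simp add: gaussian_prod prod_ennreal)
  also have "\<dots> = (\<Prod>b\<in>(Basis::'a set). (\<integral>\<^sup>+t. ennreal (exp (- t\<^sup>2 / 2)) \<partial>lborel))"
    by (rule nn_integral_lborel_prod) auto
  also have "\<dots> < \<infinity>" using fin by (simp add: power_less_top_ennreal)
  finally show "(\<integral>\<^sup>+x. ennreal (gaussian x) \<partial>(lborel :: 'a measure)) < \<infinity>" .
qed (auto simp: gaussian_def)

lemma gaussian_1d: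
  "(LINT t|lborel. exp (\<i> * of_real (a * t)) * of_real (exp (- t\<^sup>2 / 2))) = of_real (sqrt (2 * pi) * exp (- a\<^sup>2 / 2))"
proof -
  have "char std_normal_distribution a = (LINT t|lborel. of_real (std_normal_density t) * exp (\<i> * of_real (a * t)))"
    unfolding char_def by (subst integral_density) (auto simp: scaleR_conv_of_real normal_density_nonneg)
  also have "\<dots> = (LINT t|lborel. of_real (1 / sqrt (2 * pi)) * (exp (\<i> * of_real (a * t)) * of_real (exp (- t\<^sup>2 / 2))))"
    by (intro Bochner_Integration.integral_cong) (auto simp: std_normal_density_def)
  also have "\<dots> = of_real (1 / sqrt (2 * pi)) * (LINT t|lborel. exp (\<i> * of_real (a * t)) * of_real (exp (- t\<^sup>2 / 2)))"
    by (rule integral_mult_right_zero)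
  finally have "of_real (exp (- a\<^sup>2 / 2)) =
     of_real (1 / sqrt (2 * pi)) * (LINT t|lborel. exp (\<i> * of_real (a * t)) * of_real (exp (- t\<^sup>2 / 2)))"
    by (simp add: char_std_normal_distribution)
  then show ?thesis by (simp add: field_simps)
qed

lemma osc_int_gaussian: "osc_int (\<lambda>x. of_real (gaussian x)) (x :: 'a::euclidean_space) = of_real (sqrt (2 * pi) ^ DIM('a) * gaussian x)"
proof -
  have "osc_int (\<lambda>x. of_real (gaussian x)) x =
      (LINT \<xi>|lborel. (\<Prod>b\<in>Basis. exp (\<i> * of_real ((x \<bullet> b) * (\<xi> \<bullet> b))) * of_real (exp (- (\<xi> \<bullet> b)\<^sup>2 / 2))))"
    unfolding osc_int_def
  proof (rule Bochner_Integration.integral_cong[OF refl])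
    fix \<xi> :: 'a
    have "exp (\<i> * of_real (x \<bullet> \<xi>)) = (\<Prod>b\<in>Basis. exp (\<i> * of_real ((x \<bullet> b) * (\<xi> \<bullet> b))))"
      by (subst euclidean_inner) (simp add: exp_sum sum_distrib_left)
    then show "exp (\<i> * of_real (x \<bullet> \<xi>)) * of_real (gaussian \<xi>) =
        (\<Prod>b\<in>Basis. exp (\<i> * of_real ((x \<bullet> b) * (\<xi> \<bullet> b))) * of_real (exp (- (\<xi> \<bullet> b)\<^sup>2 / 2)))"
      by (simp add: gaussian_prod prod.distrib)
  qed
  also have "\<dots> = (\<Prod>b\<in>Basis. (LINT t|lborel. exp (\<i> * of_real ((x \<bullet> b) * t)) * of_real (exp (- t\<^sup>2 / 2))))"
  proof (rule integral_lborel_prod[where f="\<lambda>b t. exp (\<i> * of_real ((x \<bullet> b) * t)) * of_real (exp (- t\<^sup>2 / 2))"])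
    fix b
    show "integrable lborel (\<lambda>t. exp (\<i> * of_real ((x \<bullet> b) * t)) * of_real (exp (- t\<^sup>2 / 2)))"
      by (rule Bochner_Integration.integrable_bound[OF integrable_exp_square]) (auto simp: norm_mult simp del: of_real_mult)
  qed
  also have "\<dots> = (\<Prod>b\<in>Basis. of_real (sqrt (2 * pi) * exp (- (x \<bullet> b)\<^sup>2 / 2)))"
    by (simp only: gaussian_1d)
  also have "\<dots> = of_real (sqrt (2 * pi) ^ DIM('a) * gaussian x)"
    by (simp add: gaussian_prod prod.distrib)
  finally show ?thesis .
qed

text \<open>Since the kernel is bounded by 1, the tensor product of \<open>a\<close> and
  \<open>\<phi>\<close> is an integrable majorant. The kernel is left abstract because the
  exponentials to be inserted may have a shifted phase or one composed with a linear map.\<close>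

lemma fubini_unimodular:
  fixes a :: "'a::euclidean_space \<Rightarrow> complex" and \<phi> :: "'b::euclidean_space \<Rightarrow> complex"
  assumes a: "integrable lborel a" and \<phi>: "integrable lborel \<phi>"
    and \<kappa>: "continuous_on UNIV (\<lambda>z. \<kappa> (fst z) (snd z))" "\<And>x \<xi>. norm (\<kappa> x \<xi>) \<le> 1"
  shows "(LINT x|lborel. a x * (LINT \<xi>|lborel. \<kappa> x \<xi> * \<phi> \<xi>)) = (LINT \<xi>|lborel. \<phi> \<xi> * (LINT x|lborel. \<kappa> x \<xi> * a x))"
proof -
  have ma [measurable]: "a \<in> borel_measurable borel" "\<phi> \<in> borel_measurable borel"
    using borel_measurable_integrable[OF a] borel_measurable_integrable[OF \<phi>] by auto
  have m\<kappa>: "(\<lambda>z. \<kappa> (fst z) (snd z)) \<in> borel_measurable (lborel \<Otimes>\<^sub>M lborel)"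
    using borel_measurable_continuous_onI[OF \<kappa>(1)] by (simp add: lborel_prod)
  have "integrable (lborel \<Otimes>\<^sub>M lborel) (\<lambda>z. a (fst z) * \<phi> (snd z))"
  proof (rule lborel_pair.Fubini_integrable)
    show "(\<lambda>z. a (fst z) * \<phi> (snd z)) \<in> borel_measurable (lborel \<Otimes>\<^sub>M lborel)" by measurable
    show "integrable lborel (\<lambda>x. LINT y|lborel. norm (a (fst (x, y)) * \<phi> (snd (x, y))))"
      using a \<phi> by (simp add: norm_mult)
    show "AE x in lborel. integrable lborel (\<lambda>y. a (fst (x, y)) * \<phi> (snd (x, y)))"
      using \<phi> by simp
  qed
  then have int: "integrable (lborel \<Otimes>\<^sub>M lborel) (\<lambda>(x, y). a x * \<phi> y * \<kappa> x y)"
  proof (rule Bochner_Integration.integrable_bound)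
    show "(\<lambda>(x, y). a x * \<phi> y * \<kappa> x y) \<in> borel_measurable (lborel \<Otimes>\<^sub>M lborel)"
      using m\<kappa> unfolding split_beta' by measurable
    show "AE z in lborel \<Otimes>\<^sub>M lborel. norm (case z of (x, y) \<Rightarrow> a x * \<phi> y * \<kappa> x y) \<le> norm (a (fst z) * \<phi> (snd z))"
      using \<kappa>(2) by (auto simp: norm_mult mult_left_le split: prod.split)
  qed
  have "(LINT x|lborel. a x * (LINT \<xi>|lborel. \<kappa> x \<xi> * \<phi> \<xi>)) = (LINT x|lborel. (LINT \<xi>|lborel. a x * \<phi> \<xi> * \<kappa> x \<xi>))"
    unfolding integral_mult_right_zero[symmetric] by (simp only: mult_ac)
  also have "\<dots> = (LINT \<xi>|lborel. (LINT x|lborel. a x * \<phi> \<xi> * \<kappa> x \<xi>))"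
    by (rule lborel_pair.Fubini_integral[OF int, symmetric])
  also have "\<dots> = (LINT \<xi>|lborel. \<phi> \<xi> * (LINT x|lborel. \<kappa> x \<xi> * a x))"
    unfolding integral_mult_right_zero[symmetric] by (simp only: mult_ac)
  finally show ?thesis .
qed

text \<open>A Gaussian factor of growing width is inserted into the outer integral. In the limit it
  disappears; on the other hand Fubini turns it into an approximate identity that acts on
  \<open>\<psi>\<close> at \<open>x\<close>. The two limits agree.\<close>

theorem osc_int_osc_int:
  fixes \<psi> :: "'a::euclidean_space \<Rightarrow> complex"
  assumes \<psi>: "rapid \<psi>" and F: "rapid (osc_int \<psi>)"
  shows "osc_int (osc_int \<psi>) (- x) = of_real ((2 * pi) ^ DIM('a)) * \<psi> x"
proof -
  let ?c = "sqrt (2 * pi) ^ DIM('a)"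
  let ?e = "\<lambda>n. inverse (real (Suc n))"
  obtain C where C: "C > 0" "\<And>x. norm (\<psi> x) \<le> C" using rapidE[OF \<psi>, of 0] by auto
  have m\<psi>: "\<psi> \<in> borel_measurable borel" "osc_int \<psi> \<in> borel_measurable borel"
    by (intro borel_measurable_continuous_onI rapid_continuous \<psi> F)+
  have e0: "(\<lambda>n. ?e n *\<^sub>R y) \<longlonglongrightarrow> 0" for y :: 'a
    using tendsto_scaleR[OF LIMSEQ_inverse_real_of_nat tendsto_const[of y]] by simp
  have eq: "(LINT \<xi>|lborel. exp (\<i> * of_real (- x \<bullet> \<xi>)) * osc_int \<psi> \<xi> * of_real (gaussian (?e n *\<^sub>R \<xi>)))
      = ?c * (LINT z|lborel. \<psi> (x + ?e n *\<^sub>R z) * of_real (gaussian z))" for n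
  proof -
    let ?a = "\<lambda>\<xi>. exp (\<i> * of_real (- x \<bullet> \<xi>)) * of_real (gaussian (?e n *\<^sub>R \<xi>))"
    have ia: "integrable lborel ?a"
    proof (rule Bochner_Integration.integrable_bound)
      show "integrable lborel (\<lambda>\<xi>::'a. gaussian (?e n *\<^sub>R \<xi>))"
        using lborel_integrable_affine[OF integrable_gaussian, of "?e n" 0] by simp
      show "?a \<in> borel_measurable lborel" by measurable
    qed (use gaussian_bounds in \<open>simp add: norm_mult\<close>)
    \<comment> \<open>Modulation moves the transform of the Gaussian to \<open>x\<close>, and
      dilation by \<open>?e n\<close> concentrates it there.\<close>
    have sc: "osc_int ?a y = ?c * (real (Suc n) ^ DIM('a)) * gaussian (real (Suc n) *\<^sub>R (y - x))" for y
    proof -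
      have "osc_int ?a y = (LINT \<xi>|lborel. exp (\<i> * of_real ((y - x) \<bullet> \<xi>)) * of_real (gaussian (?e n *\<^sub>R \<xi>)))"
        unfolding osc_int_def
        by (intro Bochner_Integration.integral_cong) (auto simp: inner_diff_left exp_diff exp_minus field_simps)
      also have "\<dots> = real (Suc n) ^ DIM('a) *\<^sub>R (LINT z|lborel.
          exp (\<i> * of_real ((y - x) \<bullet> (real (Suc n) *\<^sub>R z))) * of_real (gaussian z))"
        by (subst lborel_integral_affine[where c="real (Suc n)" and t=0]) auto
      also have "\<dots> = real (Suc n) ^ DIM('a) *\<^sub>R osc_int (\<lambda>x. of_real (gaussian x)) (real (Suc n) *\<^sub>R (y - x))"
        by (simp add: osc_int_def)
      finally show ?thesis by (simp add: osc_int_gaussian scaleR_conv_of_real mult_ac)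
    qed
    have "(LINT \<xi>|lborel. exp (\<i> * of_real (- x \<bullet> \<xi>)) * osc_int \<psi> \<xi> * of_real (gaussian (?e n *\<^sub>R \<xi>)))
        = (LINT \<xi>|lborel. ?a \<xi> * (LINT y|lborel. exp (\<i> * of_real (\<xi> \<bullet> y)) * \<psi> y))"
      by (simp add: osc_int_def mult_ac)
    also have "\<dots> = (LINT y|lborel. \<psi> y * (LINT \<xi>|lborel. exp (\<i> * of_real (\<xi> \<bullet> y)) * ?a \<xi>))"
      by (rule fubini_unimodular[OF ia rapid_integrable[OF \<psi>]]) (auto intro!: continuous_intros)
    also have "\<dots> = (LINT y|lborel. \<psi> y * osc_int ?a y)" by (simp add: osc_int_def inner_commute)
    also have "\<dots> = (LINT y|lborel. (?c * (real (Suc n) ^ DIM('a))) * (\<psi> y * of_real (gaussian (real (Suc n) *\<^sub>R (y - x)))))"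
      unfolding sc by (simp add: mult_ac)
    also have "\<dots> = (?c * (real (Suc n) ^ DIM('a))) * (LINT y|lborel. \<psi> y * of_real (gaussian (real (Suc n) *\<^sub>R (y - x))))"
      by (rule integral_mult_right_zero)
    also have "(LINT y|lborel. \<psi> y * of_real (gaussian (real (Suc n) *\<^sub>R (y - x)))) =
        \<bar>?e n\<bar> ^ DIM('a) *\<^sub>R (LINT z|lborel. \<psi> (x + ?e n *\<^sub>R z) * of_real (gaussian (real (Suc n) *\<^sub>R ((x + ?e n *\<^sub>R z) - x))))"
      by (rule lborel_integral_affine) (use m\<psi>(1) in measurable)
    finally show ?thesis
      by (simp add: scaleR_conv_of_real power_inverse del: of_nat_Suc)
  qed
  \<comment> \<open>First limit: the Gaussian factor tends to 1, and the rapidly decreasing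
    \<open>osc_int \<psi>\<close> is the majorant.\<close>
  have "(\<lambda>n. LINT \<xi>|lborel. exp (\<i> * of_real (- x \<bullet> \<xi>)) * osc_int \<psi> \<xi> * of_real (gaussian (?e n *\<^sub>R \<xi>)))
      \<longlonglongrightarrow> (LINT \<xi>|lborel. exp (\<i> * of_real (- x \<bullet> \<xi>)) * osc_int \<psi> \<xi> * of_real (gaussian (0::'a)))"
  proof (rule integral_dominated_convergence[where w="\<lambda>\<xi>. norm (osc_int \<psi> \<xi>)"])
    show "integrable lborel (\<lambda>\<xi>. norm (osc_int \<psi> \<xi>))" using rapid_integrable[OF F] by simp
    have "(\<lambda>n. gaussian (?e n *\<^sub>R \<xi>)) \<longlonglongrightarrow> gaussian (0::'a)" for \<xi> :: 'a
      by (rule continuous_on_tendsto_compose[of UNIV gaussian, OF _ e0]) (auto intro: continuous_intros)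
    then show "AE \<xi> in lborel. (\<lambda>n. exp (\<i> * of_real (- x \<bullet> \<xi>)) * osc_int \<psi> \<xi> * of_real (gaussian (?e n *\<^sub>R \<xi>)))
        \<longlonglongrightarrow> exp (\<i> * of_real (- x \<bullet> \<xi>)) * osc_int \<psi> \<xi> * of_real (gaussian (0::'a))"
      by (intro AE_I2 tendsto_intros)
    show "AE \<xi> in lborel. norm (exp (\<i> * of_real (- x \<bullet> \<xi>)) * osc_int \<psi> \<xi> * of_real (gaussian (?e n *\<^sub>R \<xi>)))
        \<le> norm (osc_int \<psi> \<xi>)" for n
    proof (rule AE_I2)
      fix \<xi> :: 'a
      have "\<bar>gaussian (?e n *\<^sub>R \<xi>)\<bar> \<le> 1" using gaussian_bounds[of "?e n *\<^sub>R \<xi>"] by linarith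
      from mult_left_le[OF this norm_ge_zero[of "osc_int \<psi> \<xi>"]]
      show "norm (exp (\<i> * of_real (- x \<bullet> \<xi>)) * osc_int \<psi> \<xi> * of_real (gaussian (?e n *\<^sub>R \<xi>))) \<le> norm (osc_int \<psi> \<xi>)"
        by (simp only: norm_mult norm_exp_i_real norm_of_real mult_1)
    qed
  qed (use m\<psi> in measurable)
  then have L: "(\<lambda>n. ?c * (LINT z|lborel. \<psi> (x + ?e n *\<^sub>R z) * of_real (gaussian z))) \<longlonglongrightarrow> osc_int (osc_int \<psi>) (- x)"
    unfolding eq by (simp add: osc_int_def[of "osc_int \<psi>"] gaussian_def)
  \<comment> \<open>Second limit: after rescaling, \<open>\<psi>\<close> is averaged over points
    that converge to \<open>x\<close>.\<close>
  have "(\<lambda>n. LINT z|lborel. \<psi> (x + ?e n *\<^sub>R z) * of_real (gaussian z)) \<longlonglongrightarrow> (LINT z|lborel. \<psi> x * of_real (gaussian (z::'a)))"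
  proof (rule integral_dominated_convergence[where w="\<lambda>z. C * gaussian z"])
    show "integrable lborel (\<lambda>z::'a. C * gaussian z)" by (intro integrable_mult_right integrable_gaussian)
    have "(\<lambda>n. \<psi> (x + ?e n *\<^sub>R z)) \<longlonglongrightarrow> \<psi> x" for z
    proof -
      have "(\<lambda>n. x + ?e n *\<^sub>R z) \<longlonglongrightarrow> x" using tendsto_add[OF tendsto_const e0[of z], of x] by simp
      then show ?thesis using continuous_on_tendsto_compose[OF rapid_continuous[OF \<psi>, of UNIV]] by auto
    qed
    then show "AE z in lborel. (\<lambda>n. \<psi> (x + ?e n *\<^sub>R z) * of_real (gaussian z)) \<longlonglongrightarrow> \<psi> x * of_real (gaussian z)"
      by (intro AE_I2 tendsto_intros)
    show "AE z in lborel. norm (\<psi> (x + ?e n *\<^sub>R z) * of_real (gaussian z)) \<le> C * gaussian z" for n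
    proof (rule AE_I2)
      fix z :: 'a
      show "norm (\<psi> (x + ?e n *\<^sub>R z) * of_real (gaussian z)) \<le> C * gaussian z"
        using mult_right_mono[OF C(2) less_imp_le[OF gaussian_bounds(1)]] gaussian_bounds(1)[of z]
        by (simp only: norm_mult norm_of_real abs_of_pos)
    qed
  qed (use m\<psi> in measurable)
  moreover have "(LINT z|lborel. \<psi> x * of_real (gaussian (z::'a))) = \<psi> x * ?c"
    using osc_int_gaussian[of "0::'a"] by (simp add: osc_int_def gaussian_def)
  ultimately have "(\<lambda>n. LINT z|lborel. \<psi> (x + ?e n *\<^sub>R z) * of_real (gaussian z)) \<longlonglongrightarrow> \<psi> x * ?c"
    by (simp only:)
  then have "(\<lambda>n. ?c * (LINT z|lborel. \<psi> (x + ?e n *\<^sub>R z) * of_real (gaussian z))) \<longlonglongrightarrow> ?c * (\<psi> x * ?c)"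
    by (rule tendsto_mult_left)
  from LIMSEQ_unique[OF L this]
  have "osc_int (osc_int \<psi>) (- x) = of_real (?c * ?c) * \<psi> x" by (simp add: mult_ac)
  \<comment> \<open>One factor \<open>?c\<close> comes from the transform of the Gaussian, the other
    one from its total mass.\<close>
  also have "?c * ?c = (sqrt (2 * pi) * sqrt (2 * pi)) ^ DIM('a)"
    by (rule power_mult_distrib[symmetric])
  also have "\<dots> = (2 * pi) ^ DIM('a)" by (simp only: real_sqrt_mult_self abs_of_pos[of "2 * pi"] pi_gt_zero) simp
  finally show ?thesis .
qed

lemma fourier_osc_int: "fourier f x = osc_int f (- x)"
  by (simp add: fourier_def osc_int_def inner_commute)

lemma inverse_fourier_osc_int: "inverse_fourier (f :: 'a::euclidean_space \<Rightarrow> complex) x = osc_int f x / of_real ((2 * pi) ^ DIM('a))"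
  by (simp add: inverse_fourier_def osc_int_def)

section \<open>Tempered distributions under the integral sign\<close>

text \<open>The error depends on \<open>h\<close> only through the majorant \<open>d\<close> and the
  oscillation \<open>e\<close>, so one tagged division serves a whole family of integrands
  uniformly. The part outside the box costs \<epsilon>, the box itself \<open>e\<close> times its
  volume.\<close>

lemma riemann_sum_approx:
  fixes h :: "'b::euclidean_space \<Rightarrow> complex"
  assumes d: "integrable lborel d" and h: "continuous_on UNIV h" "\<And>x. norm (h x) \<le> d x"
    and eps: "(LINT x|lborel. indicator (- cbox a b) x * d x) \<le> \<epsilon>"
    and p: "p tagged_division_of cbox a b" "(\<lambda>x. ball x \<delta>) fine p"
    and osc: "\<And>x t. x \<in> cbox a b \<Longrightarrow> t \<in> cbox a b \<Longrightarrow> dist t x < \<delta> \<Longrightarrow> norm (h x - h t) \<le> e"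
  shows "norm ((LINT x|lborel. h x) - (\<Sum>(t, Q)\<in>p. measure lborel Q *\<^sub>R h t)) \<le> \<epsilon> + e * measure lborel (cbox a b)"
proof -
  have mh [measurable]: "h \<in> borel_measurable borel" using h(1) by (rule borel_measurable_continuous_onI)
  have ih: "integrable lborel h"
    by (rule Bochner_Integration.integrable_bound[OF d]) (auto intro!: AE_I2 order_trans[OF h(2) abs_ge_self])
  have iB: "integrable lborel (\<lambda>x. indicator (cbox a b) x *\<^sub>R h x)"
    and iC: "integrable lborel (\<lambda>x. indicator (- cbox a b) x *\<^sub>R h x)"
    using ih by (auto intro!: integrable_mult_indicator)
  have id: "integrable lborel (\<lambda>x. indicator (- cbox a b) x * d x)"
    using integrable_mult_indicator[OF _ d, of "- cbox a b"] by simp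
  have "(LINT x|lborel. h x) = (LINT x|lborel. indicator (cbox a b) x *\<^sub>R h x + indicator (- cbox a b) x *\<^sub>R h x)"
    by (intro Bochner_Integration.integral_cong) (auto simp: indicator_def)
  also have "\<dots> = (LINT x|lborel. indicator (cbox a b) x *\<^sub>R h x) + (LINT x|lborel. indicator (- cbox a b) x *\<^sub>R h x)"
    by (rule Bochner_Integration.integral_add[OF iB iC])
  finally have split: "(LINT x|lborel. h x) = (LINT x|lborel. indicator (cbox a b) x *\<^sub>R h x) + (LINT x|lborel. indicator (- cbox a b) x *\<^sub>R h x)" .
  have "norm (LINT x|lborel. indicator (- cbox a b) x *\<^sub>R h x) \<le> (LINT x|lborel. indicator (- cbox a b) x * d x)"
    by (rule norm_integral_le[OF id]) (use h(2) in \<open>auto simp: indicator_def\<close>)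
  with eps have out: "norm (LINT x|lborel. indicator (- cbox a b) x *\<^sub>R h x) \<le> \<epsilon>" by linarith
  have "(LINT x|lborel. indicator (cbox a b) x *\<^sub>R h x) = integral (cbox a b) h"
    using set_borel_integral_eq_integral(2)[of "cbox a b" h] iB
    by (simp add: set_integrable_def set_lebesgue_integral_def)
  also have "\<dots> = (\<Sum>(x, Q)\<in>p. integral Q h)"
    using integrable_continuous[of a b h] continuous_on_subset[OF h(1)]
    by (intro integral_combine_tagged_division_topdown[OF _ p(1)]) auto
  finally have "norm ((LINT x|lborel. indicator (cbox a b) x *\<^sub>R h x) - (\<Sum>(t, Q)\<in>p. measure lborel Q *\<^sub>R h t))
      = norm (\<Sum>(t, Q)\<in>p. integral Q h - measure lborel Q *\<^sub>R h t)"
    by (simp add: sum_subtractf split_def)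
  also have "\<dots> \<le> (\<Sum>(t, Q)\<in>p. e * measure lborel Q)"
  proof (rule sum_norm_le, clarify)
    fix t Q assume tQ: "(t, Q) \<in> p"
    obtain c d where Q: "Q = cbox c d" using tagged_division_ofD(4)[OF p(1) tQ] by auto
    have sub: "Q \<subseteq> cbox a b" "t \<in> Q" using tagged_division_ofD(2,3)[OF p(1) tQ] by auto
    have fine: "Q \<subseteq> ball t \<delta>" using p(2) tQ by (auto simp: fine_def)
    have "(h has_integral integral Q h) Q"
      unfolding Q by (intro integrable_integral integrable_continuous continuous_on_subset[OF h(1)]) auto
    from has_integral_diff[OF this[unfolded Q] has_integral_const[of "h t" c d]]
    have hi: "((\<lambda>x. h x - h t) has_integral (integral Q h - measure lborel Q *\<^sub>R h t)) (cbox c d)"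
      by (simp add: Q)
    have "0 \<le> e" using osc[of t t] sub p(2) tQ fine by fastforce
    from has_integral_bound[OF this hi] show "norm (integral Q h - measure lborel Q *\<^sub>R h t) \<le> e * measure lborel Q"
      using osc[of _ t] sub fine Q by (auto simp: subset_iff)
  qed
  also have "\<dots> = e * measure lborel (cbox a b)"
    using additive_content_tagged_division[OF p(1)] by (simp add: split_def sum_distrib_left[symmetric])
  finally show ?thesis using out norm_triangle_ineq[of "(LINT x|lborel. indicator (cbox a b) x *\<^sub>R h x) - (\<Sum>(t, Q)\<in>p. measure lborel Q *\<^sub>R h t)"
      "LINT x|lborel. indicator (- cbox a b) x *\<^sub>R h x"]
    unfolding split by (simp add: algebra_simps)
qed

lemma integrable_tail:
  fixes d :: "'b::euclidean_space \<Rightarrow> real"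
  assumes "integrable lborel d" "\<epsilon> > 0"
  obtains a b where "(LINT x|lborel. indicator (- cbox a b) x * d x) \<le> \<epsilon>"
proof -
  have [measurable]: "d \<in> borel_measurable borel"
    using borel_measurable_integrable[OF assms(1)] by simp
  let ?B = "\<lambda>n. cbox (- real n *\<^sub>R One) (real n *\<^sub>R One :: 'b)"
  have "(\<lambda>n. LINT x|lborel. indicator (- ?B n) x * d x) \<longlonglongrightarrow> (LINT x|(lborel :: 'b measure). 0)"
  proof (rule integral_dominated_convergence[where w="\<lambda>x. norm (d x)"])
    show "integrable lborel (\<lambda>x. norm (d x))" using assms(1) by simp
    have "(\<lambda>n. indicator (- ?B n) x * d x) \<longlonglongrightarrow> 0" for x
    proof (rule tendsto_eventually)
      obtain m :: nat where m: "norm x \<le> real m" using real_arch_simple by blast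
      have "indicator (- ?B n) x * d x = 0" if "n \<ge> m" for n
      proof -
        have "x \<in> ?B n" unfolding mem_box
        proof (intro ballI)
          fix i :: 'b assume i: "i \<in> Basis"
          have "\<bar>x \<bullet> i\<bar> \<le> real n" using Basis_le_norm[OF i, of x] m that by linarith
          then show "- real n *\<^sub>R One \<bullet> i \<le> x \<bullet> i \<and> x \<bullet> i \<le> real n *\<^sub>R One \<bullet> i"
            using i by (simp add: abs_le_iff)
        qed
        then show ?thesis by simp
      qed
      then show "\<forall>\<^sub>F n in sequentially. indicator (- ?B n) x * d x = 0"
        by (auto simp: eventually_sequentially)
    qed
    then show "AE x in lborel. (\<lambda>n. indicator (- ?B n) x * d x) \<longlonglongrightarrow> 0" by simp
  qed (auto simp: indicator_def)
  then have "(\<lambda>n. LINT x|lborel. indicator (- ?B n) x * d x) \<longlonglongrightarrow> 0" by simp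
  from order_tendstoD(2)[OF this assms(2)] obtain n where "(LINT x|lborel. indicator (- ?B n) x * d x) < \<epsilon>"
    by (auto simp: eventually_sequentially)
  then show ?thesis using that less_imp_le by blast
qed

section \<open>Seminorm estimates for tempered distributions\<close>

lemma finite_multi_indices_upto: "finite (multi_indices_upto N :: 'a::euclidean_space list set)"
  using finite_lists_length_le[OF finite_Basis, of N]
  by (simp add: multi_indices_upto_def multi_indices_def conj_commute)

lemma schwartz_seminorm_le:
  fixes f :: "'a::euclidean_space \<Rightarrow> complex"
  assumes "\<And>bs x. bs \<in> multi_indices_upto N \<Longrightarrow> (1 + norm x) ^ N * norm (iter_deriv bs f x) \<le> e"
  shows "schwartz_seminorm N f \<le> real (card (multi_indices_upto N :: 'a list set)) * e"
  unfolding schwartz_seminorm_def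
  by (rule sum_bounded_above) (use assms in \<open>auto intro!: cSUP_least\<close>)

text \<open>Replaces the sum of suprema in the definition by a single pointwise bound, which is the
  form in which estimates of derivatives arise.\<close>

lemma tempered_bound:
  fixes u :: "'a::euclidean_space functional"
  assumes "tempered_distribution u"
  obtains K N where "K > 0" "\<And>f e. schwartz f \<Longrightarrow>
     (\<And>bs x. bs \<in> multi_indices_upto N \<Longrightarrow> (1 + norm x) ^ N * norm (iter_deriv bs f x) \<le> e)
     \<Longrightarrow> norm (u f) \<le> K * e"
proof -
  obtain C N where C: "\<And>f. schwartz f \<Longrightarrow> norm (u f) \<le> C * schwartz_seminorm N f"
    using assms by (auto simp: tempered_distribution_def)
  let ?M = "multi_indices_upto N :: 'a list set"
  show ?thesis
  proof (rule that[of "\<bar>C\<bar> * real (card ?M) + 1" N])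
    fix f e assume f: "schwartz f"
      and e: "\<And>bs x. bs \<in> ?M \<Longrightarrow> (1 + norm x) ^ N * norm (iter_deriv bs f x) \<le> e"
    have "[] \<in> ?M" by (simp add: multi_indices_upto_def)
    from e[OF this, of 0] have e0: "0 \<le> e" by (rule order_trans[rotated]) simp
    \<comment> \<open>The hypothesis on \<open>e\<close> bounds the sets whose suprema are taken, so
      these are meaningful and non-negative; this permits replacing \<open>C\<close> by its absolute
      value.\<close>
    have s0: "0 \<le> schwartz_seminorm N f"
      unfolding schwartz_seminorm_def
    proof (rule sum_nonneg)
      fix bs assume "bs \<in> ?M"
      then have "bdd_above (range (\<lambda>x. (1 + norm x) ^ N * norm (iter_deriv bs f x)))"
        using e by (auto intro!: bdd_aboveI)
      then show "0 \<le> (SUP x. (1 + norm x) ^ N * norm (iter_deriv bs f x))"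
        by (rule cSUP_upper2[of _ _ 0]) auto
    qed
    have "norm (u f) \<le> \<bar>C\<bar> * schwartz_seminorm N f"
      using C[OF f] mult_right_mono[OF abs_ge_self s0, of C] by linarith
    also have "\<dots> \<le> \<bar>C\<bar> * (real (card ?M) * e)"
      by (intro mult_left_mono schwartz_seminorm_le e) auto
    finally show "norm (u f) \<le> (\<bar>C\<bar> * real (card ?M) + 1) * e" using e0 by (simp add: algebra_simps)
  qed (simp add: add_nonneg_pos)
qed

lemma iter_deriv_lincomb:
  fixes f g :: "'a::euclidean_space \<Rightarrow> complex"
  assumes "smooth f" "smooth g" "bs \<in> multi_indices"
  shows "iter_deriv bs (\<lambda>x. a * f x + b * g x) = (\<lambda>x. a * iter_deriv bs f x + b * iter_deriv bs g x)"
  using assms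
  by (simp add: iter_deriv_add smooth_mult smooth_const iter_deriv_compose_linear[OF _ bounded_linear_mult_right])

lemma schwartz_lincomb:
  assumes f: "schwartz f" and g: "schwartz g"
  shows "schwartz (\<lambda>x. a * f x + b * g x)"
proof (rule schwartzI)
  show "smooth (\<lambda>x. a * f x + b * g x)"
    by (intro smooth_add smooth_mult smooth_const schwartz_smooth f g)
  fix N and bs :: "'a list" assume bs: "bs \<in> multi_indices"
  obtain C where C: "\<And>x. (1 + norm x) ^ N * norm (iter_deriv bs f x) \<le> C" using schwartzE[OF f bs] by metis
  obtain D where D: "\<And>x. (1 + norm x) ^ N * norm (iter_deriv bs g x) \<le> D" using schwartzE[OF g bs] by metis
  have "(1 + norm x) ^ N * norm (iter_deriv bs (\<lambda>x. a * f x + b * g x) x) \<le> norm a * C + norm b * D" for x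
  proof -
    have "(1 + norm x) ^ N * norm (iter_deriv bs (\<lambda>x. a * f x + b * g x) x)
       \<le> (1 + norm x) ^ N * (norm a * norm (iter_deriv bs f x) + norm b * norm (iter_deriv bs g x))"
      unfolding iter_deriv_lincomb[OF schwartz_smooth[OF f] schwartz_smooth[OF g] bs]
      by (intro mult_left_mono norm_triangle_le) (auto simp: norm_mult)
    also have "\<dots> = norm a * ((1 + norm x) ^ N * norm (iter_deriv bs f x)) + norm b * ((1 + norm x) ^ N * norm (iter_deriv bs g x))"
      by (simp add: algebra_simps)
    also have "\<dots> \<le> norm a * C + norm b * D"
      by (intro add_mono mult_left_mono C D) auto
    finally show ?thesis .
  qed
  then show "\<exists>C. \<forall>x. (1 + norm x) ^ N * norm (iter_deriv bs (\<lambda>x. a * f x + b * g x) x) \<le> C" by blast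
qed

lemma iter_deriv_zero: "iter_deriv bs (\<lambda>x. 0) = (\<lambda>x. 0)"
proof (induction bs)
  case (Cons b bs)
  show ?case unfolding iter_deriv_Cons Cons.IH
    by (rule ext) (rule partial_deriv_eq[OF has_derivative_const])
qed simp

lemma schwartz_zero: "schwartz (\<lambda>x. 0)"
  by (rule schwartzI) (auto simp: smooth_const iter_deriv_zero)

lemma tempered_linear:
  assumes "tempered_distribution u" "schwartz f" "schwartz g"
  shows "u (\<lambda>x. a * f x + b * g x) = a * u f + b * u g"
  using assms by (simp add: tempered_distribution_def linear_functional_on_def)

lemma tempered_sum:
  assumes u: "tempered_distribution u" and A: "finite A" and f: "\<And>i. i \<in> A \<Longrightarrow> schwartz (f i)"
  shows "schwartz (\<lambda>x. \<Sum>i\<in>A. c i * f i x)" "u (\<lambda>x. \<Sum>i\<in>A. c i * f i x) = (\<Sum>i\<in>A. c i * u (f i))"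
proof -
  have "schwartz (\<lambda>x. \<Sum>i\<in>A. c i * f i x) \<and> u (\<lambda>x. \<Sum>i\<in>A. c i * f i x) = (\<Sum>i\<in>A. c i * u (f i))"
    using A f
  proof (induction A rule: finite_induct)
    case empty
    then show ?case using tempered_linear[OF u schwartz_zero schwartz_zero, of 0 0] schwartz_zero by simp
  next
    case (insert i A)
    then have "schwartz (f i)" "schwartz (\<lambda>x. \<Sum>i\<in>A. c i * f i x)" by auto
    from schwartz_lincomb[OF this, of "c i" 1] tempered_linear[OF u this, of "c i" 1]
    show ?case using insert by simp
  qed
  then show "schwartz (\<lambda>x. \<Sum>i\<in>A. c i * f i x)" "u (\<lambda>x. \<Sum>i\<in>A. c i * f i x) = (\<Sum>i\<in>A. c i * u (f i))"
    by auto
qed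

lemma smooth_lipschitz:
  fixes k :: "'a::euclidean_space \<Rightarrow> complex"
  assumes "smooth k" "\<And>b w. b \<in> Basis \<Longrightarrow> w \<in> closed_segment y z \<Longrightarrow> norm (partial_deriv b k w) \<le> C"
  shows "norm (k y - k z) \<le> real DIM('a) * C * norm (y - z)"
proof (rule differentiable_bound[of "closed_segment y z"])
  fix w assume w: "w \<in> closed_segment y z"
  have D: "(k has_derivative frechet_derivative k (at w)) (at w)"
    by (rule differentiable_has_derivative[OF smooth_differentiable[OF assms(1)]])
  then show "(k has_derivative frechet_derivative k (at w)) (at w within closed_segment y z)"
    by (rule has_derivative_at_withinI)
  have lin: "linear (frechet_derivative k (at w))"
    using has_derivative_bounded_linear[OF D] bounded_linear.linear by blast
  show "onorm (frechet_derivative k (at w)) \<le> real DIM('a) * C"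
  proof (rule onorm_le)
    fix h :: 'a
    have "frechet_derivative k (at w) h = frechet_derivative k (at w) (\<Sum>b\<in>Basis. (h \<bullet> b) *\<^sub>R b)"
      by (simp add: euclidean_representation)
    also have "\<dots> = (\<Sum>b\<in>Basis. (h \<bullet> b) *\<^sub>R partial_deriv b k w)"
      by (simp add: linear_sum[OF lin] linear_cmul[OF lin] partial_deriv_def)
    also have "norm \<dots> \<le> (\<Sum>b\<in>(Basis::'a set). norm h * C)"
      by (intro sum_norm_le) (use assms(2)[OF _ w] Basis_le_norm[of _ h] in \<open>auto intro!: mult_mono\<close>)
    finally show "norm (frechet_derivative k (at w) h) \<le> real DIM('a) * C * norm h" by (simp add: mult_ac)
  qed
qed auto

text \<open>For points at distance at most 1 the weights along the connecting segment are comparable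
  up to the factor 2 ^ N, so the mean value bound keeps the full decay.\<close>

lemma schwartz_lipschitz:
  fixes k :: "'a::euclidean_space \<Rightarrow> complex"
  assumes k: "schwartz k"
  obtains C where "C > 0" "\<And>y z. norm (y - z) \<le> 1 \<Longrightarrow> (1 + norm y) ^ N * norm (k y - k z) \<le> C * norm (y - z)"
proof -
  have "\<exists>C>0. \<forall>w. (1 + norm w) ^ N * norm (partial_deriv b k w) \<le> C" if "b \<in> Basis" for b
  proof -
    have b: "[b] \<in> multi_indices" using that by (simp add: multi_indices_def)
    obtain C where "C > 0" "\<And>w. (1 + norm w) ^ N * norm (iter_deriv [b] k w) \<le> C"
      using schwartzE[OF k b] by metis
    then show ?thesis by (auto simp: iter_deriv_Cons simp del: iter_deriv.simps(2))
  qed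
  then obtain B where B: "\<And>b. b \<in> Basis \<Longrightarrow> B b > 0"
    "\<And>b w. b \<in> Basis \<Longrightarrow> (1 + norm w) ^ N * norm (partial_deriv b k w) \<le> B b" by metis
  define C where "C = 2 ^ N * sum B Basis"
  have Bs: "B b \<le> sum B Basis" if "b \<in> Basis" for b
    using that B(1) by (intro member_le_sum) (auto intro: less_imp_le)
  have "sum B Basis > 0" using B(1) by (intro sum_pos) auto
  then have C0: "C > 0" by (simp add: C_def)
  show ?thesis
  proof (rule that[of "real DIM('a) * C"])
    show "real DIM('a) * C > 0" using C0 by simp
    fix y z :: 'a assume yz: "norm (y - z) \<le> 1"
    have "norm (k y - k z) \<le> real DIM('a) * (C / (1 + norm y) ^ N) * norm (y - z)"
    proof (rule smooth_lipschitz[OF schwartz_smooth[OF k]])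
      fix b w :: 'a assume b: "b \<in> Basis" and w: "w \<in> closed_segment y z"
      have "norm (w - y) \<le> norm (y - z)"
        using segment_bound(1)[OF w] by (simp add: norm_minus_commute)
      also note yz
      finally have "norm y - norm w \<le> 1"
        using norm_triangle_ineq2[of y w] by (simp add: norm_minus_commute)
      then have "1 + norm y \<le> 2 * (1 + norm w)"
        using norm_ge_zero[of w] unfolding distrib_left by linarith
      then have "(1 + norm y) ^ N \<le> (2 * (1 + norm w)) ^ N" by (intro power_mono) auto
      then have "(1 + norm y) ^ N * norm (partial_deriv b k w) \<le> (2 * (1 + norm w)) ^ N * norm (partial_deriv b k w)"
        by (rule mult_right_mono) simp
      also have "\<dots> \<le> C"
        unfolding C_def power_mult_distrib mult.assoc
        using B(2)[OF b, of w] Bs[OF b] by (intro mult_left_mono) auto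
      finally show "norm (partial_deriv b k w) \<le> C / (1 + norm y) ^ N"
        by (simp add: pos_le_divide_eq add_pos_nonneg mult.commute)
    qed
    then show "(1 + norm y) ^ N * norm (k y - k z) \<le> real DIM('a) * C * norm (y - z)"
      by (simp add: field_simps add_pos_nonneg)
  qed
qed

text \<open>By Fubini, averaging translates along \<open>L\<close> multiplies the symbol by the
  transform of \<open>a\<close> at the adjoint point. Up to sign, \<open>L\<close> will be the
  identity or the embedding of the hyperplane, whose adjoint drops the last coordinate.\<close>

lemma conv_osc_int:
  fixes a :: "'b::euclidean_space \<Rightarrow> complex" and \<phi> :: "'a::euclidean_space \<Rightarrow> complex"
  assumes a: "rapid a" and \<phi>: "rapid \<phi>" and L: "bounded_linear L" and adj: "\<And>x \<xi>. L x \<bullet> \<xi> = x \<bullet> Ls \<xi>"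
  shows "(LINT x|lborel. a x * osc_int \<phi> (Z + L x)) = osc_int (\<lambda>\<xi>. osc_int a (Ls \<xi>) * \<phi> \<xi>) Z"
proof -
  have "continuous_on UNIV (\<lambda>z. exp (\<i> * complex_of_real ((Z + L (fst z)) \<bullet> snd z)))"
    by (intro continuous_intros bounded_linear.continuous_on[OF L])
  then have "(LINT x|lborel. a x * osc_int \<phi> (Z + L x)) =
     (LINT \<xi>|lborel. \<phi> \<xi> * (LINT x|lborel. exp (\<i> * of_real ((Z + L x) \<bullet> \<xi>)) * a x))"
    unfolding osc_int_def
    by (intro fubini_unimodular[OF rapid_integrable[OF a] rapid_integrable[OF \<phi>]]) (auto simp del: of_real_add)
  also have "\<dots> = (LINT \<xi>|lborel. exp (\<i> * of_real (Z \<bullet> \<xi>)) * (osc_int a (Ls \<xi>) * \<phi> \<xi>))"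
  proof (rule Bochner_Integration.integral_cong[OF refl])
    fix \<xi> :: 'a
    have "(LINT x|lborel. exp (\<i> * of_real ((Z + L x) \<bullet> \<xi>)) * a x) =
        (LINT x|lborel. exp (\<i> * of_real (Z \<bullet> \<xi>)) * (exp (\<i> * of_real (Ls \<xi> \<bullet> x)) * a x))"
      by (intro Bochner_Integration.integral_cong)
         (auto simp: inner_add_left adj exp_add distrib_left inner_commute[of "Ls \<xi>"])
    also have "\<dots> = exp (\<i> * of_real (Z \<bullet> \<xi>)) * osc_int a (Ls \<xi>)"
      unfolding osc_int_def by (rule integral_mult_right_zero)
    finally show "\<phi> \<xi> * (LINT x|lborel. exp (\<i> * of_real ((Z + L x) \<bullet> \<xi>)) * a x) =
        exp (\<i> * of_real (Z \<bullet> \<xi>)) * (osc_int a (Ls \<xi>) * \<phi> \<xi>)" by simp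
  qed
  finally show ?thesis by (simp add: osc_int_def)
qed

section \<open>Reflected translates, and distributions under the integral sign\<close>

lemma iter_deriv_reflect:
  fixes f :: "'a::euclidean_space \<Rightarrow> complex"
  assumes "smooth f" "bs \<in> multi_indices"
  shows "iter_deriv bs (\<lambda>y. f (Z - y)) y = (- 1) ^ length bs *\<^sub>R iter_deriv bs f (Z - y)"
  using fun_cong[OF iter_deriv_scaled[OF assms, of "-1" Z], of y] by simp

lemma smooth_reflect:
  fixes f :: "'a::euclidean_space \<Rightarrow> complex"
  assumes "smooth f" shows "smooth (\<lambda>y. f (Z - y))"
  using smooth_scaled[OF assms, of "-1" Z] by simp

lemma one_plus_norm_mult_le: "1 + norm (x + y) \<le> (1 + norm x) * (1 + norm (y :: 'a::real_normed_vector))"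
  using norm_triangle_ineq[of x y] mult_nonneg_nonneg[OF norm_ge_zero[of x] norm_ge_zero[of y]]
  by (simp add: algebra_simps del: mult_nonneg_nonneg)

lemma weight_shift: "(1 + norm y) ^ N \<le> (1 + norm Z) ^ N * (1 + norm (Z - y :: 'a::real_normed_vector)) ^ N"
proof -
  have "1 + norm y \<le> (1 + norm Z) * (1 + norm (Z - y))"
    using one_plus_norm_mult_le[of Z "y - Z"] by (simp add: norm_minus_commute)
  then have "(1 + norm y) ^ N \<le> ((1 + norm Z) * (1 + norm (Z - y))) ^ N"
    by (intro power_mono) auto
  then show ?thesis by (simp add: power_mult_distrib)
qed

lemma schwartz_reflect:
  fixes f :: "'a::euclidean_space \<Rightarrow> complex"
  assumes f: "schwartz f"
  shows "schwartz (\<lambda>y. f (Z - y))"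
proof (rule schwartzI)
  show "smooth (\<lambda>y. f (Z - y))" by (rule smooth_reflect[OF schwartz_smooth[OF f]])
  fix N and bs :: "'a list" assume bs: "bs \<in> multi_indices"
  obtain C where C: "\<And>x. (1 + norm x) ^ N * norm (iter_deriv bs f x) \<le> C" using schwartzE[OF f bs] by metis
  have "(1 + norm y) ^ N * norm (iter_deriv bs (\<lambda>y. f (Z - y)) y) \<le> (1 + norm Z) ^ N * C" for y
  proof -
    have "(1 + norm y) ^ N * norm (iter_deriv bs (\<lambda>y. f (Z - y)) y)
        \<le> ((1 + norm Z) ^ N * (1 + norm (Z - y)) ^ N) * norm (iter_deriv bs f (Z - y))"
      using weight_shift[of y N Z] by (simp add: iter_deriv_reflect[OF schwartz_smooth[OF f] bs] mult_right_mono)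
    also have "\<dots> \<le> (1 + norm Z) ^ N * C"
      using C by (simp add: mult.assoc mult_left_mono)
    finally show ?thesis .
  qed
  then show "\<exists>C. \<forall>y. (1 + norm y) ^ N * norm (iter_deriv bs (\<lambda>y. f (Z - y)) y) \<le> C" by blast
qed

lemma smooth_cmult: fixes f :: "'a::euclidean_space \<Rightarrow> complex" shows "smooth f \<Longrightarrow> smooth (\<lambda>x. c * f x)"
  by (intro smooth_mult smooth_const)

lemma iter_deriv_sum:
  fixes f :: "'i \<Rightarrow> 'a::euclidean_space \<Rightarrow> complex"
  assumes "finite A" "\<And>i. i \<in> A \<Longrightarrow> smooth (f i)" "bs \<in> multi_indices"
  shows "iter_deriv bs (\<lambda>x. \<Sum>i\<in>A. c i * f i x) = (\<lambda>x. \<Sum>i\<in>A. c i * iter_deriv bs (f i) x)"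
  using assms(1,2)
proof (induction A rule: finite_induct)
  case empty
  then show ?case by (simp add: iter_deriv_zero)
next
  case (insert i A)
  have "smooth (\<lambda>x. \<Sum>i\<in>A. c i * f i x)" using insert by (intro smooth_sum smooth_cmult) auto
  with insert iter_deriv_lincomb[of "f i" "\<lambda>x. \<Sum>i\<in>A. c i * f i x" bs "c i" 1] assms(3)
  show ?case by (simp add: fun_eq_iff)
qed

text \<open>
  A tempered distribution may be applied under the integral sign because the Riemann sums of the
  integral converge in every Schwartz seminorm. By \<open>conv_osc_int\<close>, derivatives of the integral are
  integrals of the same form, so no differentiation under the integral sign is needed.
\<close>

lemma pass_through:
  fixes a :: "'b::euclidean_space \<Rightarrow> complex" and \<phi> :: "'a::euclidean_space \<Rightarrow> complex"
    and u :: "'a functional" and L :: "'b \<Rightarrow> 'a" and X :: 'a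
  assumes u: "tempered_distribution u" and a: "rapid a" and \<phi>: "test_function \<phi>"
    and L: "bounded_linear L" and Ls: "bounded_linear Ls" and adj: "\<And>x \<xi>. L x \<bullet> \<xi> = x \<bullet> Ls \<xi>"
    and normL: "\<And>x. norm (L x) \<le> norm x"
  defines "G \<equiv> \<lambda>x y. osc_int \<phi> (X + L x - y)"
  defines "T \<equiv> \<lambda>y. osc_int (\<lambda>\<xi>. osc_int a (Ls \<xi>) * \<phi> \<xi>) (X - y)"
  shows "continuous_on UNIV (\<lambda>x. u (G x))"
    and "\<exists>C N. \<forall>x. norm (u (G x)) \<le> C * (1 + norm x) ^ N"
    and "u T = (LINT x|lborel. a x * u (G x))"
proof -
  obtain K N where K: "K > 0" and uK: "\<And>f e. schwartz f \<Longrightarrow>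
     (\<And>bs x. bs \<in> multi_indices_upto N \<Longrightarrow> (1 + norm x) ^ N * norm (iter_deriv bs f x) \<le> e)
     \<Longrightarrow> norm (u f) \<le> K * e"
    using tempered_bound[OF u] by metis
  let ?M = "multi_indices_upto N :: 'a list set"
  have M: "bs \<in> multi_indices" if "bs \<in> ?M" for bs using that by (simp add: multi_indices_upto_def)
  define k where "k = osc_int \<phi>"
  have sk: "schwartz k" unfolding k_def by (rule schwartz_osc_int[OF \<phi>])
  have kbs: "iter_deriv bs k = osc_int (\<lambda>\<xi>. i_monomial bs \<xi> * \<phi> \<xi>)" for bs
    unfolding k_def by (rule iter_deriv_osc_int[OF test_function_rapid[OF \<phi>]])
  have skbs: "schwartz (iter_deriv bs k)" for bs
    unfolding kbs by (rule schwartz_osc_int[OF test_function_i_monomial_mult[OF \<phi>]])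
  have "\<exists>C>0. \<forall>z. (1 + norm z) ^ N * norm (iter_deriv bs k z) \<le> C" for bs
    using schwartzE[OF skbs[of bs] Nil_multi_indices, of N] by auto
  then obtain C1 where C1: "\<And>bs. C1 bs > 0" "\<And>bs z. (1 + norm z) ^ N * norm (iter_deriv bs k z) \<le> C1 bs"
    by metis
  have "\<exists>C>0. \<forall>y z. norm (y - z) \<le> 1 \<longrightarrow> (1 + norm y) ^ N * norm (iter_deriv bs k y - iter_deriv bs k z) \<le> C * norm (y - z)" for bs
    using schwartz_lipschitz[OF skbs[of bs], of N] by metis
  then obtain C2 where C2: "\<And>bs. C2 bs > 0" "\<And>bs y z. norm (y - z) \<le> 1 \<Longrightarrow>
       (1 + norm y) ^ N * norm (iter_deriv bs k y - iter_deriv bs k z) \<le> C2 bs * norm (y - z)"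
    by metis
  \<comment> \<open>One constant for the size and the Lipschitz bounds of all derivatives of order
    at most \<open>N\<close>; the summand 1 keeps it positive.\<close>
  define B where "B = (\<Sum>bs\<in>?M. C1 bs + C2 bs) + 1"
  have BC: "C1 bs \<le> B" "C2 bs \<le> B" if "bs \<in> ?M" for bs
  proof -
    have "C1 bs + C2 bs \<le> (\<Sum>bs\<in>?M. C1 bs + C2 bs)"
      using that C1(1) C2(1) by (intro member_le_sum finite_multi_indices_upto) (auto intro: add_nonneg_nonneg less_imp_le)
    then show "C1 bs \<le> B" "C2 bs \<le> B" using C1(1)[of bs] C2(1)[of bs] by (auto simp: B_def)
  qed
  have B0: "B > 0"
    unfolding B_def using C1(1) C2(1) by (intro add_nonneg_pos sum_nonneg) (auto intro: add_nonneg_nonneg less_imp_le)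
  \<comment> \<open>Translation by \<open>X + L x\<close> costs at most the factor
    \<open>w x\<close> in the Schwartz weight. It is polynomial in \<open>x\<close> and will be
    absorbed by the decay of \<open>a\<close>.\<close>
  define w where "w = (\<lambda>x::'b. (1 + norm X) ^ N * (1 + norm x) ^ N)"
  have w0: "w x > 0" for x unfolding w_def by (intro mult_pos_pos zero_less_power) (auto intro: add_pos_nonneg)
  have ww: "(1 + norm y) ^ N \<le> w x * (1 + norm (X + L x - y)) ^ N" for x y
  proof -
    have "1 + norm (X + L x) \<le> (1 + norm X) * (1 + norm x)"
      using one_plus_norm_mult_le[of X "L x"] mult_left_mono[of "1 + norm (L x)" "1 + norm x" "1 + norm X"] normL[of x]
      by auto
    then have "(1 + norm (X + L x)) ^ N \<le> w x"
      unfolding w_def power_mult_distrib[symmetric] by (intro power_mono) auto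
    then have "(1 + norm (X + L x)) ^ N * (1 + norm (X + L x - y)) ^ N \<le> w x * (1 + norm (X + L x - y)) ^ N"
      by (rule mult_right_mono) simp
    then show ?thesis using weight_shift[of y N "X + L x"] by linarith
  qed
  have sG: "schwartz (G x)" for x unfolding G_def k_def[symmetric] by (rule schwartz_reflect[OF sk])
  have dG: "iter_deriv bs (G x) y = (- 1) ^ length bs *\<^sub>R iter_deriv bs k (X + L x - y)" if "bs \<in> ?M" for bs x y
    unfolding G_def k_def[symmetric] by (rule iter_deriv_reflect[OF schwartz_smooth[OF sk] M[OF that]])
  have b1: "(1 + norm y) ^ N * norm (iter_deriv bs (G x) y) \<le> B * w x" if bs: "bs \<in> ?M" for bs x y
  proof -
    have "(1 + norm y) ^ N * norm (iter_deriv bs (G x) y)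
       \<le> (w x * (1 + norm (X + L x - y)) ^ N) * norm (iter_deriv bs k (X + L x - y))"
      using ww[of y x] by (simp add: dG[OF bs] mult_right_mono)
    also have "\<dots> \<le> w x * C1 bs"
      using C1(2)[of "X + L x - y" bs] w0[of x] by (simp add: mult.assoc mult_left_mono)
    also have "\<dots> \<le> B * w x" using BC[OF bs] w0[of x] by (simp add: mult.commute mult_right_mono)
    finally show ?thesis .
  qed
  have b2: "(1 + norm y) ^ N * norm (iter_deriv bs (G x) y - iter_deriv bs (G t) y) \<le> B * w x * norm (x - t)"
    if bs: "bs \<in> ?M" and xt: "norm (x - t) \<le> 1" for bs x t y
  proof -
    have e: "(X + L x - y) - (X + L t - y) = L (x - t)"
      using L by (simp add: bounded_linear.linear linear_diff)
    have "(1 + norm y) ^ N * norm (iter_deriv bs (G x) y - iter_deriv bs (G t) y)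
       \<le> (w x * (1 + norm (X + L x - y)) ^ N) * norm (iter_deriv bs k (X + L x - y) - iter_deriv bs k (X + L t - y))"
      using ww[of y x] by (simp add: dG[OF bs] mult_right_mono scaleR_diff_right[symmetric])
    also have "\<dots> \<le> w x * (C2 bs * norm (L (x - t)))"
      using C2(2)[of "X + L x - y" "X + L t - y" bs] w0[of x] xt normL[of "x - t"]
      by (simp add: mult.assoc mult_left_mono e del: add_diff_cancel_left add_diff_cancel_right)
    also have "\<dots> \<le> w x * (B * norm (x - t))"
      using BC[OF bs] w0[of x] normL[of "x - t"] C2(1)[of bs] B0 by (intro mult_left_mono mult_mono) auto
    finally show ?thesis by (simp add: mult_ac)
  qed
  define v where "v = (\<lambda>x. u (G x))"
  have v1: "norm (v x) \<le> K * (B * w x)" for x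
    unfolding v_def using b1 by (intro uK sG) auto
  have v2: "norm (v x - v t) \<le> K * (B * w x * norm (x - t))" if "norm (x - t) \<le> 1" for x t
  proof -
    have "v x - v t = u (\<lambda>y. 1 * G x y + (-1) * G t y)"
      unfolding v_def tempered_linear[OF u sG sG] by simp
    also have "norm \<dots> \<le> K * (B * w x * norm (x - t))"
    proof (rule uK[OF schwartz_lincomb[OF sG sG]])
      fix bs :: "'a list" and y :: 'a assume bs: "bs \<in> ?M"
      show "(1 + norm y) ^ N * norm (iter_deriv bs (\<lambda>y. 1 * G x y + (-1) * G t y) y) \<le> B * w x * norm (x - t)"
        unfolding iter_deriv_lincomb[OF schwartz_smooth[OF sG] schwartz_smooth[OF sG] M[OF bs]]
        using b2[OF bs that] by simp
    qed
    finally show ?thesis .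
  qed
  have contv: "continuous_on UNIV v"
  proof (rule continuous_at_imp_continuous_on, rule ballI)
    fix x :: 'b
    have "((\<lambda>t. v x - v t) \<longlongrightarrow> 0) (at x)"
    proof (rule Lim_null_comparison)
      have "\<forall>\<^sub>F t in at x. norm (x - t) \<le> 1"
        using eventually_at_ball[of 1 x UNIV] by (auto elim!: eventually_mono simp: dist_norm)
      then show "\<forall>\<^sub>F t in at x. norm (v x - v t) \<le> K * (B * w x * norm (x - t))"
        by eventually_elim (rule v2)
      show "((\<lambda>t. K * (B * w x * norm (x - t))) \<longlongrightarrow> 0) (at x)"
        by (rule tendsto_eq_intros refl | simp)+
    qed
    from tendsto_diff[OF tendsto_const[of "v x"] this] show "isCont v x"
      by (simp add: isCont_def)
  qed
  then show "continuous_on UNIV (\<lambda>x. u (G x))" by (simp add: v_def)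
  have "norm (u (G x)) \<le> (K * B * (1 + norm X) ^ N) * (1 + norm x) ^ N" for x
    using v1[of x] by (simp add: v_def w_def mult_ac)
  then show "\<exists>C N. \<forall>x. norm (u (G x)) \<le> C * (1 + norm x) ^ N" by blast
  have conta: "continuous_on UNIV a" by (rule rapid_continuous[OF a])
  \<comment> \<open>This majorant dominates all weighted derivatives of the integrand and, up to the
    factor \<open>K\<close>, also the scalar integrand \<open>h\<close>. Hence a single box and a
    single tagged division serve all of them.\<close>
  define d where "d = (\<lambda>x. B * w x * norm (a x))"
  have d_int: "integrable lborel d"
  proof -
    have "rapid (\<lambda>x. complex_of_real (B * w x) * a x)"
    proof (rule rapid_mult[OF a, where C="B * (1 + norm X) ^ N" and M=N])
      show "continuous_on UNIV (\<lambda>x. complex_of_real (B * w x))"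
        unfolding w_def by (intro continuous_intros)
      show "norm (complex_of_real (B * w x)) \<le> B * (1 + norm X) ^ N * (1 + norm x) ^ N" for x
        using B0 unfolding norm_of_real w_def by (simp add: abs_mult mult_ac)
    qed
    from integrable_norm[OF rapid_integrable[OF this]] show ?thesis
      using B0 w0 unfolding d_def by (simp add: norm_mult less_imp_le del: of_real_mult)
  qed
  have rT: "test_function (\<lambda>\<xi>. osc_int a (Ls \<xi>) * \<phi> \<xi>)"
    using smooth_affine[OF Ls smooth_osc_int[OF a], of 0] by (intro test_function_mult[OF \<phi>]) simp
  have sT: "schwartz T" unfolding T_def by (rule schwartz_reflect[OF schwartz_osc_int[OF rT]])
  have dT: "iter_deriv bs T y = (LINT x|lborel. a x * iter_deriv bs (G x) y)" if bs: "bs \<in> ?M" for bs y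
  proof -
    have "iter_deriv bs T y = (- 1) ^ length bs *\<^sub>R osc_int (\<lambda>\<xi>. i_monomial bs \<xi> * (osc_int a (Ls \<xi>) * \<phi> \<xi>)) (X - y)"
      unfolding T_def iter_deriv_reflect[OF schwartz_smooth[OF schwartz_osc_int[OF rT]] M[OF bs]]
        iter_deriv_osc_int[OF test_function_rapid[OF rT]] ..
    also have "osc_int (\<lambda>\<xi>. i_monomial bs \<xi> * (osc_int a (Ls \<xi>) * \<phi> \<xi>)) (X - y) = osc_int (\<lambda>\<xi>. osc_int a (Ls \<xi>) * (i_monomial bs \<xi> * \<phi> \<xi>)) (X - y)"
      by (simp add: mult_ac)
    also have "\<dots> = (LINT x|lborel. a x * osc_int (\<lambda>\<xi>. i_monomial bs \<xi> * \<phi> \<xi>) ((X - y) + L x))"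
      by (rule conv_osc_int[OF a test_function_rapid[OF test_function_i_monomial_mult[OF \<phi>]] L adj, symmetric])
    also have "(- 1) ^ length bs *\<^sub>R \<dots> = (LINT x|lborel. (- 1) ^ length bs *\<^sub>R (a x * osc_int (\<lambda>\<xi>. i_monomial bs \<xi> * \<phi> \<xi>) ((X - y) + L x)))"
      by (rule integral_scaleR_right[symmetric])
    also have "\<dots> = (LINT x|lborel. a x * iter_deriv bs (G x) y)"
      by (intro Bochner_Integration.integral_cong refl) (simp add: dG[OF bs] kbs algebra_simps)
    finally show ?thesis .
  qed
  define h where "h = (\<lambda>x. a x * v x)"
  \<comment> \<open>\<open>u T\<close> and the integral are both compared with \<open>u S\<close>
    for a Riemann sum \<open>S\<close>. Each comparison costs at most
    \<open>2 * K * \<epsilon>\<close>, one half for the tail and one half for the box.\<close>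
  have main: "norm (u T - (LINT x|lborel. h x)) \<le> 4 * K * \<epsilon>" if eps: "\<epsilon> > 0" for \<epsilon>
  proof -
    obtain p0 q0 where tail: "(LINT x|lborel. indicator (- cbox p0 q0) x * d x) \<le> \<epsilon>"
      using integrable_tail[OF d_int eps] .
    define V where "V = measure lborel (cbox p0 q0)"
    \<comment> \<open>\<open>V + 1\<close> instead of \<open>V\<close> avoids a division by zero for
      a degenerate box.\<close>
    define e where "e = \<epsilon> / (V + 1)"
    have V0: "V \<ge> 0" by (simp add: V_def)
    have e0: "e > 0" using eps V0 by (simp add: e_def)
    have eV: "e * V \<le> \<epsilon>" using eps V0 by (simp add: e_def field_simps)
    have bdd: "\<exists>B>0. \<forall>x\<in>cbox p0 q0. f x \<le> B" if f: "continuous_on UNIV f" for f :: "'b \<Rightarrow> real"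
    proof -
      have "compact (f ` cbox p0 q0)"
        using continuous_on_subset[OF f] by (intro compact_continuous_image compact_cbox) auto
      then obtain B where "B > 0" "\<forall>y\<in>f ` cbox p0 q0. norm y \<le> B"
        using compact_imp_bounded bounded_pos by blast
      then show ?thesis by force
    qed
    have "continuous_on UNIV w" unfolding w_def by (intro continuous_intros)
    then obtain W where W: "W > 0" "\<And>x. x \<in> cbox p0 q0 \<Longrightarrow> w x \<le> W" using bdd by blast
    obtain A where A: "A > 0" "\<And>x. x \<in> cbox p0 q0 \<Longrightarrow> norm (a x) \<le> A"
      using bdd[OF continuous_on_norm[OF conta]] by blast
    have "uniformly_continuous_on (cbox p0 q0) a"
      using compact_uniformly_continuous[OF continuous_on_subset[OF conta]] by auto
    then obtain \<delta>1 where \<delta>1: "\<delta>1 > 0" "\<And>x t. x \<in> cbox p0 q0 \<Longrightarrow> t \<in> cbox p0 q0 \<Longrightarrow> dist t x < \<delta>1 \<Longrightarrow> dist (a t) (a x) < e / (2 * B * W)"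
    proof -
      assume uc: "uniformly_continuous_on (cbox p0 q0) a"
        and *: "\<And>\<delta>1. 0 < \<delta>1 \<Longrightarrow> (\<And>x t. x \<in> cbox p0 q0 \<Longrightarrow> t \<in> cbox p0 q0 \<Longrightarrow> dist t x < \<delta>1 \<Longrightarrow>
            dist (a t) (a x) < e / (2 * B * W)) \<Longrightarrow> thesis"
      have "e / (2 * B * W) > 0" using e0 B0 W(1) by simp
      with uc obtain \<delta>1 where "\<delta>1 > 0" "\<forall>x\<in>cbox p0 q0. \<forall>t\<in>cbox p0 q0. dist t x < \<delta>1 \<longrightarrow> dist (a t) (a x) < e / (2 * B * W)"
        unfolding uniformly_continuous_on_def by blast
      then show thesis by (intro *) auto
    qed
    \<comment> \<open>The bounds \<open>\<delta>1\<close> and \<open>e / (2 * B * W * A)\<close>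
      make each of the two summands in \<open>osc\<close> at most \<open>e / 2\<close>; the bound 1
      is the range of the Lipschitz estimate \<open>b2\<close>.\<close>
    define \<delta> where "\<delta> = min 1 (min \<delta>1 (e / (2 * B * W * A)))"
    have \<delta>0: "\<delta> > 0" using \<delta>1(1) e0 B0 W(1) A(1) by (simp add: \<delta>_def)
    have osc: "norm (a x - a t) * (B * w x) + norm (a t) * (B * w x * norm (x - t)) \<le> e" "norm (x - t) \<le> 1"
      if "x \<in> cbox p0 q0" "t \<in> cbox p0 q0" "dist t x < \<delta>" for x t
    proof -
      have "norm (a x - a t) * (B * w x) \<le> (e / (2 * B * W)) * (B * W)"
        using \<delta>1(2)[OF that(1,2)] that B0 W(2)[OF that(1)] w0[of x] e0 W(1)
        by (intro mult_mono) (auto simp: \<delta>_def dist_norm norm_minus_commute)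
      moreover have "norm (a t) * (B * w x * norm (x - t)) \<le> A * (B * W * (e / (2 * B * W * A)))"
        using that B0 W w0[of x] A by (intro mult_mono) (auto simp: \<delta>_def dist_norm norm_minus_commute less_imp_le)
      ultimately show "norm (a x - a t) * (B * w x) + norm (a t) * (B * w x * norm (x - t)) \<le> e"
        using B0 W(1) A(1) e0 by (simp add: field_simps)
      show "norm (x - t) \<le> 1" using that by (simp add: \<delta>_def dist_norm norm_minus_commute)
    qed
    have "gauge (\<lambda>x::'b. ball x \<delta>)" using \<delta>0 by (simp add: gauge_ball)
    then obtain p where p: "p tagged_division_of cbox p0 q0" "(\<lambda>x. ball x \<delta>) fine p"
      using fine_division_exists by metis
    have fp: "finite p" using p(1) by (rule tagged_division_of_finite)
    define c where "c = (\<lambda>i::'b \<times> 'b set. complex_of_real (measure lborel (snd i)) * a (fst i))"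
    define S where "S = (\<lambda>y. \<Sum>i\<in>p. c i * G (fst i) y)"
    have sS: "schwartz S" unfolding S_def by (rule tempered_sum(1)[OF u fp sG])
    have uS: "u S = (\<Sum>(t, Q)\<in>p. measure lborel Q *\<^sub>R h t)"
      unfolding S_def tempered_sum(2)[OF u fp sG]
      by (simp add: h_def v_def c_def split_def scaleR_conv_of_real mult_ac)
    have "norm ((LINT x|lborel. h x) - u S) \<le> K * \<epsilon> + (K * e) * V"
      unfolding uS V_def
    proof (rule riemann_sum_approx[OF _ _ _ _ p])
      show "integrable lborel (\<lambda>x. K * d x)" using d_int by simp
      show "continuous_on UNIV h" unfolding h_def by (intro continuous_intros conta contv)
      show "norm (h x) \<le> K * d x" for x
        using mult_left_mono[OF v1[of x] norm_ge_zero[of "a x"]] by (simp add: h_def d_def norm_mult mult_ac)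
      show "(LINT x|lborel. indicator (- cbox p0 q0) x * (K * d x)) \<le> K * \<epsilon>"
        using mult_left_mono[OF tail, of K] K by (simp add: mult.left_commute)
      fix x t assume xt: "x \<in> cbox p0 q0" "t \<in> cbox p0 q0" "dist t x < \<delta>"
      have "norm (h x - h t) = norm ((a x - a t) * v x + a t * (v x - v t))"
        by (simp add: h_def algebra_simps)
      also have "\<dots> \<le> norm (a x - a t) * norm (v x) + norm (a t) * norm (v x - v t)"
        by (rule norm_triangle_le) (simp add: norm_mult)
      also have "\<dots> \<le> norm (a x - a t) * (K * (B * w x)) + norm (a t) * (K * (B * w x * norm (x - t)))"
        by (intro add_mono mult_left_mono v1 v2 osc(2)[OF xt]) auto
      also have "\<dots> = K * (norm (a x - a t) * (B * w x) + norm (a t) * (B * w x * norm (x - t)))"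
        by (simp add: algebra_simps)
      also have "\<dots> \<le> K * e" using osc(1)[OF xt] K by (intro mult_left_mono) auto
      finally show "norm (h x - h t) \<le> K * e" .
    qed
    moreover have "norm (u T - u S) \<le> K * (\<epsilon> + e * V)"
    proof -
      have "u T - u S = u (\<lambda>y. 1 * T y + (-1) * S y)"
        unfolding tempered_linear[OF u sT sS] by simp
      also have "norm \<dots> \<le> K * (\<epsilon> + e * V)"
      proof (rule uK[OF schwartz_lincomb[OF sT sS]])
        fix bs :: "'a list" and y :: 'a assume bs: "bs \<in> ?M"
        \<comment> \<open>The weight is moved into the integrand; the Riemann estimate then applies
          for every \<open>bs\<close> and \<open>y\<close> with the same \<open>d\<close>,
          \<open>p\<close> and \<open>e\<close>, which gives the uniform bound that
          \<open>uK\<close> asks for.\<close>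
        let ?n = "complex_of_real ((1 + norm y) ^ N)"
        let ?g = "\<lambda>x. ?n * (a x * iter_deriv bs (G x) y)"
        have "iter_deriv bs S y = (\<Sum>i\<in>p. c i * iter_deriv bs (G (fst i)) y)"
          unfolding S_def iter_deriv_sum[OF fp schwartz_smooth[OF sG] M[OF bs]] ..
        then have gS: "?n * iter_deriv bs S y = (\<Sum>(t, Q)\<in>p. measure lborel Q *\<^sub>R ?g t)"
          by (simp add: c_def split_def scaleR_conv_of_real mult_ac sum_distrib_left)
        have gT: "?n * iter_deriv bs T y = (LINT x|lborel. ?g x)"
          unfolding dT[OF bs] by (rule integral_mult_right_zero[symmetric])
        have n: "norm ?n = (1 + norm y) ^ N" by (simp add: norm_power del: of_real_power)
        have "(1 + norm y) ^ N * norm (iter_deriv bs (\<lambda>y. 1 * T y + (-1) * S y) y)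
            = norm (?n * iter_deriv bs T y - ?n * iter_deriv bs S y)"
          unfolding iter_deriv_lincomb[OF schwartz_smooth[OF sT] schwartz_smooth[OF sS] M[OF bs]]
            right_diff_distrib[symmetric] norm_mult n by simp
        also have "\<dots> \<le> \<epsilon> + e * V"
          unfolding gS gT V_def
        proof (rule riemann_sum_approx[OF d_int _ _ tail p])
          have "continuous_on UNIV (\<lambda>x. iter_deriv bs (G x) y)"
            unfolding dG[OF bs]
            by (intro continuous_intros continuous_on_compose2[OF smooth_continuous[OF schwartz_smooth[OF skbs]], of UNIV]
                bounded_linear.continuous_on[OF L]) auto
          then show "continuous_on UNIV ?g" by (intro continuous_intros conta)
          show "norm (?g x) \<le> d x" for x
            using mult_left_mono[OF b1[OF bs, of y x] norm_ge_zero[of "a x"]]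
            unfolding norm_mult n d_def by (simp add: mult_ac)
          fix x t assume xt: "x \<in> cbox p0 q0" "t \<in> cbox p0 q0" "dist t x < \<delta>"
          have "norm (?g x - ?g t) = norm (?n * ((a x - a t) * iter_deriv bs (G x) y + a t * (iter_deriv bs (G x) y - iter_deriv bs (G t) y)))"
            by (simp add: algebra_simps)
          also have "\<dots> \<le> (1 + norm y) ^ N * (norm (a x - a t) * norm (iter_deriv bs (G x) y) +
               norm (a t) * norm (iter_deriv bs (G x) y - iter_deriv bs (G t) y))"
            unfolding norm_mult n by (intro mult_left_mono norm_triangle_le) (auto simp: norm_mult)
          also have "\<dots> = norm (a x - a t) * ((1 + norm y) ^ N * norm (iter_deriv bs (G x) y)) +
               norm (a t) * ((1 + norm y) ^ N * norm (iter_deriv bs (G x) y - iter_deriv bs (G t) y))"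
            by (simp add: algebra_simps)
          also have "\<dots> \<le> norm (a x - a t) * (B * w x) + norm (a t) * (B * w x * norm (x - t))"
            by (intro add_mono mult_left_mono b1[OF bs] b2[OF bs osc(2)[OF xt]]) auto
          also have "\<dots> \<le> e" by (rule osc(1)[OF xt])
          finally show "norm (?g x - ?g t) \<le> e" .
        qed
        finally show "(1 + norm y) ^ N * norm (iter_deriv bs (\<lambda>y. 1 * T y + (-1) * S y) y) \<le> \<epsilon> + e * V" .
      qed
      finally show ?thesis .
    qed
    moreover have "K * (e * V) \<le> K * \<epsilon>" using eV K by (intro mult_left_mono) auto
    moreover have "norm (u T - (LINT x|lborel. h x)) \<le> norm (u T - u S) + norm ((LINT x|lborel. h x) - u S)"
      by (metis norm_minus_commute norm_triangle_ineq4 diff_diff_eq2 diff_add_cancel add_diff_eq norm_triangle_sub norm_triangle_ineq diff_add_eq)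
    ultimately show ?thesis by (simp add: algebra_simps)
  qed
  have "norm (u T - (LINT x|lborel. h x)) \<le> 0"
  proof (rule field_le_epsilon)
    fix e :: real assume "e > 0"
    then show "norm (u T - (LINT x|lborel. h x)) \<le> 0 + e"
      using main[of "e / (4 * K)"] K by simp
  qed
  then show "u T = (LINT x|lborel. a x * u (G x))" by (simp add: h_def v_def)
qed

section \<open>Continuous functions as distributions\<close>

lemma exists_bump:
  fixes x0 :: "'a::euclidean_space"
  assumes \<Psi>: "LP_cutoff \<Psi>" and "\<delta> > 0"
  obtains \<beta> :: "'a \<Rightarrow> real" where "test_function (\<lambda>x. of_real (\<beta> x))" "\<And>x. \<beta> x \<ge> 0"
    "\<And>x. dist x0 x \<ge> \<delta> \<Longrightarrow> \<beta> x = 0" "integrable lborel \<beta>" "(LINT x|lborel. \<beta> x) > 0"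
proof -
  \<comment> \<open>Dilation by \<open>c\<close> sends the distance \<open>\<delta>\<close> to 2,
    beyond 13/10, and \<open>\<delta> / 2\<close> to 1, below 11/10.\<close>
  define c where "c = 2 / \<delta>"
  define P where "P = (\<lambda>x. LP_Psi \<Psi> 0 (c *\<^sub>R x + - c *\<^sub>R x0))"
  \<comment> \<open>Squaring makes the bump non-negative, as \<open>LP_cutoff\<close> leaves the
    sign of \<open>\<Psi>\<close> between 11/10 and 13/10 open.\<close>
  define \<beta> where "\<beta> = (\<lambda>x. P x * P x)"
  have c: "c > 0" using assms(2) by (simp add: c_def)
  have n: "norm (c *\<^sub>R x + - c *\<^sub>R x0) = c * dist x0 x" for x
  proof -
    have "c *\<^sub>R x + - c *\<^sub>R x0 = c *\<^sub>R (x - x0)" by (simp add: scaleR_diff_right)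
    then show ?thesis using c by (simp only: norm_scaleR dist_norm norm_minus_commute[of x0] abs_of_pos)
  qed
  have sm: "smooth \<beta>" unfolding \<beta>_def P_def by (intro smooth_mult smooth_scaled smooth_LP_Psi \<Psi>)
  have z: "\<beta> x = 0" if "dist x0 x \<ge> \<delta>" for x
  proof -
    have "c * dist x0 x \<ge> c * \<delta>" using that c by (intro mult_left_mono) auto
    then have "norm (c *\<^sub>R x + - c *\<^sub>R x0) > 13/10 * 2 ^ 0" unfolding n using assms(2) by (simp add: c_def)
    from LP_Psi_eq_0[OF \<Psi> this] show ?thesis by (simp add: \<beta>_def P_def)
  qed
  have o: "\<beta> x = 1" if "dist x0 x < \<delta> / 2" for x
  proof -
    have "c * dist x0 x < c * (\<delta> / 2)" using that c by (intro mult_strict_left_mono) auto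
    moreover have "c * (\<delta> / 2) = 1" using assms(2) by (simp add: c_def)
    ultimately have "norm (c *\<^sub>R x + - c *\<^sub>R x0) < 11/10 * 2 ^ 0" unfolding n by simp
    from LP_Psi_eq_1[OF \<Psi> this] show ?thesis by (simp add: \<beta>_def P_def)
  qed
  have t: "test_function (\<lambda>x. complex_of_real (\<beta> x))"
  proof (rule test_functionI[of _ "norm x0 + \<delta>"])
    show "smooth (\<lambda>x. complex_of_real (\<beta> x))" by (rule smooth_of_real[OF sm])
    fix x :: 'a assume "norm x > norm x0 + \<delta>"
    then have "dist x0 x \<ge> \<delta>" using norm_triangle_ineq2[of x x0] by (simp add: dist_norm norm_minus_commute)
    then show "complex_of_real (\<beta> x) = 0" using z by simp
  qed
  have i: "integrable lborel \<beta>"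
    using rapid_integrable[OF test_function_rapid[OF t]] by (simp add: complex_of_real_integrable_eq)
  have "measure lborel (ball x0 (\<delta> / 2)) = (LINT x|lborel. indicator (ball x0 (\<delta> / 2)) x)" by simp
  also have "\<dots> \<le> (LINT x|lborel. \<beta> x)"
  proof (rule integral_mono[OF _ i])
    show "integrable lborel (indicator (ball x0 (\<delta> / 2)) :: 'a \<Rightarrow> real)"
      by (intro integrable_real_indicator) (use emeasure_lborel_ball_finite in auto)
    show "indicator (ball x0 (\<delta> / 2)) x \<le> \<beta> x" for x
      using o[of x] by (auto simp: indicator_def \<beta>_def)
  qed
  finally have le: "measure lborel (ball x0 (\<delta> / 2)) \<le> (LINT x|lborel. \<beta> x)" .
  have "0 < measure lborel (ball x0 (\<delta> / 2))" using assms(2) by (intro content_ball_pos) simp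
  from less_le_trans[OF this le] have "(LINT x|lborel. \<beta> x) > 0" .
  with t z i show ?thesis using that[of \<beta>] by (simp add: \<beta>_def)
qed

lemma integrable_continuous_test:
  fixes g :: "'a::euclidean_space \<Rightarrow> complex"
  assumes g: "continuous_on UNIV g" and f: "test_function f"
  shows "integrable lborel (\<lambda>x. g x * f x)"
proof -
  obtain R where R: "R > 0" "\<And>x. norm x > R \<Longrightarrow> f x = 0" using test_functionE[OF f] by metis
  have fc: "continuous_on UNIV f" by (rule smooth_continuous[OF test_function_smooth[OF f]])
  have "integrable lborel (\<lambda>x. indicator (cball 0 R) x *\<^sub>R (g x * f x))"
    by (rule borel_integrable_compact) (use continuous_on_subset[OF g] continuous_on_subset[OF fc] in \<open>auto intro!: continuous_intros\<close>)
  also have "(\<lambda>x. indicator (cball 0 R) x *\<^sub>R (g x * f x)) = (\<lambda>x. g x * f x)"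
    using R(2) by (auto simp: indicator_def fun_eq_iff not_le)
  finally show ?thesis .
qed

text \<open>Uniqueness for the description operator in \<open>function_of\<close>: a non-negative
  bump, supported where the difference of the functions hardly varies, would detect a point at which
  they differ.\<close>

lemma continuous_eqI_test:
  fixes g1 g2 :: "'a::euclidean_space \<Rightarrow> complex"
  assumes \<Psi>: "LP_cutoff \<Psi>" and g: "continuous_on UNIV g1" "continuous_on UNIV g2"
    and eq: "\<And>f. test_function f \<Longrightarrow> regular_functional g1 f = regular_functional g2 f"
  shows "g1 = g2"
proof (rule ext, rule ccontr)
  fix x0 assume ne: "g1 x0 \<noteq> g2 x0"
  define g where "g = (\<lambda>x. g1 x - g2 x)"
  have cg: "continuous_on UNIV g" unfolding g_def by (intro continuous_intros g)
  define e where "e = norm (g x0) / 2"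
  have e: "e > 0" using ne by (simp add: e_def g_def)
  obtain \<delta> where \<delta>: "\<delta> > 0" "\<And>x. dist x0 x < \<delta> \<Longrightarrow> norm (g x0 - g x) \<le> e"
    using cg e unfolding continuous_on_iff by (metis UNIV_I dist_commute dist_norm less_imp_le)
  obtain \<beta> where \<beta>: "test_function (\<lambda>x. complex_of_real (\<beta> x))" "\<And>x. \<beta> x \<ge> 0"
    "\<And>x. dist x0 x \<ge> \<delta> \<Longrightarrow> \<beta> x = 0" "integrable lborel \<beta>" "(LINT x|lborel. \<beta> x) > 0"
    using exists_bump[OF \<Psi> \<delta>(1), of x0] by metis
  note i = integrable_continuous_test[OF g(1) \<beta>(1)] integrable_continuous_test[OF g(2) \<beta>(1)]
  have "(LINT x|lborel. g x * \<beta> x) = 0"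
    using eq[OF \<beta>(1)] i by (simp add: regular_functional_def g_def left_diff_distrib)
  then have "g x0 * (LINT x|lborel. \<beta> x) = (LINT x|lborel. (g x0 - g x) * \<beta> x)"
    using integrable_continuous_test[OF cg \<beta>(1)] \<beta>(4) by (simp add: left_diff_distrib)
  also have "norm \<dots> \<le> (LINT x|lborel. e * \<beta> x)"
  proof (rule norm_integral_le)
    show "integrable lborel (\<lambda>x. e * \<beta> x)" using \<beta>(4) by simp
    show "norm ((g x0 - g x) * \<beta> x) \<le> e * \<beta> x" for x
      using \<beta>(2)[of x] \<beta>(3)[of x] \<delta>(2)[of x] by (cases "dist x0 x < \<delta>") (auto simp: norm_mult mult_right_mono)
  qed
  finally have "norm (g x0) * (LINT x|lborel. \<beta> x) \<le> e * (LINT x|lborel. \<beta> x)"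
    using \<beta>(5) by (simp add: norm_mult)
  then have "norm (g x0) \<le> e" using \<beta>(5) by simp
  then show False using e by (simp add: e_def)
qed

lemma function_of_eqI:
  fixes g :: "'a::euclidean_space \<Rightarrow> complex"
  assumes "LP_cutoff \<Psi>" "continuous_on UNIV g" "\<And>f. test_function f \<Longrightarrow> u f = regular_functional g f"
  shows "function_of u = g"
  unfolding function_of_def using assms continuous_eqI_test[OF assms(1)]
  by (intro the_equality) auto

section \<open>Littlewood--Paley blocks as convolutions\<close>

text \<open>The division turns \<open>osc_int\<close> into the inverse Fourier transform, so that
  \<open>kernel m\<close> is the convolution kernel of the Fourier multiplier
  \<open>m\<close>.\<close>

definition scaled_symbol :: "('a::euclidean_space \<Rightarrow> real) \<Rightarrow> 'a \<Rightarrow> complex" where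
  "scaled_symbol m \<xi> = of_real (m \<xi>) / of_real ((2 * pi) ^ DIM('a))"

definition kernel :: "('a::euclidean_space \<Rightarrow> real) \<Rightarrow> 'a \<Rightarrow> complex" where
  "kernel m = osc_int (scaled_symbol m)"

definition cutoff :: "('a::euclidean_space \<Rightarrow> real) \<Rightarrow> bool" where
  "cutoff m \<longleftrightarrow> smooth m \<and> (\<exists>R. \<forall>\<xi>. norm \<xi> > R \<longrightarrow> m \<xi> = 0)"

lemma test_function_scaled_symbol:
  fixes m :: "'a::euclidean_space \<Rightarrow> real"
  assumes "cutoff m" shows "test_function (scaled_symbol m)"
proof -
  obtain R where R: "\<And>\<xi>. norm \<xi> > R \<Longrightarrow> m \<xi> = 0" using assms by (auto simp: cutoff_def)
  have "smooth (\<lambda>\<xi>. of_real (m \<xi>) * (1 / of_real ((2 * pi) ^ DIM('a))) :: complex)"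
    using assms by (intro smooth_mult smooth_of_real smooth_const) (simp add: cutoff_def)
  then show ?thesis
    by (intro test_functionI[of _ R]) (auto simp: scaled_symbol_def[abs_def] R)
qed

lemma schwartz_kernel: "cutoff m \<Longrightarrow> schwartz (kernel m)"
  unfolding kernel_def by (intro schwartz_osc_int test_function_scaled_symbol)

lemma rapid_kernel: "cutoff m \<Longrightarrow> rapid (kernel m)"
  by (intro schwartz_rapid schwartz_kernel)

lemma osc_int_kernel: 
  fixes m :: "'a::euclidean_space \<Rightarrow> real"
  assumes "cutoff m" shows "osc_int (kernel m) (- \<xi>) = of_real (m \<xi>)"
  unfolding kernel_def using rapid_kernel[OF assms]
  by (subst osc_int_osc_int) (auto simp: test_function_rapid test_function_scaled_symbol assms kernel_def scaled_symbol_def)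

lemma cutoff_Phi: "LP_cutoff \<Psi> \<Longrightarrow> cutoff (LP_Phi \<Psi> j :: 'a::euclidean_space \<Rightarrow> real)"
  unfolding cutoff_def using smooth_LP_Phi LP_Phi_support(1) by (metis not_le)

lemma cutoff_Psi: "LP_cutoff \<Psi> \<Longrightarrow> cutoff (LP_Psi \<Psi> j :: 'a::euclidean_space \<Rightarrow> real)"
  unfolding cutoff_def using smooth_LP_Psi LP_Psi_eq_0 by blast

text \<open>After unfolding the transforms, the block tested with \<open>f\<close> is
  \<open>u\<close> applied to an average, weighted by \<open>f\<close>, of translated kernels.
  Moving \<open>u\<close> inside the average exhibits the function behind the functional. The
  polynomial growth is the starting point of Peetre's argument.\<close>

lemma LP_block_eq:
  fixes u :: "'a::euclidean_space functional"
  assumes \<Psi>: "LP_cutoff \<Psi>" and u: "tempered_distribution u"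
  shows "LP_block \<Psi> j u = (\<lambda>x. u (\<lambda>y. kernel (LP_Phi \<Psi> j) (x - y)))"
    and "continuous_on UNIV (LP_block \<Psi> j u)"
    and "\<exists>C N. \<forall>x. norm (LP_block \<Psi> j u x) \<le> C * (1 + norm x) ^ N"
proof -
  let ?\<phi> = "scaled_symbol (LP_Phi \<Psi> j) :: 'a \<Rightarrow> complex"
  let ?g = "\<lambda>x. u (\<lambda>y. kernel (LP_Phi \<Psi> j) (x - y))"
  note pt = pass_through[OF u _ test_function_scaled_symbol[OF cutoff_Phi[OF \<Psi>]] bounded_linear_ident bounded_linear_ident,
      where X=0, simplified, folded kernel_def]
  \<comment> \<open>The claims on continuity and growth in \<open>pass_through\<close> do not
    mention \<open>a\<close>, so they are taken at the zero function.\<close>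
  have r0: "rapid (\<lambda>x::'a. 0)" using schwartz_rapid[OF schwartz_zero] .
  show *: "LP_block \<Psi> j u = ?g"
    unfolding LP_block_def
  proof (rule function_of_eqI[OF \<Psi>])
    show "continuous_on UNIV ?g" using pt(1)[OF r0] .
    fix f :: "'a \<Rightarrow> complex" assume f: "test_function f"
    have "inverse_fourier_dist (mult_dist (LP_Phi \<Psi> j) (fourier_dist u)) f
        = u (\<lambda>y. osc_int (\<lambda>\<xi>. osc_int f \<xi> * ?\<phi> \<xi>) (- y))"
      by (simp add: inverse_fourier_dist_def mult_dist_def fourier_dist_def fourier_osc_int[abs_def]
          inverse_fourier_osc_int[abs_def] scaled_symbol_def[abs_def] mult.commute)
    also have "\<dots> = (LINT x|lborel. f x * ?g x)" using pt(3)[OF test_function_rapid[OF f]] by simp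
    finally show "inverse_fourier_dist (mult_dist (LP_Phi \<Psi> j) (fourier_dist u)) f = regular_functional ?g f"
      by (simp add: regular_functional_def mult.commute)
  qed
  show "continuous_on UNIV (LP_block \<Psi> j u)" unfolding * using pt(1)[OF r0] .
  show "\<exists>C N. \<forall>x. norm (LP_block \<Psi> j u x) \<le> C * (1 + norm x) ^ N" unfolding * using pt(2)[OF r0] .
qed

text \<open>Convolution along \<open>L\<close> multiplies the symbol of the block by
  \<open>m (Ls \<xi>)\<close>. The constant \<open>c\<close> will be 1 in reproducing formulas and 0
  for disjoint frequencies.\<close>

lemma LP_block_conv:
  fixes u :: "'a::euclidean_space functional" and m :: "'b::euclidean_space \<Rightarrow> real" and L :: "'b \<Rightarrow> 'a"
  assumes \<Psi>: "LP_cutoff \<Psi>" and u: "tempered_distribution u" and m: "cutoff m"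
    and L: "bounded_linear L" and Ls: "bounded_linear Ls" and adj: "\<And>x \<xi>. L x \<bullet> \<xi> = x \<bullet> Ls \<xi>"
    and normL: "\<And>x. norm (L x) \<le> norm x"
    and c: "\<And>\<xi>. m (Ls \<xi>) * LP_Phi \<Psi> j \<xi> = c * LP_Phi \<Psi> j \<xi>"
  shows "(LINT z|lborel. kernel m z * LP_block \<Psi> j u (X - L z)) = of_real c * LP_block \<Psi> j u X"
proof -
  let ?\<phi> = "scaled_symbol (LP_Phi \<Psi> j) :: 'a \<Rightarrow> complex"
  let ?k = "kernel (LP_Phi \<Psi> j) :: 'a \<Rightarrow> complex"
  have s: "schwartz (\<lambda>y. ?k (X - y))" by (intro schwartz_reflect schwartz_kernel cutoff_Phi \<Psi>)
  have e: "osc_int (kernel m) (- Ls \<xi>) * ?\<phi> \<xi> = of_real c * ?\<phi> \<xi>" for \<xi>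
    using c[of \<xi>] by (simp add: osc_int_kernel[OF m] scaled_symbol_def flip: of_real_mult)
  have "(LINT z|lborel. kernel m z * LP_block \<Psi> j u (X - L z)) =
      (LINT z|lborel. kernel m z * u (\<lambda>y. osc_int ?\<phi> (X + - L z - y)))"
    by (simp add: LP_block_eq(1)[OF \<Psi> u] kernel_def)
  also have "\<dots> = u (\<lambda>y. osc_int (\<lambda>\<xi>. osc_int (kernel m) (- Ls \<xi>) * ?\<phi> \<xi>) (X - y))"
    by (rule pass_through(3)[OF u rapid_kernel[OF m] test_function_scaled_symbol[OF cutoff_Phi[OF \<Psi>]]
          bounded_linear_minus[OF L] bounded_linear_minus[OF Ls], symmetric])
       (auto simp: adj normL)
  \<comment> \<open>The summand with factor 0 gives the argument the shape of
    \<open>tempered_linear\<close>.\<close>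
  also have "\<dots> = u (\<lambda>y. of_real c * ?k (X - y) + 0 * ?k (X - y))"
    unfolding e by (simp add: kernel_def osc_int_def mult.left_commute)
  also have "\<dots> = of_real c * u (\<lambda>y. ?k (X - y))"
    unfolding tempered_linear[OF u s s] by simp
  finally show ?thesis by (simp add: LP_block_eq(1)[OF \<Psi> u])
qed

lemma kernel_scaled:
  fixes m :: "'a::euclidean_space \<Rightarrow> real"
  assumes m: "cutoff m" and c: "c > 0"
  shows "kernel (\<lambda>\<xi>. m (inverse c *\<^sub>R \<xi>)) z = of_real (c ^ DIM('a)) * kernel m (c *\<^sub>R z)"
proof -
  have [measurable]: "scaled_symbol m \<in> borel_measurable borel"
    by (intro borel_measurable_continuous_onI smooth_continuous test_function_smooth test_function_scaled_symbol m)
  have "kernel (\<lambda>\<xi>. m (inverse c *\<^sub>R \<xi>)) z = (LINT \<xi>|lborel. exp (\<i> * of_real (z \<bullet> \<xi>)) * scaled_symbol m (inverse c *\<^sub>R \<xi>))"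
    by (simp add: kernel_def osc_int_def scaled_symbol_def)
  also have "\<dots> = \<bar>c\<bar> ^ DIM('a) *\<^sub>R (LINT \<xi>|lborel. exp (\<i> * of_real (z \<bullet> (0 + c *\<^sub>R \<xi>))) * scaled_symbol m (inverse c *\<^sub>R (0 + c *\<^sub>R \<xi>)))"
    by (rule lborel_integral_affine) (use c in auto)
  also have "\<dots> = of_real (c ^ DIM('a)) * kernel m (c *\<^sub>R z)"
    using c by (simp add: kernel_def osc_int_def scaleR_conv_of_real)
  finally show ?thesis .
qed

lemma kernel_Psi:
  assumes "LP_cutoff \<Psi>"
  shows "kernel (LP_Psi \<Psi> j :: 'a::euclidean_space \<Rightarrow> real) z = of_real ((2 ^ j) ^ DIM('a)) * kernel (LP_Psi \<Psi> 0) (2 ^ j *\<^sub>R z)"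
proof -
  have "(LP_Psi \<Psi> j :: 'a \<Rightarrow> real) = (\<lambda>\<xi>. LP_Psi \<Psi> 0 (inverse (2 ^ j) *\<^sub>R \<xi>))"
    by (simp add: LP_Psi_def fun_eq_iff powr_minus powr_realpow)
  then show ?thesis using kernel_scaled[OF cutoff_Psi[OF assms, of 0], of "2 ^ j" z] by simp
qed

text \<open>All these kernels are dilates of one rapidly decreasing kernel, hence the constant is
  independent of \<open>j\<close>.\<close>

lemma kernel_Psi_decay:
  assumes "LP_cutoff \<Psi>"
  shows "\<exists>C>0. \<forall>j z. norm (kernel (LP_Psi \<Psi> j :: 'a::euclidean_space \<Rightarrow> real) z) * (1 + 2 ^ j * norm z) ^ M \<le> C * (2 ^ j) ^ DIM('a)"
proof -
  obtain C where C: "C > 0" "\<And>z::'a. (1 + norm z) ^ M * norm (kernel (LP_Psi \<Psi> 0) z) \<le> C"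
    using rapidE[OF rapid_kernel[OF cutoff_Psi[OF assms]]] by metis
  have "norm (kernel (LP_Psi \<Psi> j) z) * (1 + 2 ^ j * norm z) ^ M \<le> C * (2 ^ j) ^ DIM('a)" for j and z :: 'a
    using mult_left_mono[OF C(2)[of "2 ^ j *\<^sub>R z"], of "(2 ^ j) ^ DIM('a)"]
    by (simp add: kernel_Psi[OF assms, of j z] norm_mult norm_power mult_ac)
  then show ?thesis using C(1) by blast
qed

lemma kernel_diff:
  assumes "cutoff m1" "cutoff m2"
  shows "kernel (\<lambda>\<xi>. m1 \<xi> - m2 \<xi>) z = kernel m1 z - kernel m2 z"
proof -
  have "integrable lborel (\<lambda>\<xi>. exp (\<i> * of_real (z \<bullet> \<xi>)) * scaled_symbol m \<xi>)" if "cutoff m" for m :: "'a \<Rightarrow> real"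
    by (intro rapid_integrable rapid_exp_mult test_function_rapid test_function_scaled_symbol that)
  from Bochner_Integration.integral_diff[OF this[OF assms(1)] this[OF assms(2)]]
  show ?thesis by (simp add: kernel_def osc_int_def scaled_symbol_def diff_divide_distrib right_diff_distrib)
qed

text \<open>The symbols with positive index are dilates of each other, but the one of index 0 is of
  a different kind. Differences of neighbouring \<open>LP_Psi\<close> kernels treat them
  together.\<close>

lemma kernel_Phi_decay:
  assumes "LP_cutoff \<Psi>"
  shows "\<exists>C>0. \<forall>j z. norm (kernel (LP_Phi \<Psi> j :: 'a::euclidean_space \<Rightarrow> real) z) * (1 + 2 ^ j * norm z) ^ M \<le> C * (2 ^ j) ^ DIM('a)"
proof -
  obtain C where C: "C > 0" "\<And>j (z::'a). norm (kernel (LP_Psi \<Psi> j) z) * (1 + 2 ^ j * norm z) ^ M \<le> C * (2 ^ j) ^ DIM('a)"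
    using kernel_Psi_decay[OF assms, of M] by metis
  have "norm (kernel (LP_Phi \<Psi> j) z) * (1 + 2 ^ j * norm z) ^ M \<le> (C + C * 2 ^ M) * (2 ^ j) ^ DIM('a)" for j and z :: 'a
  proof (cases j)
    case 0
    have "(LP_Phi \<Psi> 0 :: 'a \<Rightarrow> real) = LP_Psi \<Psi> 0" by (simp add: LP_Phi_def fun_eq_iff)
    then have "norm (kernel (LP_Phi \<Psi> j) z) * (1 + 2 ^ j * norm z) ^ M \<le> C * (2 ^ j) ^ DIM('a)"
      using C(2)[of 0 z] 0 by simp
    also have "\<dots> \<le> (C + C * 2 ^ M) * (2 ^ j) ^ DIM('a)"
      using C(1) by (intro mult_right_mono) auto
    finally show ?thesis .
  next
    case (Suc i)
    have "(LP_Phi \<Psi> j :: 'a \<Rightarrow> real) = (\<lambda>\<xi>. LP_Psi \<Psi> j \<xi> - LP_Psi \<Psi> i \<xi>)" using Suc by (simp add: LP_Phi_def fun_eq_iff)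
    then have k: "kernel (LP_Phi \<Psi> j) z = kernel (LP_Psi \<Psi> j) z - kernel (LP_Psi \<Psi> i) z"
      using kernel_diff[OF cutoff_Psi[OF assms] cutoff_Psi[OF assms]] by metis
    \<comment> \<open>Changing the scale of the weight from \<open>i\<close> to
      \<open>j = Suc i\<close> costs the factor 2 ^ M.\<close>
    have "(1 + 2 ^ j * norm z) ^ M \<le> (2 * (1 + 2 ^ i * norm z)) ^ M"
      by (intro power_mono) (auto simp: Suc add_nonneg_nonneg)
    then have "norm (kernel (LP_Psi \<Psi> i) z) * (1 + 2 ^ j * norm z) ^ M
        \<le> norm (kernel (LP_Psi \<Psi> i) z) * (2 * (1 + 2 ^ i * norm z)) ^ M" by (rule mult_left_mono) simp
    also have "\<dots> = 2 ^ M * (norm (kernel (LP_Psi \<Psi> i) z) * (1 + 2 ^ i * norm z) ^ M)"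
      unfolding power_mult_distrib by (simp add: mult_ac)
    also have "\<dots> \<le> 2 ^ M * (C * (2 ^ i) ^ DIM('a))" by (intro mult_left_mono C(2)) auto
    also have "\<dots> \<le> 2 ^ M * (C * (2 ^ j) ^ DIM('a))"
      using C(1) by (intro mult_left_mono power_mono) (auto simp: Suc)
    finally have "norm (kernel (LP_Psi \<Psi> i) z) * (1 + 2 ^ j * norm z) ^ M \<le> 2 ^ M * (C * (2 ^ j) ^ DIM('a))" .
    moreover have "norm (kernel (LP_Phi \<Psi> j) z) * (1 + 2 ^ j * norm z) ^ M
       \<le> (norm (kernel (LP_Psi \<Psi> j) z) + norm (kernel (LP_Psi \<Psi> i) z)) * (1 + 2 ^ j * norm z) ^ M"
      unfolding k by (intro mult_right_mono norm_triangle_ineq4) (simp add: add_nonneg_nonneg)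
    ultimately show ?thesis using C(2)[of j z] by (simp add: algebra_simps)
  qed
  moreover have "C + C * 2 ^ M > 0" using C(1) by (simp add: add_pos_pos)
  ultimately show ?thesis by blast
qed

section \<open>Maximal function estimates for band-limited functions\<close>

lemma weight_submult:
  fixes x y :: "'a::real_normed_vector"
  assumes "R \<ge> 0"
  shows "(1 + R * norm (x + y)) ^ M \<le> (1 + R * norm x) ^ M * (1 + R * norm y) ^ M"
proof -
  have "1 + R * norm (x + y) \<le> (1 + R * norm x) * (1 + R * norm y)"
    using one_plus_norm_mult_le[of "R *\<^sub>R x" "R *\<^sub>R y"] assms by (simp flip: scaleR_add_right)
  then have "(1 + R * norm (x + y)) ^ M \<le> ((1 + R * norm x) * (1 + R * norm y)) ^ M"
    using assms by (intro power_mono) (auto simp: add_nonneg_nonneg)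
  then show ?thesis by (simp add: power_mult_distrib)
qed

text \<open>
  The supremum \<open>S\<close> of \<open>norm (g y) / (1 + R * norm (x - y)) ^ M\<close> is Peetre's maximal function; splitting
  \<open>norm (g z)\<close> into the powers \<open>p\<close> and \<open>1 - p\<close> in the reproducing formula bounds \<open>S\<close> by
  \<open>S powr (1 - p)\<close> times the integral, and finiteness of \<open>S\<close> permits to divide.
\<close>

lemma peetre_aux:
  fixes g K :: "'a::euclidean_space \<Rightarrow> complex"
  assumes g: "continuous_on UNIV g" and K: "continuous_on UNIV K"
    and rep: "\<And>y. g y = (LINT z|lborel. K z * g (y - z))"
    and p: "0 < p" "p \<le> 1" and R: "R > 0"
    and dec: "\<And>z. norm (K z) * (1 + R * norm z) ^ M \<le> C"
    and bdd: "bdd_above (range (\<lambda>y. norm (g y) / (1 + R * norm (x - y)) ^ M))"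
    and int: "integrable lborel (\<lambda>z. norm (g z) powr p)"
  shows "norm (g x) powr p \<le> C * (LINT z|lborel. norm (g z) powr p * ((1 + R * norm (x - z)) ^ M) powr (- p))"
proof -
  define W where "W = (\<lambda>z::'a. (1 + R * norm z) ^ M)"
  have W1: "W z \<ge> 1" for z using R unfolding W_def by (intro one_le_power) auto
  have W0: "W z > 0" for z using W1[of z] by linarith
  have Wm: "W (a + b) \<le> W a * W b" for a b unfolding W_def using R by (intro weight_submult) auto
  define S where "S = (SUP y. norm (g y) / W (x - y))"
  have S: "norm (g y) \<le> S * W (x - y)" for y
  proof -
    have "norm (g y) / W (x - y) \<le> S" unfolding S_def using bdd by (intro cSUP_upper) (auto simp: W_def)
    then show ?thesis using W0 by (simp add: pos_divide_le_eq)
  qed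
  have S0: "S \<ge> 0" using order_trans[OF norm_ge_zero S[of x]] W0[of "x - x"] by (simp add: zero_le_mult_iff not_le)
  have [measurable]: "g \<in> borel_measurable borel" "K \<in> borel_measurable borel"
    using g K by (auto intro: borel_measurable_continuous_onI)
  define I where "I = (LINT z|lborel. norm (g z) powr p * W (x - z) powr (- p))"
  have W_meas [measurable]: "(\<lambda>z. W (x - z)) \<in> borel_measurable borel" unfolding W_def by measurable
  have Wp: "W z powr (- p) \<le> 1" for z
    using W1[of z] p ge_one_powr_ge_zero[of "W z" p] by (simp add: powr_minus inverse_le_1_iff)
  have iI: "integrable lborel (\<lambda>z. norm (g z) powr p * W (x - z) powr (- p))"
    by (rule Bochner_Integration.integrable_bound[OF int])
       (use Wp in \<open>auto intro!: AE_I2 simp: abs_mult mult_left_le\<close>)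
  have I0: "I \<ge> 0" unfolding I_def by (rule Bochner_Integration.integral_nonneg) simp
  have C0: "C \<ge> 0" using order_trans[OF _ dec[of 0]] by simp
  have key: "norm (g y) \<le> (C * S powr (1 - p) * I) * W (x - y)" for y
  proof -
    have "g y = (LINT z|lborel. K z * g (y - z))" by (rule rep)
    also have "\<dots> = \<bar>- 1 :: real\<bar> ^ DIM('a) *\<^sub>R (LINT z|lborel. K (y + (- 1) *\<^sub>R z) * g (y - (y + (- 1) *\<^sub>R z)))"
      by (rule lborel_integral_affine) auto
    also have "\<dots> = (LINT z|lborel. K (y - z) * g z)" by simp
    also have "norm \<dots> \<le> (LINT z|lborel. (C * S powr (1 - p) * W (x - y)) * (norm (g z) powr p * W (x - z) powr (- p)))"
    proof (rule norm_integral_le)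
      show "integrable lborel (\<lambda>z. (C * S powr (1 - p) * W (x - y)) * (norm (g z) powr p * W (x - z) powr (- p)))"
        using iI by simp
      fix z
      have "norm (g z) = norm (g z) powr (p + (1 - p))" by (cases "g z = 0") auto
      also have "\<dots> = norm (g z) powr p * norm (g z) powr (1 - p)" by (rule powr_add)
      also have "\<dots> \<le> norm (g z) powr p * (S * W (x - z)) powr (1 - p)"
        using S[of z] p by (intro mult_left_mono powr_mono2) auto
      also have "(S * W (x - z)) powr (1 - p) = S powr (1 - p) * (W (x - z) * W (x - z) powr (- p))"
        using S0 W0[of "x - z"] by (simp add: powr_mult powr_mult_base)
      \<comment> \<open>The weight is split at \<open>y\<close>: \<open>W (y - z)\<close> will be
        absorbed by the decay of \<open>K\<close>, while \<open>W (x - y)\<close> leaves the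
        integral and matches the denominator in the supremum \<open>S\<close>.\<close>
      also have "norm (g z) powr p * (S powr (1 - p) * (W (x - z) * W (x - z) powr (- p)))
         \<le> norm (g z) powr p * (S powr (1 - p) * ((W (x - y) * W (y - z)) * W (x - z) powr (- p)))"
        using Wm[of "x - y" "y - z"] by (intro mult_left_mono mult_right_mono) auto
      finally have "norm (K (y - z)) * norm (g z) \<le> norm (K (y - z)) *
          (norm (g z) powr p * (S powr (1 - p) * ((W (x - y) * W (y - z)) * W (x - z) powr (- p))))"
        by (rule mult_left_mono) simp
      also have "\<dots> = (norm (K (y - z)) * W (y - z)) * (S powr (1 - p) * W (x - y) * (norm (g z) powr p * W (x - z) powr (- p)))"
        by (simp add: mult_ac)
      also have "\<dots> \<le> C * (S powr (1 - p) * W (x - y) * (norm (g z) powr p * W (x - z) powr (- p)))"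
        using dec[of "y - z"] less_imp_le[OF W0] by (intro mult_right_mono mult_nonneg_nonneg) (auto simp: W_def)
      finally show "norm (K (y - z) * g z) \<le> (C * S powr (1 - p) * W (x - y)) * (norm (g z) powr p * W (x - z) powr (- p))"
        by (simp add: norm_mult mult_ac)
    qed
    finally show ?thesis by (simp add: I_def mult_ac)
  qed
  have gS: "norm (g x) \<le> S" using S[of x] by (simp add: W_def)
  have "norm (g x) powr p \<le> C * I"
  \<comment> \<open>Division by a power of \<open>S\<close> is impossible if \<open>S\<close> is 0,
    but then \<open>g\<close> vanishes at \<open>x\<close>.\<close>
  proof (cases "S = 0")
    case True
    then show ?thesis using gS p C0 I0 by simp
  next
    case False
    then have Sp: "S > 0" using S0 by simp
    have "S \<le> C * S powr (1 - p) * I"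
      unfolding S_def
    proof (rule cSUP_least)
      show "norm (g y) / W (x - y) \<le> C * (SUP y. norm (g y) / W (x - y)) powr (1 - p) * I" for y
        using key[of y] W0[of "x - y"] by (simp add: pos_divide_le_eq S_def)
    qed simp
    also have "\<dots> = S powr (1 - p) * (C * I)" by simp
    finally have "S powr (1 - p) * S powr p \<le> S powr (1 - p) * (C * I)"
      using Sp by (simp flip: powr_add)
    then have "S powr p \<le> C * I" using Sp by simp
    then show ?thesis using powr_mono2[OF _ _ gS, of p] p by simp
  qed
  then show ?thesis by (simp add: I_def W_def)
qed

text \<open>
  The growth order \<open>N\<close> depends on the distribution, so a constant depending on \<open>N\<close> would be useless.
  It only serves to show that \<open>g\<close> is bounded, after which every \<open>M\<close> is admissible.
\<close>

lemma peetre: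
  fixes g K :: "'a::euclidean_space \<Rightarrow> complex"
  assumes g: "continuous_on UNIV g" "\<And>y. norm (g y) \<le> A * (1 + norm y) ^ N" and K: "continuous_on UNIV K"
    and rep: "\<And>y. g y = (LINT z|lborel. K z * g (y - z))"
    and p: "0 < p" "p \<le> 1" and R: "R \<ge> 1"
    and dec: "\<And>M z. norm (K z) * (1 + R * norm z) ^ M \<le> C M"
    and int: "integrable lborel (\<lambda>z. norm (g z) powr p)"
  shows "norm (g x) powr p \<le> C M * (LINT z|lborel. norm (g z) powr p * ((1 + R * norm (x - z)) ^ M) powr (- p))"
    and "bounded (range g)"
proof -
  have R0: "R > 0" using R by linarith
  have A0: "A \<ge> 0" using order_trans[OF norm_ge_zero g(2)[of 0]] by simp
  let ?W = "\<lambda>M z::'a. (1 + R * norm z) ^ M"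
  have W1: "?W M z \<ge> 1" for M z using R0 by (intro one_le_power) auto
  have [measurable]: "g \<in> borel_measurable borel" using g(1) by (rule borel_measurable_continuous_onI)
  \<comment> \<open>With the weight of order \<open>N\<close> the growth bound makes the supremum
    finite.\<close>
  have st1: "norm (g x) powr p \<le> C N * (LINT z|lborel. norm (g z) powr p)" for x
  proof -
    have "norm (g y) / ?W N (x - y) \<le> A * (1 + norm x) ^ N" for y
    proof -
      have "(1 + norm y) ^ N \<le> (1 + norm x) ^ N * (1 + norm (x - y)) ^ N" by (rule weight_shift)
      also have "\<dots> \<le> (1 + norm x) ^ N * ?W N (x - y)"
        using mult_right_mono[OF R norm_ge_zero[of "x - y"]] by (intro mult_left_mono power_mono) auto
      finally have "A * (1 + norm y) ^ N \<le> A * ((1 + norm x) ^ N * ?W N (x - y))" using A0 by (rule mult_left_mono)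
      then have "norm (g y) \<le> A * (1 + norm x) ^ N * ?W N (x - y)" using g(2)[of y] by (simp add: mult.assoc)
      then show ?thesis using W1[of "x - y" N] by (subst pos_divide_le_eq) auto
    qed
    then have bdd: "bdd_above (range (\<lambda>y. norm (g y) / ?W N (x - y)))" by (auto intro!: bdd_aboveI)
    have "norm (g x) powr p \<le> C N * (LINT z|lborel. norm (g z) powr p * ?W N (x - z) powr (- p))"
      by (rule peetre_aux[OF g(1) K rep p R0 dec bdd int])
    also have "\<dots> \<le> C N * (LINT z|lborel. norm (g z) powr p)"
    proof (rule mult_left_mono)
      have le: "norm (g z) powr p * ?W N (x - z) powr (- p) \<le> norm (g z) powr p" for z
        using W1[of "x - z" N] p ge_one_powr_ge_zero[of "?W N (x - z)" p]
        by (intro mult_left_le) (auto simp: powr_minus inverse_le_1_iff)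
      then show "(LINT z|lborel. norm (g z) powr p * ?W N (x - z) powr (- p)) \<le> (LINT z|lborel. norm (g z) powr p)"
        by (intro integral_mono int Bochner_Integration.integrable_bound[OF int]) (auto simp: abs_mult)
      show "0 \<le> C N" using order_trans[OF _ dec[of 0]] by simp
    qed
    finally show ?thesis .
  qed
  have bd: "norm (g y) \<le> (C N * (LINT z|lborel. norm (g z) powr p)) powr (1 / p)" for y
  proof -
    have "(norm (g y) powr p) powr (1 / p) \<le> (C N * (LINT z|lborel. norm (g z) powr p)) powr (1 / p)"
      using st1[of y] p by (intro powr_mono2) auto
    then show ?thesis using p by (simp add: powr_powr)
  qed
  then show "bounded (range g)" unfolding bounded_iff by auto
  let ?B = "(C N * (LINT z|lborel. norm (g z) powr p)) powr (1 / p)"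
  have "norm (g y) / ?W M (x - y) \<le> ?B" for y
  proof -
    have "norm (g y) / ?W M (x - y) \<le> norm (g y) / 1" using W1[of "x - y" M] by (intro divide_left_mono) auto
    then show ?thesis using bd[of y] by simp
  qed
  then have bdd: "bdd_above (range (\<lambda>y. norm (g y) / ?W M (x - y)))" by (auto intro!: bdd_aboveI)
  show "norm (g x) powr p \<le> C M * (LINT z|lborel. norm (g z) powr p * ((1 + R * norm (x - z)) ^ M) powr (- p))"
    by (rule peetre_aux[OF g(1) K rep p R0 dec bdd int])
qed

text \<open>Decay of order \<open>M * p\<close> at distances beyond 1 / R. The form, a real power of
  a natural power, is that of the weights in \<open>peetre\<close>.\<close>

definition decay_weight :: "real \<Rightarrow> nat \<Rightarrow> real \<Rightarrow> 'a::euclidean_space \<Rightarrow> real" where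
  "decay_weight R M p z = ((1 + R * norm z) ^ M) powr (- p)"

lemma decay_weight_nonneg [simp]: "decay_weight R M p z \<ge> 0"
  by (simp add: decay_weight_def)

lemma decay_weight_le_1: "R \<ge> 0 \<Longrightarrow> p \<ge> 0 \<Longrightarrow> decay_weight R M p z \<le> 1"
proof -
  assume "R \<ge> 0" "p \<ge> 0"
  then have "(1 + R * norm z) ^ M \<ge> 1" by (intro one_le_power) auto
  then have "((1 + R * norm z) ^ M) powr p \<ge> 1" using \<open>p \<ge> 0\<close> by (rule ge_one_powr_ge_zero)
  then show "decay_weight R M p z \<le> 1" by (simp add: decay_weight_def powr_minus inverse_le_1_iff)
qed

lemma decay_weight_minus: "decay_weight R M p (x - y) = decay_weight R M p (y - x)"
  by (simp add: decay_weight_def norm_minus_commute)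

lemma decay_weight_mono: 
  assumes "R \<ge> 0" "p \<ge> 0" "norm z \<le> norm z'"
  shows "decay_weight R M p z' \<le> decay_weight R M p z"
proof -
  have "(1 + R * norm z) ^ M \<le> (1 + R * norm z') ^ M"
    using assms by (intro power_mono add_left_mono mult_left_mono) auto
  moreover have "(1 + R * norm z) ^ M > 0" using assms by (intro zero_less_power) (auto intro: add_pos_nonneg)
  ultimately show ?thesis unfolding decay_weight_def using assms(2) by (intro powr_mono2') auto
qed

lemma continuous_decay_weight [continuous_intros]:
  assumes "R \<ge> 0" "continuous_on S f" shows "continuous_on S (\<lambda>x. decay_weight R M p (f x))"
proof -
  have "(1 + R * norm (f x)) ^ M \<noteq> 0" for x
    using assms(1) by (smt (verit) norm_ge_zero mult_nonneg_nonneg power_not_zero)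
  then show ?thesis unfolding decay_weight_def using assms by (intro continuous_intros) auto
qed

lemma decay_weight_measurable: "R \<ge> 0 \<Longrightarrow> (\<lambda>z. decay_weight R M p (x - z)) \<in> borel_measurable borel"
  by (intro borel_measurable_continuous_onI continuous_intros)

text \<open>Once the decay is of order twice the dimension, the weight lies below a fixed integrable
  function dilated by \<open>R\<close>; so \<open>J\<close> depends neither on \<open>M\<close> and
  \<open>p\<close> nor on the centre.\<close>

lemma nn_integral_decay_weight:
  obtains J where "J > 0" "\<And>R p M (x::'a::euclidean_space). R > 0 \<Longrightarrow> p > 0 \<Longrightarrow> real M * p \<ge> 2 * real DIM('a) \<Longrightarrow>
     (\<integral>\<^sup>+z. ennreal (decay_weight R M p (x - z)) \<partial>lborel) \<le> ennreal (J / R ^ DIM('a))"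
proof -
  let ?d = "2 * DIM('a)"
  let ?f = "\<lambda>z::'a. inverse ((1 + norm z) ^ ?d)"
  define J where "J = (LINT z|lborel. ?f z)"
  have J: "(\<integral>\<^sup>+z. ennreal (?f z) \<partial>lborel) = ennreal J"
    unfolding J_def by (rule nn_integral_eq_integral[OF integrable_inverse_one_plus_norm]) simp
  have "(\<integral>\<^sup>+z. ennreal (decay_weight R M p (x - z)) \<partial>lborel) \<le> ennreal ((J + 1) / R ^ DIM('a))"
    if R: "R > 0" and p: "p > 0" and M: "real M * p \<ge> 2 * real DIM('a)" for R p M and x :: 'a
  proof -
    have le: "decay_weight R M p z \<le> ?f (R *\<^sub>R z)" for z :: 'a
    proof -
      have g1: "1 + R * norm z \<ge> 1" using R by simp
      then have "decay_weight R M p z = (1 + R * norm z) powr (- (real M * p))"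
        by (simp add: decay_weight_def powr_powr flip: powr_realpow)
      also have "\<dots> \<le> (1 + R * norm z) powr (- real ?d)"
        using M g1 by (intro powr_mono) auto
      also have "\<dots> = inverse ((1 + R * norm z) powr real ?d)" by (rule powr_minus)
      also have "(1 + R * norm z) powr real ?d = (1 + R * norm z) ^ ?d"
        using g1 by (intro powr_realpow) auto
      finally show ?thesis using R by simp
    qed
    have [measurable]: "?f \<in> borel_measurable borel" by measurable
    have "(\<integral>\<^sup>+z. ennreal (decay_weight R M p (x - z)) \<partial>lborel) \<le> (\<integral>\<^sup>+z. ennreal (?f (R *\<^sub>R (x - z))) \<partial>lborel)"
      using le by (intro nn_integral_mono ennreal_leI) auto
    also have "\<dots> = (\<integral>\<^sup>+z. ennreal (?f (R *\<^sub>R x + (- R) *\<^sub>R z)) \<partial>lborel)"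
      by (simp add: scaleR_diff_right)
    finally have 1: "(\<integral>\<^sup>+z. ennreal (decay_weight R M p (x - z)) \<partial>lborel) \<le> (\<integral>\<^sup>+z. ennreal (?f (R *\<^sub>R x + (- R) *\<^sub>R z)) \<partial>lborel)" .
    have 2: "ennreal J = ennreal (\<bar>- R\<bar> ^ DIM('a)) * (\<integral>\<^sup>+z. ennreal (?f (R *\<^sub>R x + (- R) *\<^sub>R z)) \<partial>lborel)"
      unfolding J[symmetric] by (rule lborel_nn_integral_affine) (use R in auto)
    have "(\<integral>\<^sup>+z. ennreal (?f (R *\<^sub>R x + (- R) *\<^sub>R z)) \<partial>lborel) = ennreal (J / R ^ DIM('a))"
    proof -
      have "ennreal (inverse (R ^ DIM('a))) * ennreal J = (ennreal (inverse (R ^ DIM('a))) * ennreal (R ^ DIM('a))) * (\<integral>\<^sup>+z. ennreal (?f (R *\<^sub>R x + (- R) *\<^sub>R z)) \<partial>lborel)"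
        using 2 R by (simp add: mult.assoc)
      also have "ennreal (inverse (R ^ DIM('a))) * ennreal (R ^ DIM('a)) = 1"
        using R by (simp flip: ennreal_mult)
      finally show ?thesis
        using R by (simp add: J_def divide_inverse mult.commute flip: ennreal_mult')
    qed
    also have "\<dots> \<le> ennreal ((J + 1) / R ^ DIM('a))" using R by (intro ennreal_leI divide_right_mono) auto
    finally show ?thesis using 1 by (rule order_trans[rotated])
  qed
  moreover have "J + 1 > 0" unfolding J_def by (intro add_nonneg_pos Bochner_Integration.integral_nonneg) auto
  ultimately show ?thesis by (rule that[rotated])
qed

text \<open>The \<open>p\<close>-th power of the quasi-norm. For exponents at most 1 it is
  subadditive, so estimates are made for it, and roots are taken only in the Besov norms.\<close>

definition Lp_power :: "real \<Rightarrow> ('a::euclidean_space \<Rightarrow> complex) \<Rightarrow> ennreal" where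
  "Lp_power p g = (\<integral>\<^sup>+x. ennreal (norm (g x) powr p) \<partial>lborel)"

text \<open>Localisation in frequency is expressed by a reproducing formula and polynomial growth,
  both of which the traces of blocks share. The index is \<open>Suc j\<close> because the
  \<open>j\<close>-th block reaches up to 13/10 * 2 ^ j, where \<open>LP_Psi \<Psi> j\<close> need
  not be 1 but \<open>LP_Psi \<Psi> (Suc j)\<close> is.\<close>

definition bandlimited :: "(real \<Rightarrow> real) \<Rightarrow> nat \<Rightarrow> ('a::euclidean_space \<Rightarrow> complex) \<Rightarrow> bool" where
  "bandlimited \<Psi> j g \<longleftrightarrow> continuous_on UNIV g \<and> (\<exists>A N. \<forall>y. norm (g y) \<le> A * (1 + norm y) ^ N) \<and>
     (\<forall>y. g y = (LINT z|lborel. kernel (LP_Psi \<Psi> (Suc j)) z * g (y - z)))"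

lemma LP_Psi_Suc_eq_1:
  assumes "LP_cutoff \<Psi>" "LP_Phi \<Psi> j \<xi> \<noteq> 0" "norm \<eta> \<le> norm \<xi>"
  shows "LP_Psi \<Psi> (Suc j) \<eta> = 1"
proof (rule LP_Psi_eq_1[OF assms(1)])
  have "norm \<eta> \<le> 13/10 * 2 ^ j" using LP_Phi_support(1)[OF assms(1,2)] assms(3) by linarith
  also have "\<dots> < 11/10 * 2 ^ Suc j" by simp
  finally show "norm \<eta> < 11/10 * 2 ^ Suc j" .
qed

lemma bandlimited_block:
  fixes u :: "'a::euclidean_space functional"
  assumes \<Psi>: "LP_cutoff \<Psi>" and u: "tempered_distribution u"
  shows "bandlimited \<Psi> j (LP_block \<Psi> j u)"
  unfolding bandlimited_def
proof (intro conjI allI)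
  show "continuous_on UNIV (LP_block \<Psi> j u)" "\<exists>A N. \<forall>y. norm (LP_block \<Psi> j u y) \<le> A * (1 + norm y) ^ N"
    by (rule LP_block_eq[OF \<Psi> u])+
  show "LP_block \<Psi> j u y = (LINT z|lborel. kernel (LP_Psi \<Psi> (Suc j)) z * LP_block \<Psi> j u (y - z))" for y
    using LP_block_conv[OF \<Psi> u cutoff_Psi[OF \<Psi>, of "Suc j"] bounded_linear_ident bounded_linear_ident, of j 1 y]
      LP_Psi_Suc_eq_1[OF \<Psi>] by fastforce
qed

text \<open>Convolution in the hyperplane variables alone has the symbol
  \<open>m (fst \<xi>)\<close> in the full space: the embedding of the hyperplane and
  \<open>fst\<close> are adjoint.\<close>

lemma trace_conv:
  fixes u :: "('a::euclidean_space \<times> real) functional" and m :: "'a \<Rightarrow> real"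
  assumes \<Psi>: "LP_cutoff \<Psi>" and u: "tempered_distribution u" and m: "cutoff m"
    and c: "\<And>\<xi> :: 'a \<times> real. m (fst \<xi>) * LP_Phi \<Psi> j \<xi> = c * LP_Phi \<Psi> j \<xi>"
  shows "(LINT z|lborel. kernel m z * LP_block \<Psi> j u (x - z, 0)) = of_real c * LP_block \<Psi> j u (x, 0)"
proof -
  have "(LINT z|lborel. kernel m z * LP_block \<Psi> j u ((x, 0) - (z, 0))) = of_real c * LP_block \<Psi> j u (x, 0)"
  proof (rule LP_block_conv[OF \<Psi> u m bounded_linear_Pair[OF bounded_linear_ident bounded_linear_zero] bounded_linear_fst])
    show "m (fst \<xi>) * LP_Phi \<Psi> j \<xi> = c * LP_Phi \<Psi> j \<xi>" for \<xi> :: "'a \<times> real" by (rule c)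
  qed (auto simp: inner_prod_def norm_Pair)
  then show ?thesis by simp
qed

lemma norm_fst_le': "norm (fst \<xi>) \<le> norm \<xi>"
  by (metis norm_fst_le prod.collapse)

text \<open>The projection of a frequency is no longer than the frequency itself, so the trace stays
  in the same ball, although not in an annulus.\<close>

lemma bandlimited_trace:
  fixes u :: "('a::euclidean_space \<times> real) functional"
  assumes \<Psi>: "LP_cutoff \<Psi>" and u: "tempered_distribution u"
  shows "bandlimited \<Psi> j (\<lambda>x. LP_block \<Psi> j u (x, 0))"
  unfolding bandlimited_def
proof (intro conjI allI)
  show "continuous_on UNIV (\<lambda>x. LP_block \<Psi> j u (x, 0))"
    by (rule continuous_on_compose2[OF LP_block_eq(2)[OF \<Psi> u]]) (auto intro!: continuous_intros)
  obtain A N where AN: "\<And>y. norm (LP_block \<Psi> j u y) \<le> A * (1 + norm y) ^ N"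
    using LP_block_eq(3)[OF \<Psi> u] by metis
  have "norm (LP_block \<Psi> j u (x, 0)) \<le> A * (1 + norm x) ^ N" for x
    using AN[of "(x, 0)"] by (simp add: norm_Pair)
  then show "\<exists>A N. \<forall>x. norm (LP_block \<Psi> j u (x, 0)) \<le> A * (1 + norm x) ^ N" by blast
  have "LP_Psi \<Psi> (Suc j) (fst \<xi>) * LP_Phi \<Psi> j \<xi> = 1 * LP_Phi \<Psi> j \<xi>" for \<xi> :: "'a \<times> real"
    using LP_Psi_Suc_eq_1[OF \<Psi> _ norm_fst_le', of j \<xi>] by (cases "LP_Phi \<Psi> j \<xi> = 0") auto
  from trace_conv[OF \<Psi> u cutoff_Psi[OF \<Psi>] this]
  show "LP_block \<Psi> j u (x, 0) = (LINT z|lborel. kernel (LP_Psi \<Psi> (Suc j)) z * LP_block \<Psi> j u (x - z, 0))" for x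
    by simp
qed

lemma Lp_power_integrable:
  assumes "continuous_on UNIV g" "Lp_power p g < \<infinity>"
  shows "integrable lborel (\<lambda>x. norm (g x) powr p)"
proof -
  have [measurable]: "g \<in> borel_measurable borel" using assms(1) by (rule borel_measurable_continuous_onI)
  show ?thesis using assms(2) by (intro integrableI_nonneg) (auto simp: Lp_power_def)
qed

text \<open>Here the growth data of the individual function have disappeared: the constant depends
  on the order \<open>M\<close> of the weight only.\<close>

lemma bl_peetre:
  assumes \<Psi>: "LP_cutoff \<Psi>"
  obtains C where "\<And>M. C M > 0" "\<And>j p (g :: 'a::euclidean_space \<Rightarrow> complex) M x. bandlimited \<Psi> j g \<Longrightarrow> 0 < p \<Longrightarrow> p \<le> 1 \<Longrightarrow> Lp_power p g < \<infinity> \<Longrightarrow>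
     ennreal (norm (g x) powr p) \<le> ennreal (C M * (2 ^ j) ^ DIM('a)) *
       (\<integral>\<^sup>+z. ennreal (norm (g z) powr p * decay_weight (2 ^ j) M p (x - z)) \<partial>lborel)"
proof -
  have "\<exists>C>0. \<forall>j. \<forall>z::'a. norm (kernel (LP_Psi \<Psi> j) z) * (1 + 2 ^ j * norm z) ^ M \<le> C * (2 ^ j) ^ DIM('a)" for M
    using kernel_Psi_decay[OF \<Psi>, where 'a='a] by blast
  then obtain C where C: "\<And>M. C M > 0"
    "\<And>M j (z::'a). norm (kernel (LP_Psi \<Psi> j) z) * (1 + 2 ^ j * norm z) ^ M \<le> C M * (2 ^ j) ^ DIM('a)"
    by metis
  \<comment> \<open>The kernel has index \<open>Suc j\<close>, which costs
    \<open>2 ^ DIM('a)\<close> when its size is expressed by \<open>2 ^ j\<close>; the weight of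
    scale \<open>2 ^ j\<close> is the smaller one.\<close>
  define D where "D = (\<lambda>M. C M * 2 ^ DIM('a))"
  have dec: "norm (kernel (LP_Psi \<Psi> (Suc j)) z) * (1 + 2 ^ j * norm z) ^ M \<le> D M * (2 ^ j) ^ DIM('a)" for M j and z :: 'a
  proof -
    have "(1 + 2 ^ j * norm z) ^ M \<le> (1 + 2 ^ Suc j * norm z) ^ M"
      by (intro power_mono add_left_mono mult_right_mono) auto
    then have "norm (kernel (LP_Psi \<Psi> (Suc j)) z) * (1 + 2 ^ j * norm z) ^ M \<le> norm (kernel (LP_Psi \<Psi> (Suc j)) z) * (1 + 2 ^ Suc j * norm z) ^ M"
      by (rule mult_left_mono) simp
    also have "\<dots> \<le> C M * (2 ^ Suc j) ^ DIM('a)" by (rule C(2))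
    finally show ?thesis by (simp add: D_def power_mult_distrib mult_ac)
  qed
  have "ennreal (norm (g x) powr p) \<le> ennreal (D M * (2 ^ j) ^ DIM('a)) *
       (\<integral>\<^sup>+z. ennreal (norm (g z) powr p * decay_weight (2 ^ j) M p (x - z)) \<partial>lborel)"
    if g: "bandlimited \<Psi> j g" and p: "0 < p" "p \<le> 1" and fin: "Lp_power p g < \<infinity>" for j p and g :: "'a \<Rightarrow> complex" and M x
  proof -
    obtain A N where AN: "\<And>y. norm (g y) \<le> A * (1 + norm y) ^ N"
      and cg: "continuous_on UNIV g" and rep: "\<And>y. g y = (LINT z|lborel. kernel (LP_Psi \<Psi> (Suc j)) z * g (y - z))"
      using g unfolding bandlimited_def by blast
    have [measurable]: "g \<in> borel_measurable borel" using cg by (rule borel_measurable_continuous_onI)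
    note int = Lp_power_integrable[OF cg fin]
    have R: "(2::real) ^ j \<ge> 1" by simp
    have b: "norm (g x) powr p \<le> (D M * (2 ^ j) ^ DIM('a)) * (LINT z|lborel. norm (g z) powr p * decay_weight (2 ^ j) M p (x - z))"
      unfolding decay_weight_def
      by (rule peetre(1)[OF cg AN rapid_continuous[OF rapid_kernel[OF cutoff_Psi[OF \<Psi>]]] rep p R dec int])
    have mw [measurable]: "(\<lambda>z. decay_weight (2 ^ j) M p (x - z)) \<in> borel_measurable borel" by (rule decay_weight_measurable) simp
    have "integrable lborel (\<lambda>z. norm (g z) powr p * decay_weight (2 ^ j) M p (x - z))"
      using mult_left_le[OF decay_weight_le_1[of "2 ^ j" p M] powr_ge_zero] p
      by (intro Bochner_Integration.integrable_bound[OF int]) (auto simp: abs_mult intro!: AE_I2)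
    then have "(\<integral>\<^sup>+z. ennreal (norm (g z) powr p * decay_weight (2 ^ j) M p (x - z)) \<partial>lborel) =
        ennreal (LINT z|lborel. norm (g z) powr p * decay_weight (2 ^ j) M p (x - z))"
      by (rule nn_integral_eq_integral) simp
    then show ?thesis
      using ennreal_leI[OF b] C(1)[of M] by (subst (asm) ennreal_mult') (simp_all add: D_def)
  qed
  moreover have "D M > 0" for M using C(1) by (simp add: D_def)
  ultimately show ?thesis by (rule that[rotated])
qed

text \<open>With \<open>M = 0\<close> the weight is 1; this is Nikolskii's inequality from
  \<open>p\<close> to \<infinity>.\<close>

lemma bl_sup:
  assumes \<Psi>: "LP_cutoff \<Psi>"
  obtains C where "C > 0" "\<And>j p (g :: 'a::euclidean_space \<Rightarrow> complex) x. bandlimited \<Psi> j g \<Longrightarrow> 0 < p \<Longrightarrow> p \<le> 1 \<Longrightarrow> Lp_power p g < \<infinity> \<Longrightarrow>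
     ennreal (norm (g x) powr p) \<le> ennreal (C * (2 ^ j) ^ DIM('a)) * Lp_power p g"
proof -
  obtain C where C: "\<And>M. C M > 0" "\<And>j p (g :: 'a \<Rightarrow> complex) M x. bandlimited \<Psi> j g \<Longrightarrow> 0 < p \<Longrightarrow> p \<le> 1 \<Longrightarrow> Lp_power p g < \<infinity> \<Longrightarrow>
     ennreal (norm (g x) powr p) \<le> ennreal (C M * (2 ^ j) ^ DIM('a)) *
       (\<integral>\<^sup>+z. ennreal (norm (g z) powr p * decay_weight (2 ^ j) M p (x - z)) \<partial>lborel)"
    using bl_peetre[OF \<Psi>, where 'a='a] by blast
  have "ennreal (norm (g x) powr p) \<le> ennreal (C 0 * (2 ^ j) ^ DIM('a)) * Lp_power p g"
    if "bandlimited \<Psi> j g" "0 < p" "p \<le> 1" "Lp_power p g < \<infinity>" for j p and g :: "'a \<Rightarrow> complex" and x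
    using C(2)[OF that, of x 0] by (simp add: decay_weight_def Lp_power_def)
  then show ?thesis by (rule that[OF C(1)[of 0]])
qed

lemma exists_large_M: "0 < (p::real) \<Longrightarrow> \<exists>M. real M * p \<ge> c"
  by (metis less_imp_le reals_Archimedean3)

text \<open>The pointwise bound at (x, 0) is integrated over the hyperplane. Dropping the last
  coordinate enlarges the weight and leaves one whose integral in \<open>x\<close> gains 2 ^ j to
  the power n - 1; against the loss of 2 ^ j to the power n a single factor 2 ^ j remains.\<close>

lemma trace_Lp_power:
  assumes \<Psi>: "LP_cutoff \<Psi>" and p: "0 < p" "p \<le> 1"
  obtains C where "C > 0" "\<And>j (g :: 'a::euclidean_space \<times> real \<Rightarrow> complex). bandlimited \<Psi> j g \<Longrightarrow> Lp_power p g < \<infinity> \<Longrightarrow>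
     Lp_power p (\<lambda>x. g (x, 0)) \<le> ennreal (C * 2 ^ j) * Lp_power p g"
proof -
  obtain C where C: "\<And>M. C M > 0" "\<And>j p (g :: 'a \<times> real \<Rightarrow> complex) M x. bandlimited \<Psi> j g \<Longrightarrow> 0 < p \<Longrightarrow> p \<le> 1 \<Longrightarrow> Lp_power p g < \<infinity> \<Longrightarrow>
     ennreal (norm (g x) powr p) \<le> ennreal (C M * (2 ^ j) ^ DIM('a \<times> real)) *
       (\<integral>\<^sup>+z. ennreal (norm (g z) powr p * decay_weight (2 ^ j) M p (x - z)) \<partial>lborel)"
    using bl_peetre[OF \<Psi>, where 'a="'a \<times> real"] by blast
  obtain J where J: "J > 0" "\<And>R p M (x::'a). R > 0 \<Longrightarrow> p > 0 \<Longrightarrow> real M * p \<ge> 2 * real DIM('a) \<Longrightarrow>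
     (\<integral>\<^sup>+z. ennreal (decay_weight R M p (x - z)) \<partial>lborel) \<le> ennreal (J / R ^ DIM('a))"
    using nn_integral_decay_weight[where 'a='a] by blast
  obtain M where M: "real M * p \<ge> 2 * real DIM('a)" using exists_large_M[OF p(1)] by blast
  have "Lp_power p (\<lambda>x. g (x, 0)) \<le> ennreal ((C M * J) * 2 ^ j) * Lp_power p g"
    if g: "bandlimited \<Psi> j g" and fin: "Lp_power p g < \<infinity>" for j and g :: "'a \<times> real \<Rightarrow> complex"
  proof -
    have [measurable]: "g \<in> borel_measurable borel"
      using g by (auto simp: bandlimited_def intro: borel_measurable_continuous_onI)
    let ?w = "\<lambda>(x::'a) z. decay_weight (2 ^ j) M p (x - fst z)"
    have mw: "(\<lambda>(x, z). ennreal (norm (g z) powr p * ?w x z)) \<in> borel_measurable (lborel \<Otimes>\<^sub>M lborel)"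
    proof -
      have "(\<lambda>v::'a \<times> 'a \<times> real. decay_weight (2 ^ j) M p (fst v - fst (snd v))) \<in> borel_measurable borel"
        by (intro borel_measurable_continuous_onI continuous_intros) auto
      then have [measurable]: "(\<lambda>v::'a \<times> 'a \<times> real. decay_weight (2 ^ j) M p (fst v - fst (snd v))) \<in> borel_measurable (lborel \<Otimes>\<^sub>M lborel)"
        by (simp add: lborel_prod)
      show ?thesis unfolding split_beta' by measurable
    qed
    have "Lp_power p (\<lambda>x. g (x, 0)) \<le> (\<integral>\<^sup>+x. ennreal (C M * (2 ^ j) ^ DIM('a \<times> real)) *
        (\<integral>\<^sup>+z. ennreal (norm (g z) powr p * ?w x z) \<partial>lborel) \<partial>lborel)"
      unfolding Lp_power_def
    proof (intro nn_integral_mono)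
      fix x :: 'a
      have "ennreal (norm (g (x, 0)) powr p) \<le> ennreal (C M * (2 ^ j) ^ DIM('a \<times> real)) *
         (\<integral>\<^sup>+z. ennreal (norm (g z) powr p * decay_weight (2 ^ j) M p ((x, 0) - z)) \<partial>lborel)"
        by (rule C(2)[OF g p fin])
      also have "\<dots> \<le> ennreal (C M * (2 ^ j) ^ DIM('a \<times> real)) *
        (\<integral>\<^sup>+z. ennreal (norm (g z) powr p * ?w x z) \<partial>lborel)"
      proof (intro mult_left_mono nn_integral_mono ennreal_leI)
        fix z :: "'a \<times> real"
        have "norm (x - fst z) \<le> norm ((x, 0) - z)" using norm_fst_le'[of "(x, 0) - z"] by simp
        then show "decay_weight (2 ^ j) M p ((x, 0) - z) \<le> ?w x z" using p by (intro decay_weight_mono) auto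
      qed auto
      finally show "ennreal (norm (g (x, 0)) powr p) \<le> ennreal (C M * (2 ^ j) ^ DIM('a \<times> real)) *
        (\<integral>\<^sup>+z. ennreal (norm (g z) powr p * ?w x z) \<partial>lborel)" .
    qed
    also have "\<dots> = ennreal (C M * (2 ^ j) ^ DIM('a \<times> real)) *
        (\<integral>\<^sup>+x. (\<integral>\<^sup>+z. ennreal (norm (g z) powr p * ?w x z) \<partial>lborel) \<partial>lborel)"
      using lborel.borel_measurable_nn_integral[OF mw] by (intro nn_integral_cmult) simp
    also have "(\<integral>\<^sup>+x. (\<integral>\<^sup>+z. ennreal (norm (g z) powr p * ?w x z) \<partial>lborel) \<partial>lborel)
        = (\<integral>\<^sup>+z. (\<integral>\<^sup>+x. ennreal (norm (g z) powr p * ?w x z) \<partial>lborel) \<partial>lborel)"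
      using lborel_pair.Fubini'[OF mw] by simp
    also have "\<dots> \<le> (\<integral>\<^sup>+z. ennreal (norm (g z) powr p) * ennreal (J / (2 ^ j) ^ DIM('a)) \<partial>lborel)"
    proof (intro nn_integral_mono)
      fix z :: "'a \<times> real"
      have "(\<integral>\<^sup>+x. ennreal (norm (g z) powr p * ?w x z) \<partial>lborel) = ennreal (norm (g z) powr p) * (\<integral>\<^sup>+x. ennreal (decay_weight (2 ^ j) M p (fst z - x)) \<partial>lborel)"
        using decay_weight_measurable[of "2 ^ j" M p "fst z"]
        by (simp add: ennreal_mult' decay_weight_minus[of _ _ _ _ "fst z"] nn_integral_cmult)
      also have "\<dots> \<le> ennreal (norm (g z) powr p) * ennreal (J / (2 ^ j) ^ DIM('a))"
        using J(2)[OF _ p(1) M, of "2 ^ j" "fst z"] by (intro mult_left_mono) auto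
      finally show "(\<integral>\<^sup>+x. ennreal (norm (g z) powr p * ?w x z) \<partial>lborel) \<le> ennreal (norm (g z) powr p) * ennreal (J / (2 ^ j) ^ DIM('a))" .
    qed
    also have "\<dots> = Lp_power p g * ennreal (J / (2 ^ j) ^ DIM('a))"
      unfolding Lp_power_def by (rule nn_integral_multc) measurable
    finally have "Lp_power p (\<lambda>x. g (x, 0)) \<le> ennreal (C M * (2 ^ j) ^ DIM('a \<times> real)) * (Lp_power p g * ennreal (J / (2 ^ j) ^ DIM('a)))"
      by (simp add: mult_left_mono)
    also have "\<dots> = ennreal (C M * (2 ^ j) ^ DIM('a \<times> real) * (J / (2 ^ j) ^ DIM('a))) * Lp_power p g"
      using C(1)[of M] J(1) by (subst ennreal_mult) (auto simp: mult_ac)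
    also have "C M * (2 ^ j) ^ DIM('a \<times> real) * (J / (2 ^ j) ^ DIM('a)) = (C M * J) * 2 ^ j"
      by simp
    finally show ?thesis .
  qed
  moreover have "C M * J > 0" using C(1)[of M] J(1) by simp
  ultimately show ?thesis by (rule that[rotated])
qed

text \<open>L_r is interpolated between L_p on the hyperplane (\<open>trace_Lp_power\<close>) and
  the supremum (\<open>bl_sup\<close>). The number \<open>b\<close> is the term of \<open>g\<close>
  in the Besov norm; for the smoothness n / p - n + 1 the powers of 2 ^ j combine to the exponent
  -(n - 1) (1 - r), whatever \<open>p\<close> is.\<close>

lemma trace_Nr:
  assumes \<Psi>: "LP_cutoff \<Psi>" and p: "0 < p" "p \<le> r" "r \<le> 1"
  defines "n \<equiv> real (DIM('a::euclidean_space \<times> real))"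
  obtains D where "D > 0" "\<And>j b (g :: 'a \<times> real \<Rightarrow> complex). bandlimited \<Psi> j g \<Longrightarrow> b \<ge> 0 \<Longrightarrow>
     Lp_power p g = ennreal ((2 powr (- (n / p - n + 1) * real j) * b) powr p) \<Longrightarrow>
     Lp_power r (\<lambda>x. g (x, 0)) \<le> ennreal (D * 2 powr (- real j * real DIM('a) * (1 - r)) * b powr r)"
proof -
  have p1: "p \<le> 1" using p by linarith
  obtain C1 where C1: "C1 > 0" "\<And>j p (g :: 'a \<times> real \<Rightarrow> complex) x. bandlimited \<Psi> j g \<Longrightarrow> 0 < p \<Longrightarrow> p \<le> 1 \<Longrightarrow> Lp_power p g < \<infinity> \<Longrightarrow>
     ennreal (norm (g x) powr p) \<le> ennreal (C1 * (2 ^ j) ^ DIM('a \<times> real)) * Lp_power p g"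
    using bl_sup[OF \<Psi>, where 'a="'a \<times> real"] by blast
  obtain C2 where C2: "C2 > 0" "\<And>j (g :: 'a \<times> real \<Rightarrow> complex). bandlimited \<Psi> j g \<Longrightarrow> Lp_power p g < \<infinity> \<Longrightarrow>
     Lp_power p (\<lambda>x. g (x, 0)) \<le> ennreal (C2 * 2 ^ j) * Lp_power p g"
    using trace_Lp_power[OF \<Psi> p(1) p1, where 'a='a] by blast
  define D where "D = C1 powr ((r - p) / p) * C2"
  have "Lp_power r (\<lambda>x. g (x, 0)) \<le> ennreal (D * 2 powr (- real j * real DIM('a) * (1 - r)) * b powr r)"
    if g: "bandlimited \<Psi> j g" and b: "b \<ge> 0" and
      e: "Lp_power p g = ennreal ((2 powr (- (n / p - n + 1) * real j) * b) powr p)" for j b and g :: "'a \<times> real \<Rightarrow> complex"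
  proof -
    have [measurable]: "g \<in> borel_measurable borel"
      using g by (auto simp: bandlimited_def intro: borel_measurable_continuous_onI)
    have fin: "Lp_power p g < \<infinity>" unfolding e by simp
    define a where "a = 2 powr (- (n / p - n + 1) * real j) * b"
    have a0: "a \<ge> 0" using b by (simp add: a_def)
    define s where "s = C1 * (2 ^ j) ^ DIM('a \<times> real) * a powr p"
    have s0: "s \<ge> 0" using C1(1) by (simp add: s_def)
    have g_le: "norm (g x) powr p \<le> s" for x
    proof -
      have "ennreal (norm (g x) powr p) \<le> ennreal s"
        using C1(2)[OF g p(1) p1 fin, of x] C1(1) unfolding e a_def[symmetric] s_def by (simp flip: ennreal_mult')
      then show ?thesis using s0 by (simp add: ennreal_le_iff)
    qed
    have gr: "norm (g x) powr r \<le> s powr ((r - p) / p) * norm (g x) powr p" for x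
    proof -
      have "norm (g x) powr r = norm (g x) powr (r - p) * norm (g x) powr p" by (simp flip: powr_add)
      also have "norm (g x) powr (r - p) = (norm (g x) powr p) powr ((r - p) / p)" using p by (simp add: powr_powr)
      also have "\<dots> \<le> s powr ((r - p) / p)" using g_le[of x] p by (intro powr_mono2) auto
      finally show ?thesis by (simp add: mult_right_mono)
    qed
    have "Lp_power r (\<lambda>x. g (x, 0)) \<le> (\<integral>\<^sup>+x. ennreal (s powr ((r - p) / p)) * ennreal (norm (g (x, 0)) powr p) \<partial>lborel)"
      unfolding Lp_power_def using gr by (intro nn_integral_mono) (simp add: ennreal_leI flip: ennreal_mult)
    also have "\<dots> = ennreal (s powr ((r - p) / p)) * Lp_power p (\<lambda>x. g (x, 0))"
      unfolding Lp_power_def by (rule nn_integral_cmult) measurable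
    also have "\<dots> \<le> ennreal (s powr ((r - p) / p)) * (ennreal (C2 * 2 ^ j) * ennreal (a powr p))"
      using C2(2)[OF g fin] unfolding e a_def[symmetric] by (intro mult_left_mono) auto
    also have "\<dots> = ennreal (s powr ((r - p) / p) * (C2 * 2 ^ j * a powr p))"
      using C2(1) by (simp add: ennreal_mult)
    also have "s powr ((r - p) / p) * (C2 * 2 ^ j * a powr p) = D * 2 powr (- real j * real DIM('a) * (1 - r)) * b powr r"
    \<comment> \<open>For positive \<open>b\<close> the identity is checked by taking logarithms,
      which turns it into an identity of exponents; for \<open>b = 0\<close> both sides
      vanish.\<close>
    proof (cases "b = 0")
      case True
      then show ?thesis using p by (simp add: a_def)
    next
      case False
      then have b0: "b > 0" using b by simp
      then have a1: "a > 0" by (simp add: a_def)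
      have j: "(2::real) ^ j = 2 powr real j" by (simp add: powr_realpow)
      have jn: "((2::real) ^ j) ^ DIM('a \<times> real) = 2 powr (real j * n)"
        unfolding n_def of_nat_mult[symmetric] by (subst powr_realpow) (simp_all only: power_mult zero_less_numeral)
      have la: "ln a = - (n / p - n + 1) * real j * ln 2 + ln b" using b0 by (simp add: a_def ln_mult ln_powr)
      have nn: "real DIM('a) = n - 1" by (simp add: n_def)
      have "ln (s powr ((r - p) / p) * (C2 * 2 ^ j * a powr p)) =
          ((r - p) / p) * (ln C1 + real j * n * ln 2 + p * ln a) + (ln C2 + real j * ln 2 + p * ln a)"
        using C1(1) C2(1) a1 unfolding s_def jn unfolding j by (simp add: ln_mult ln_powr)
      also have "\<dots> = ((r - p) / p) * ln C1 + ln C2 + (- real j * (n - 1) * (1 - r)) * ln 2 + r * ln b"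
        unfolding la using p by (simp add: field_simps)
      also have "\<dots> = ln (D * 2 powr (- real j * real DIM('a) * (1 - r)) * b powr r)"
        using C1(1) C2(1) b0 unfolding D_def nn by (simp add: ln_mult ln_powr)
      finally show ?thesis
        using C1(1) C2(1) a1 b0 by (subst (asm) ln_inj_iff) (auto simp: s_def D_def)
    qed
    finally show ?thesis .
  qed
  moreover have "D > 0" using C1(1) C2(1) by (simp add: D_def)
  ultimately show ?thesis by (rule that[rotated])
qed

section \<open>Boundedness of the trace\<close>

text \<open>The weight with \<open>S\<close> survives up to a constant. The factor 2 between
  \<open>S\<close> and \<open>R\<close> is allowed because blocks of index j + 1 still meet the
  frequencies of w_j.\<close>

lemma decay_weight_quasi_submult:
  assumes R: "R > 0" "0 < S" "S \<le> 2 * R" and p: "p \<ge> 0"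
  shows "decay_weight R M p (y - z) * decay_weight S M p (x - y) \<le> (2 ^ M) powr p * decay_weight S M p (x - z)"
proof -
  have "(1 + S * norm (x - z)) ^ M \<le> (1 + S * norm (x - y)) ^ M * (1 + S * norm (y - z)) ^ M"
    using weight_submult[of S "x - y" "y - z" M] R by simp
  also have "(1 + S * norm (y - z)) ^ M \<le> (2 * (1 + R * norm (y - z))) ^ M"
  proof (rule power_mono)
    have "S * norm (y - z) \<le> (2 * R) * norm (y - z)" using R by (intro mult_right_mono) auto
    then show "1 + S * norm (y - z) \<le> 2 * (1 + R * norm (y - z))" by simp
  qed (use R in auto)
  also have "\<dots> = 2 ^ M * (1 + R * norm (y - z)) ^ M" by (rule power_mult_distrib)
  finally have le: "(1 + S * norm (x - z)) ^ M \<le> (1 + S * norm (x - y)) ^ M * (2 ^ M * (1 + R * norm (y - z)) ^ M)"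
    using R by (simp add: mult_left_mono)
  have pos: "(1 + S * norm (x - y)) ^ M > 0" "(1 + R * norm (y - z)) ^ M > 0" "(1 + S * norm (x - z)) ^ M > 0"
    using R by (intro zero_less_power add_pos_nonneg; simp)+
  have le2: "((1 + S * norm (x - z)) ^ M) powr p \<le> ((1 + S * norm (x - y)) ^ M) powr p * ((2 ^ M) powr p * ((1 + R * norm (y - z)) ^ M) powr p)"
    using powr_mono2[OF p _ le] pos by (simp add: powr_mult)
  have gen: "inverse c * inverse d \<le> b * inverse a" if "a \<le> d * (b * c)" "a > 0" "c > 0" "d > 0" for a b c d :: real
    using that by (simp add: field_simps)
  show ?thesis
    unfolding decay_weight_def powr_minus
    by (rule gen[OF le2]) (unfold powr_gt_zero, use pos in \<open>simp_all only: less_imp_neq[THEN not_sym] not_False_eq_True\<close>)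
qed

text \<open>A substitute for Young's inequality. Peetre's inequality bounds the \<open>r\<close>-th
  power of the integrand, without the kernel's size, by an average \<open>B x\<close>; spending the
  power 1 - r of the integrand on this bound leaves its \<open>r\<close>-th power under the
  integral, and this can be integrated in \<open>x\<close> by Fubini. The price is a power of 2 ^ (j
  - k), since the averages are taken at the coarser scale of the kernel.\<close>

lemma conv_est:
  assumes \<Psi>: "LP_cutoff \<Psi>" and r: "0 < r" "r \<le> 1"
  obtains D where "D > 0" "\<And>j k (g :: 'a::euclidean_space \<Rightarrow> complex). bandlimited \<Psi> j g \<Longrightarrow> Lp_power r g < \<infinity> \<Longrightarrow> k \<le> j + 1 \<Longrightarrow>
     Lp_power r (\<lambda>x. LINT y|lborel. kernel (LP_Phi \<Psi> k) (x - y) * g y)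
      \<le> ennreal (D * 2 powr ((real j - real k) * real DIM('a) * (1 - r))) * Lp_power r g"
proof -
  obtain C1 where C1: "\<And>M. C1 M > 0" "\<And>j p (g :: 'a \<Rightarrow> complex) M x. bandlimited \<Psi> j g \<Longrightarrow> 0 < p \<Longrightarrow> p \<le> 1 \<Longrightarrow> Lp_power p g < \<infinity> \<Longrightarrow>
     ennreal (norm (g x) powr p) \<le> ennreal (C1 M * (2 ^ j) ^ DIM('a)) *
       (\<integral>\<^sup>+z. ennreal (norm (g z) powr p * decay_weight (2 ^ j) M p (x - z)) \<partial>lborel)"
    using bl_peetre[OF \<Psi>, where 'a='a] by blast
  obtain J where J: "J > 0" "\<And>R p M (x::'a). R > 0 \<Longrightarrow> p > 0 \<Longrightarrow> real M * p \<ge> 2 * real DIM('a) \<Longrightarrow>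
     (\<integral>\<^sup>+z. ennreal (decay_weight R M p (x - z)) \<partial>lborel) \<le> ennreal (J / R ^ DIM('a))"
    using nn_integral_decay_weight[where 'a='a] by blast
  obtain M where M: "real M * r \<ge> 2 * real DIM('a)" using exists_large_M[OF r(1)] by blast
  have "\<exists>C>0. \<forall>k. \<forall>z::'a. norm (kernel (LP_Phi \<Psi> k) z) * (1 + 2 ^ k * norm z) ^ M \<le> C * (2 ^ k) ^ DIM('a)"
    using kernel_Phi_decay[OF \<Psi>, where 'a='a] by blast
  then obtain C2 where C2: "C2 > 0" "\<And>k (z::'a). norm (kernel (LP_Phi \<Psi> k) z) * (1 + 2 ^ k * norm z) ^ M \<le> C2 * (2 ^ k) ^ DIM('a)"
    by auto
  define C3 where "C3 = C1 M * (2 ^ M) powr r"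
  have C3: "C3 > 0" using C1(1) by (simp add: C3_def)
  define D where "D = C2 powr r * C3 powr (1 - r) * J"
  have "Lp_power r (\<lambda>x. LINT y|lborel. kernel (LP_Phi \<Psi> k) (x - y) * g y)
      \<le> ennreal (D * 2 powr ((real j - real k) * real DIM('a) * (1 - r))) * Lp_power r g"
    if g: "bandlimited \<Psi> j g" and fin: "Lp_power r g < \<infinity>" and k: "k \<le> j + 1" for j k and g :: "'a \<Rightarrow> complex"
  proof -
    have cg: "continuous_on UNIV g" using g unfolding bandlimited_def by blast
    then have [measurable]: "g \<in> borel_measurable borel" by (rule borel_measurable_continuous_onI)
    have [measurable]: "(kernel (LP_Phi \<Psi> k) :: 'a \<Rightarrow> complex) \<in> borel_measurable borel"
      by (intro borel_measurable_continuous_onI rapid_continuous rapid_kernel cutoff_Phi \<Psi>)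
    note int = Lp_power_integrable[OF cg fin]
    let ?Rj = "2 ^ j :: real" and ?Rk = "2 ^ k :: real"
    let ?jm = "?Rj ^ DIM('a)" and ?km = "?Rk ^ DIM('a)"
    have Rk: "?Rk \<le> 2 * ?Rj" using power_increasing[OF k, of "2::real"] by simp
    \<comment> \<open>The average is taken at the scale of the kernel, not at that of
      \<open>g\<close>.\<close>
    define B where "B = (\<lambda>x. LINT z|lborel. norm (g z) powr r * decay_weight ?Rk M r (x - z))"
    have mw [measurable]: "(\<lambda>z. decay_weight R M r (x - z)) \<in> borel_measurable borel" if "R > 0" for R and x :: 'a
      using that by (intro decay_weight_measurable) simp
    have Bint: "integrable lborel (\<lambda>z. norm (g z) powr r * decay_weight ?Rk M r (x - z))" for x
      using mult_left_le[OF decay_weight_le_1[of ?Rk r M] powr_ge_zero] r mw[of ?Rk x]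
      by (intro Bochner_Integration.integrable_bound[OF int]) (auto simp: abs_mult intro!: AE_I2)
    have B0: "B x \<ge> 0" for x unfolding B_def by (rule Bochner_Integration.integral_nonneg) simp
    have Bnn: "(\<integral>\<^sup>+z. ennreal (norm (g z) powr r * decay_weight ?Rk M r (x - z)) \<partial>lborel) = ennreal (B x)" for x
      unfolding B_def by (rule nn_integral_eq_integral[OF Bint]) simp
    \<comment> \<open>Peetre's inequality at scale \<open>?Rj\<close>, followed by a change to the
      weight of scale \<open>?Rk\<close>; here \<open>k \<le> j + 1\<close> enters.\<close>
    have pw: "norm (g y) powr r * decay_weight ?Rk M r (x - y) \<le> C3 * ?jm * B x" for x y
    proof -
      have "ennreal (norm (g y) powr r * decay_weight ?Rk M r (x - y)) = ennreal (norm (g y) powr r) * ennreal (decay_weight ?Rk M r (x - y))"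
        by (simp add: ennreal_mult)
      also have "\<dots> \<le> (ennreal (C1 M * ?jm) * (\<integral>\<^sup>+z. ennreal (norm (g z) powr r * decay_weight ?Rj M r (y - z)) \<partial>lborel)) * ennreal (decay_weight ?Rk M r (x - y))"
        by (intro mult_right_mono C1(2)[OF g r fin]) simp
      also have "\<dots> = ennreal (C1 M * ?jm) * (\<integral>\<^sup>+z. ennreal (norm (g z) powr r * decay_weight ?Rj M r (y - z)) * ennreal (decay_weight ?Rk M r (x - y)) \<partial>lborel)"
        using mw[of ?Rj y] by (subst nn_integral_multc) (auto simp: mult.assoc)
      also have "\<dots> \<le> ennreal (C1 M * ?jm) * (\<integral>\<^sup>+z. ennreal ((2 ^ M) powr r) * ennreal (norm (g z) powr r * decay_weight ?Rk M r (x - z)) \<partial>lborel)"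
      proof (intro mult_left_mono nn_integral_mono)
        fix z
        have "norm (g z) powr r * decay_weight ?Rj M r (y - z) * decay_weight ?Rk M r (x - y) \<le> (2 ^ M) powr r * (norm (g z) powr r * decay_weight ?Rk M r (x - z))"
          using mult_left_mono[OF decay_weight_quasi_submult[of ?Rj ?Rk r M y z x], of "norm (g z) powr r"] Rk r
          by (simp add: mult_ac)
        then show "ennreal (norm (g z) powr r * decay_weight ?Rj M r (y - z)) * ennreal (decay_weight ?Rk M r (x - y))
            \<le> ennreal ((2 ^ M) powr r) * ennreal (norm (g z) powr r * decay_weight ?Rk M r (x - z))"
          by (simp add: ennreal_leI flip: ennreal_mult)
      qed simp
      also have "\<dots> = ennreal (C1 M * ?jm) * (ennreal ((2 ^ M) powr r) * ennreal (B x))"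
        using mw[of ?Rk x] by (subst nn_integral_cmult) (auto simp: Bnn)
      also have "\<dots> = ennreal (C3 * ?jm * B x)"
        using C1(1)[of M] B0[of x] by (simp add: C3_def mult_ac flip: ennreal_mult)
      finally show ?thesis using C3 B0[of x] by (simp add: ennreal_le_iff)
    qed
    have h: "norm (LINT y|lborel. kernel (LP_Phi \<Psi> k) (x - y) * g y) powr r
       \<le> (C2 * ?km) powr r * (C3 * ?jm) powr (1 - r) * B x" for x
    proof -
      define s where "s = C3 * ?jm * B x"
      have s0: "s \<ge> 0" using C3 B0 by (simp add: s_def)
      have "norm (LINT y|lborel. kernel (LP_Phi \<Psi> k) (x - y) * g y)
         \<le> (LINT y|lborel. (C2 * ?km * s powr ((1 - r) / r)) * (norm (g y) powr r * decay_weight ?Rk M r (x - y)))"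
      proof (rule norm_integral_le)
        show "integrable lborel (\<lambda>y. (C2 * ?km * s powr ((1 - r) / r)) * (norm (g y) powr r * decay_weight ?Rk M r (x - y)))"
          using Bint by simp
        fix y
        define V where "V = (1 + ?Rk * norm (x - y)) ^ M"
        have V0: "V > 0" unfolding V_def by (intro zero_less_power add_pos_nonneg) auto
        have wV: "decay_weight ?Rk M r (x - y) = (1 / V) powr r" 
          unfolding decay_weight_def V_def[symmetric] using V0 by (simp add: powr_minus powr_divide inverse_eq_divide)
        define a where "a = norm (g y) / V"
        have a0: "a \<ge> 0" using V0 by (simp add: a_def)
        have ar: "a powr r = norm (g y) powr r * decay_weight ?Rk M r (x - y)" using V0 by (simp add: a_def wV powr_divide)
        \<comment> \<open>Only the factor with exponent 1 - r is estimated by \<open>pw\<close>; the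
          other one is kept, so that its integral is \<open>B x\<close> again.\<close>
        have "a = a powr (1 - r) * a powr r" using a0 by (cases "a = 0") (auto simp flip: powr_add)
        also have "a powr (1 - r) = (a powr r) powr ((1 - r) / r)" using r by (simp add: powr_powr)
        also have "\<dots> \<le> s powr ((1 - r) / r)" using pw[of y x] r unfolding ar s_def by (intro powr_mono2) auto
        finally have a: "a \<le> s powr ((1 - r) / r) * a powr r" by (simp add: mult_right_mono)
        have "norm (kernel (LP_Phi \<Psi> k) (x - y) * g y) = (norm (kernel (LP_Phi \<Psi> k) (x - y)) * V) * a"
          using V0 by (simp add: a_def norm_mult)
        also have "\<dots> \<le> (C2 * ?km) * (s powr ((1 - r) / r) * a powr r)"
          by (rule mult_mono) (use C2(1) C2(2)[of k "x - y"] a a0 in \<open>simp_all add: V_def\<close>)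
        finally show "norm (kernel (LP_Phi \<Psi> k) (x - y) * g y) \<le> (C2 * ?km * s powr ((1 - r) / r)) * (norm (g y) powr r * decay_weight ?Rk M r (x - y))"
          unfolding ar by (simp add: mult_ac)
      qed
      also have "\<dots> = C2 * ?km * s powr ((1 - r) / r) * B x" by (simp add: B_def)
      finally have "norm (LINT y|lborel. kernel (LP_Phi \<Psi> k) (x - y) * g y) powr r \<le> (C2 * ?km * s powr ((1 - r) / r) * B x) powr r"
        using r by (intro powr_mono2) auto
      also have "\<dots> = (C2 * ?km) powr r * (s powr (1 - r) * B x powr r)"
        using C2(1) B0[of x] s0 r by (simp add: powr_mult powr_powr mult_ac)
      also have "s powr (1 - r) * B x powr r = (C3 * ?jm) powr (1 - r) * B x"
        unfolding s_def using C3 B0[of x] by (cases "B x = 0") (auto simp: powr_mult mult.assoc simp flip: powr_add)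
      finally show ?thesis by (simp add: mult_ac)
    qed
    define E where "E = (C2 * ?km) powr r * (C3 * ?jm) powr (1 - r)"
    have E0: "E \<ge> 0" by (simp add: E_def)
    have mw2: "(\<lambda>(x, z). ennreal (norm (g z) powr r * decay_weight ?Rk M r (x - z))) \<in> borel_measurable (lborel \<Otimes>\<^sub>M lborel)"
    proof -
      have "(\<lambda>v::'a \<times> 'a. decay_weight ?Rk M r (fst v - snd v)) \<in> borel_measurable borel"
        by (intro borel_measurable_continuous_onI continuous_intros) auto
      then have [measurable]: "(\<lambda>v::'a \<times> 'a. decay_weight ?Rk M r (fst v - snd v)) \<in> borel_measurable (lborel \<Otimes>\<^sub>M lborel)"
        by (simp add: lborel_prod)
      show ?thesis unfolding split_beta' by measurable
    qed
    have "Lp_power r (\<lambda>x. LINT y|lborel. kernel (LP_Phi \<Psi> k) (x - y) * g y) \<le> (\<integral>\<^sup>+x. ennreal E * (\<integral>\<^sup>+z. ennreal (norm (g z) powr r * decay_weight ?Rk M r (x - z)) \<partial>lborel) \<partial>lborel)"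
      unfolding Lp_power_def Bnn
    proof (rule nn_integral_mono)
      show "ennreal (norm (LINT y|lborel. kernel (LP_Phi \<Psi> k) (x - y) * g y) powr r) \<le> ennreal E * ennreal (B x)" for x
        using ennreal_leI[OF h[of x]] E0 B0[of x] by (simp add: E_def ennreal_mult)
    qed
    also have "\<dots> = ennreal E * (\<integral>\<^sup>+x. (\<integral>\<^sup>+z. ennreal (norm (g z) powr r * decay_weight ?Rk M r (x - z)) \<partial>lborel) \<partial>lborel)"
      using lborel.borel_measurable_nn_integral[OF mw2] by (intro nn_integral_cmult) simp
    also have "(\<integral>\<^sup>+x. (\<integral>\<^sup>+z. ennreal (norm (g z) powr r * decay_weight ?Rk M r (x - z)) \<partial>lborel) \<partial>lborel)
       = (\<integral>\<^sup>+z. (\<integral>\<^sup>+x. ennreal (norm (g z) powr r * decay_weight ?Rk M r (x - z)) \<partial>lborel) \<partial>lborel)"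
      using lborel_pair.Fubini'[OF mw2] by simp
    also have "\<dots> \<le> (\<integral>\<^sup>+z. ennreal (norm (g z) powr r) * ennreal (J / ?km) \<partial>lborel)"
    proof (rule nn_integral_mono)
      fix z
      have "(\<integral>\<^sup>+x. ennreal (norm (g z) powr r * decay_weight ?Rk M r (x - z)) \<partial>lborel) = ennreal (norm (g z) powr r) * (\<integral>\<^sup>+x. ennreal (decay_weight ?Rk M r (z - x)) \<partial>lborel)"
        using mw[of ?Rk z] by (simp add: ennreal_mult' decay_weight_minus[of _ _ _ _ z] nn_integral_cmult)
      also have "\<dots> \<le> ennreal (norm (g z) powr r) * ennreal (J / ?km)"
        using J(2)[OF _ r(1) M, of ?Rk z] by (intro mult_left_mono) auto
      finally show "(\<integral>\<^sup>+x. ennreal (norm (g z) powr r * decay_weight ?Rk M r (x - z)) \<partial>lborel) \<le> ennreal (norm (g z) powr r) * ennreal (J / ?km)" .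
    qed
    also have "\<dots> = Lp_power r g * ennreal (J / ?km)"
      unfolding Lp_power_def by (rule nn_integral_multc) measurable
    finally have "Lp_power r (\<lambda>x. LINT y|lborel. kernel (LP_Phi \<Psi> k) (x - y) * g y) \<le> ennreal E * (Lp_power r g * ennreal (J / ?km))"
      by (simp add: mult_left_mono)
    also have "\<dots> = ennreal (E * (J / ?km)) * Lp_power r g"
      using E0 J(1) by (subst ennreal_mult) (auto simp: mult_ac)
    also have "E * (J / ?km) = D * 2 powr ((real j - real k) * real DIM('a) * (1 - r))"
    proof -
      have jm: "?jm = 2 powr (real j * real DIM('a))" and km: "?km = 2 powr (real k * real DIM('a))"
        unfolding of_nat_mult[symmetric] by (subst powr_realpow; simp only: power_mult zero_less_numeral)+
      have "E * (J / ?km) = D * (2 powr (real k * real DIM('a) * r) * 2 powr (real j * real DIM('a) * (1 - r)) * 2 powr (- (real k * real DIM('a))))"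
        unfolding E_def D_def jm km using C2(1) C3
        by (simp add: powr_mult powr_powr powr_minus divide_inverse mult_ac)
      also have "2 powr (real k * real DIM('a) * r) * 2 powr (real j * real DIM('a) * (1 - r)) * 2 powr (- (real k * real DIM('a)))
          = (2::real) powr ((real j - real k) * real DIM('a) * (1 - r))"
        unfolding powr_add[symmetric] by (simp add: algebra_simps)
      finally show ?thesis .
    qed
    finally show ?thesis .
  qed
  moreover have "D > 0" using C2(1) C3 J(1) by (simp add: D_def)
  ultimately show ?thesis by (rule that[rotated])
qed

section \<open>Sums of powers with exponents at most 1\<close>

lemma powr_add_le:
  fixes a b r :: real
  assumes "a \<ge> 0" "b \<ge> 0" "0 < r" "r \<le> 1"
  shows "(a + b) powr r \<le> a powr r + b powr r"
proof (cases "a + b = 0")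
  case False
  then have s: "a + b > 0" using assms by linarith
  have le: "t \<le> t powr r" if "0 \<le> t" "t \<le> 1" for t :: real
  proof (cases "t = 0")
    case False
    then have "t powr 1 \<le> t powr r" using that assms by (intro powr_mono') auto
    then show ?thesis using that False by simp
  qed simp
  \<comment> \<open>By homogeneity the sum may be normalised to 1, and then each part is at most its
    \<open>r\<close>-th power.\<close>
  have "1 = a / (a + b) + b / (a + b)" using s by (simp add: add_divide_distrib[symmetric])
  also have "\<dots> \<le> (a / (a + b)) powr r + (b / (a + b)) powr r"
    using s assms by (intro add_mono le) auto
  also have "\<dots> = (a powr r + b powr r) / (a + b) powr r"
    using s assms by (simp add: powr_divide add_divide_distrib)
  finally show ?thesis using s by (simp add: pos_le_divide_eq)
qed (use assms in auto)

lemma norm_suminf_powr_le: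
  fixes f :: "nat \<Rightarrow> complex"
  assumes f: "f sums S" and r: "0 < r" "r \<le> 1"
  shows "ennreal (norm S powr r) \<le> (\<Sum>i. ennreal (norm (f i) powr r))"
proof (rule LIMSEQ_le_const2)
  have "(\<lambda>n. norm (\<Sum>i<n. f i) powr r) \<longlonglongrightarrow> norm S powr r"
    using f r unfolding sums_def by (intro tendsto_powr2 tendsto_norm tendsto_const) auto
  then show "(\<lambda>n. ennreal (norm (\<Sum>i<n. f i) powr r)) \<longlonglongrightarrow> ennreal (norm S powr r)"
    by (intro tendsto_ennrealI)
  have "norm (\<Sum>i<n. f i) powr r \<le> (\<Sum>i<n. norm (f i) powr r)" for n
  proof (induction n)
    case (Suc n)
    have "norm (\<Sum>i<Suc n. f i) powr r \<le> (norm (\<Sum>i<n. f i) + norm (f n)) powr r"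
      using r norm_triangle_ineq[of "\<Sum>i<n. f i" "f n"] by (intro powr_mono2) auto
    also have "\<dots> \<le> norm (\<Sum>i<n. f i) powr r + norm (f n) powr r" by (intro powr_add_le r) auto
    finally show ?case using Suc by simp
  qed simp
  then have "ennreal (norm (\<Sum>i<n. f i) powr r) \<le> (\<Sum>i. ennreal (norm (f i) powr r))" for n
  proof -
    assume *: "\<And>n. norm (\<Sum>i<n. f i) powr r \<le> (\<Sum>i<n. norm (f i) powr r)"
    have "ennreal (norm (\<Sum>i<n. f i) powr r) \<le> (\<Sum>i<n. ennreal (norm (f i) powr r))"
      using ennreal_leI[OF *[of n]] by (simp add: sum_ennreal)
    also have "\<dots> \<le> (\<Sum>i. ennreal (norm (f i) powr r))" by (intro sum_le_suminf) auto
    finally show ?thesis .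
  qed
  then show "\<exists>N. \<forall>n\<ge>N. ennreal (norm (\<Sum>i<n. f i) powr r) \<le> (\<Sum>i. ennreal (norm (f i) powr r))" by blast
qed

text \<open>The embedding of l_q into l_r: each term is bounded by the whole sum \<open>S\<close>,
  which absorbs the surplus exponent r - q.\<close>

lemma summable_powr_le:
  fixes b :: "nat \<Rightarrow> real"
  assumes b: "\<And>k. b k \<ge> 0" and q: "0 < q" "q \<le> r" and s: "summable (\<lambda>k. b k powr q)"
  shows "summable (\<lambda>k. b k powr r)" "(\<Sum>k. b k powr r) \<le> (\<Sum>k. b k powr q) powr (r / q)"
proof -
  define S where "S = (\<Sum>k. b k powr q)"
  have S0: "S \<ge> 0" unfolding S_def by (intro suminf_nonneg s) simp
  have le: "b k powr r \<le> S powr ((r - q) / q) * b k powr q" for k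
  proof -
    have "b k powr q = (\<Sum>i\<in>{k}. b i powr q)" by simp
    also have "\<dots> \<le> S" unfolding S_def by (intro sum_le_suminf s) auto
    finally have bS: "b k powr q \<le> S" .
    have "b k powr r = b k powr (r - q) * b k powr q" by (simp flip: powr_add)
    also have "b k powr (r - q) = (b k powr q) powr ((r - q) / q)" using q by (simp add: powr_powr)
    also have "\<dots> \<le> S powr ((r - q) / q)" using bS q by (intro powr_mono2) auto
    finally show ?thesis by (simp add: mult_right_mono)
  qed
  have s2: "summable (\<lambda>k. S powr ((r - q) / q) * b k powr q)" by (intro summable_mult s)
  show s3: "summable (\<lambda>k. b k powr r)"
    by (rule summable_comparison_test'[OF s2, of 0]) (use le in auto)
  have "(\<Sum>k. b k powr r) \<le> (\<Sum>k. S powr ((r - q) / q) * b k powr q)"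
    by (intro suminf_le le s2 s3)
  also have "\<dots> = S powr ((r - q) / q) * S" unfolding S_def by (rule suminf_mult[OF s])
  also have "\<dots> = S powr (r / q)"
    using S0 q by (cases "S = 0") (auto simp: powr_mult_base mult.commute[of _ S] diff_divide_distrib)
  finally show "(\<Sum>k. b k powr r) \<le> (\<Sum>k. b k powr q) powr (r / q)" by (simp add: S_def)
qed

section \<open>Besov quasi-norms in terms of real sequences\<close>

lemma ennreal_powr_ennreal: "x \<ge> 0 \<Longrightarrow> ennreal_powr (ennreal x) a = ennreal (x powr a)"
  by (simp add: ennreal_powr_def)

lemma ennreal_powr_le:
  assumes "x \<le> ennreal y" "y \<ge> 0" "a \<ge> 0"
  shows "ennreal_powr x a \<le> ennreal (y powr a)"
proof -
  obtain z where z: "x = ennreal z" "z \<ge> 0" using assms(1) by (cases x) (auto simp: top_unique)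
  then show ?thesis using assms by (auto simp: ennreal_powr_ennreal intro!: ennreal_leI powr_mono2)
qed

lemma Lp_norm_Lp_power: "0 < p \<Longrightarrow> Lp_norm (ennreal p) g = ennreal_powr (Lp_power p g) (1 / p)"
  by (simp add: Lp_norm_def Lp_power_def)

text \<open>Finiteness of the norm makes all terms real. The number \<open>b k\<close> is the
  weighted quasi-norm of the k-th block, in the normalisation of \<open>trace_Nr\<close>.\<close>

lemma besovE:
  fixes u :: "'a::euclidean_space functional"
  assumes u: "u \<in> besov \<Psi> s (ennreal p) (ennreal q)" and p: "0 < p" and q: "0 < q"
  obtains b where "\<And>k. b k \<ge> 0" "\<And>k. Lp_power p (LP_block \<Psi> k u) = ennreal ((2 powr (- s * real k) * b k) powr p)"
    "summable (\<lambda>k. b k powr q)" "besov_norm \<Psi> s (ennreal p) (ennreal q) u = ennreal ((\<Sum>k. b k powr q) powr (1 / q))"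
proof -
  define T where "T = (\<lambda>k. ennreal (2 powr (s * real k * q)) * ennreal_powr (Lp_norm (ennreal p) (LP_block \<Psi> k u)) q)"
  have bn: "besov_norm \<Psi> s (ennreal p) (ennreal q) u = ennreal_powr (\<Sum>k. T k) (1 / q)"
    using q by (simp add: besov_norm_def T_def)
  have "besov_norm \<Psi> s (ennreal p) (ennreal q) u < \<infinity>" using u by (simp add: besov_def)
  then have fin: "(\<Sum>k. T k) \<noteq> top" unfolding bn by (auto simp: ennreal_powr_def)
  have Tfin: "T k \<noteq> top" for k
  proof -
    have "(\<Sum>i\<in>{k}. T i) \<le> (\<Sum>k. T k)" by (intro sum_le_suminf) auto
    then show ?thesis using fin by (auto simp: top_unique)
  qed
  have Nfin: "Lp_power p (LP_block \<Psi> k u) \<noteq> top" for k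
    using Tfin[of k] by (auto simp: T_def Lp_norm_Lp_power[OF p] ennreal_powr_def ennreal_mult_eq_top_iff)
  define A where "A = (\<lambda>k. enn2real (Lp_power p (LP_block \<Psi> k u)))"
  have A: "Lp_power p (LP_block \<Psi> k u) = ennreal (A k)" "A k \<ge> 0" for k
    using Nfin[of k] by (simp_all add: A_def less_top)
  define b where "b = (\<lambda>k. 2 powr (s * real k) * A k powr (1 / p))"
  have Tb: "T k = ennreal (b k powr q)" for k
    using A(2)[of k] by (simp add: T_def Lp_norm_Lp_power[OF p] A(1) ennreal_powr_ennreal b_def powr_mult powr_powr ennreal_mult)
  show ?thesis
  proof (rule that[of b])
    show "b k \<ge> 0" for k by (simp add: b_def)
    have "2 powr (- s * real k) * b k = A k powr (1 / p)" for k
      by (simp add: b_def powr_minus)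
    then show "Lp_power p (LP_block \<Psi> k u) = ennreal ((2 powr (- s * real k) * b k) powr p)" for k
      using A[of k] p by (simp add: powr_powr)
    show s: "summable (\<lambda>k. b k powr q)"
      using fin unfolding Tb by (intro summable_suminf_not_top) auto
    show "besov_norm \<Psi> s (ennreal p) (ennreal q) u = ennreal ((\<Sum>k. b k powr q) powr (1 / q))"
      unfolding bn Tb by (subst suminf_ennreal2) (auto simp: s ennreal_powr_ennreal suminf_nonneg)
  qed
qed

text \<open>The weight of this smoothness is the reciprocal of the 1/r-th power of the decaying
  factor, so every term of the supremum obeys the same bound.\<close>

lemma besov_norm_inf_le:
  fixes v :: "'a::euclidean_space functional"
  assumes r: "0 < r" and X: "X \<ge> 0"
    and le: "\<And>k. Lp_power r (LP_block \<Psi> k v) \<le> ennreal (2 powr (- real k * real m * (1 - r)) * X)"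
  shows "besov_norm \<Psi> (real m * (1 / r - 1)) (ennreal r) \<infinity> v \<le> ennreal (X powr (1 / r))"
proof -
  have "ennreal (2 powr (real m * (1 / r - 1) * real k)) * Lp_norm (ennreal r) (LP_block \<Psi> k v) \<le> ennreal (X powr (1 / r))" for k
  proof -
    have "ennreal (2 powr (real m * (1 / r - 1) * real k)) * Lp_norm (ennreal r) (LP_block \<Psi> k v)
       \<le> ennreal (2 powr (real m * (1 / r - 1) * real k)) * ennreal ((2 powr (- real k * real m * (1 - r)) * X) powr (1 / r))"
      unfolding Lp_norm_Lp_power[OF r] using r X by (intro mult_left_mono ennreal_powr_le le) auto
    also have "\<dots> = ennreal (2 powr (real m * (1 / r - 1) * real k) * (2 powr (- real k * real m * (1 - r) / r) * X powr (1 / r)))"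
      using X by (simp add: powr_mult powr_powr ennreal_mult)
    also have "2 powr (real m * (1 / r - 1) * real k) * (2 powr (- real k * real m * (1 - r) / r) * X powr (1 / r)) = X powr (1 / r)"
    proof -
      have "real m * (1 / r - 1) * real k + - real k * real m * (1 - r) / r = 0" using r by (simp add: field_simps)
      then have "(2::real) powr (real m * (1 / r - 1) * real k) * 2 powr (- real k * real m * (1 - r) / r) = 1"
        unfolding powr_add[symmetric] by simp
      then show ?thesis by (simp add: mult.assoc[symmetric])
    qed
    finally show ?thesis .
  qed
  then show ?thesis by (simp add: besov_norm_def SUP_least)
qed

section \<open>Distributions given by integrable functions\<close>

lemma multi_indices_upto_0: "multi_indices_upto 0 = {[]}"
  by (auto simp: multi_indices_upto_def multi_indices_def)

lemma norm_le_seminorm_0: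
  assumes "bdd_above (range (\<lambda>x. norm (f x)))"
  shows "norm (f x) \<le> schwartz_seminorm 0 f" "norm (f x) \<le> test_seminorm 0 f"
  using cSUP_upper[OF UNIV_I assms] by (simp_all add: schwartz_seminorm_def test_seminorm_def multi_indices_upto_0)

lemma rapid_bounded:
  assumes "rapid f" obtains B where "\<And>x. norm (f x) \<le> B"
  using rapidE[OF assms, of 0] by auto

lemma rapid_bdd:
  assumes "rapid f" shows "bdd_above (range (\<lambda>x. norm (f x)))"
proof -
  obtain B where "\<And>x. norm (f x) \<le> B" using rapid_bounded[OF assms] by blast
  then show ?thesis by (auto intro!: bdd_aboveI)
qed

lemma integrable_mult_bounded:
  fixes w f :: "'a::euclidean_space \<Rightarrow> complex"
  assumes w: "integrable lborel w" and f: "continuous_on UNIV f" "\<And>x. norm (f x) \<le> B"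
  shows "integrable lborel (\<lambda>x. w x * f x)" "norm (LINT x|lborel. w x * f x) \<le> (LINT x|lborel. norm (w x)) * B"
proof -
  have [measurable]: "f \<in> borel_measurable borel" using f(1) by (rule borel_measurable_continuous_onI)
  have [measurable]: "w \<in> borel_measurable borel" using borel_measurable_integrable[OF w] by simp
  have i: "integrable lborel (\<lambda>x. norm (w x) * B)" using w by simp
  have le: "norm (w x * f x) \<le> norm (w x) * B" for x using f(2)[of x] by (simp add: norm_mult mult_left_mono)
  show "integrable lborel (\<lambda>x. w x * f x)"
    by (rule Bochner_Integration.integrable_bound[OF i]) (auto intro!: AE_I2 order_trans[OF le abs_ge_self])
  show "norm (LINT x|lborel. w x * f x) \<le> (LINT x|lborel. norm (w x)) * B"
    using norm_integral_le[OF i le] by simp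
qed

lemma regular_functional_tempered:
  fixes w :: "'a::euclidean_space \<Rightarrow> complex"
  assumes w: "integrable lborel w"
  shows "tempered_distribution (regular_functional w)" "distribution (regular_functional w)"
proof -
  have lin: "regular_functional w (\<lambda>x. a * f x + b * g x) = a * regular_functional w f + b * regular_functional w g"
    if fg: "rapid f" "rapid g" for f g a b
  proof -
    obtain B1 where B1: "\<And>x. norm (f x) \<le> B1" using rapid_bounded[OF fg(1)] by blast
    obtain B2 where B2: "\<And>x. norm (g x) \<le> B2" using rapid_bounded[OF fg(2)] by blast
    have "integrable lborel (\<lambda>x. w x * f x)" "integrable lborel (\<lambda>x. w x * g x)"
      using integrable_mult_bounded(1)[OF w rapid_continuous[OF fg(1)] B1]
        integrable_mult_bounded(1)[OF w rapid_continuous[OF fg(2)] B2] by auto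
    then show ?thesis unfolding regular_functional_def
      by (simp add: distrib_left mult.left_commute[of "w _"])
  qed
  have s: "norm (regular_functional w f) \<le> (LINT x|lborel. norm (w x)) * schwartz_seminorm 0 f"
    and t: "norm (regular_functional w f) \<le> (LINT x|lborel. norm (w x)) * test_seminorm 0 f" if "rapid f" for f
    unfolding regular_functional_def
    by (intro integrable_mult_bounded(2)[OF w rapid_continuous[OF that]] norm_le_seminorm_0 rapid_bdd that)+
  show "tempered_distribution (regular_functional w)"
    unfolding tempered_distribution_def linear_functional_on_def
    by (intro conjI ballI allI exI[of _ "LINT x|lborel. norm (w x)"] exI[of _ 0] impI)
       (auto intro!: lin s schwartz_rapid)
  show "distribution (regular_functional w)"
    unfolding distribution_def linear_functional_on_def
    by (intro conjI ballI allI exI[of _ "LINT x|lborel. norm (w x)"] exI[of _ 0] impI)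
       (auto intro!: lin t test_function_rapid)
qed

lemma LP_block_regular:
  fixes w :: "'a::euclidean_space \<Rightarrow> complex"
  assumes \<Psi>: "LP_cutoff \<Psi>" and w: "integrable lborel w"
  shows "LP_block \<Psi> k (regular_functional w) x = (LINT y|lborel. w y * kernel (LP_Phi \<Psi> k) (x - y))"
  unfolding LP_block_eq(1)[OF \<Psi> regular_functional_tempered(1)[OF w]] by (simp add: regular_functional_def)

text \<open>The L_1 norms are summable, so the series converges absolutely almost everywhere, and
  the values of \<open>w\<close> on the exceptional null set do not affect integrals. Bounded
  continuous \<open>\<phi>\<close> include both test functions and the kernels of the
  blocks.\<close>

lemma series_integrable:
  fixes f :: "nat \<Rightarrow> 'a::euclidean_space \<Rightarrow> complex"
  assumes c: "\<And>j. continuous_on UNIV (f j)" and N: "\<And>j. Lp_power 1 (f j) \<le> ennreal (a j)" and a: "\<And>j. a j \<ge> 0" "summable a"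
  defines "w \<equiv> \<lambda>x. \<Sum>j. f j x"
  shows "integrable lborel w"
    and "\<And>\<phi> B. continuous_on UNIV \<phi> \<Longrightarrow> (\<And>x. norm (\<phi> x) \<le> B) \<Longrightarrow>
      (\<lambda>j. LINT x|lborel. f j x * \<phi> x) sums (LINT x|lborel. w x * \<phi> x)"
proof -
  have [measurable]: "f j \<in> borel_measurable borel" for j using c by (rule borel_measurable_continuous_onI)
  have N1: "Lp_power 1 (f j) = (\<integral>\<^sup>+x. ennreal (norm (f j x)) \<partial>lborel)" for j by (simp add: Lp_power_def)
  have int: "integrable lborel (f j)" for j
    using N[of j] by (intro integrableI_bounded) (auto simp flip: N1 intro: le_less_trans)
  have "(\<integral>\<^sup>+x. (\<Sum>j. ennreal (norm (f j x))) \<partial>lborel) = (\<Sum>j. Lp_power 1 (f j))"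
    unfolding N1 by (rule nn_integral_suminf) measurable
  also have "\<dots> \<le> (\<Sum>j. ennreal (a j))" by (intro suminf_le N) auto
  also have "\<dots> < \<infinity>" using a by (simp add: suminf_ennreal2)
  finally have "(\<integral>\<^sup>+x. (\<Sum>j. ennreal (norm (f j x))) \<partial>lborel) \<noteq> \<infinity>" by simp
  then have "AE x in lborel. (\<Sum>j. ennreal (norm (f j x))) \<noteq> \<infinity>" by (intro nn_integral_noteq_infinite) measurable
  then have ae: "AE x in lborel. summable (\<lambda>j. norm (f j x))"
    by eventually_elim (auto intro: summable_suminf_not_top)
  have le: "(LINT x|lborel. norm (f j x)) \<le> a j" for j
  proof -
    have "ennreal (LINT x|lborel. norm (f j x)) = Lp_power 1 (f j)"
      unfolding N1 by (rule nn_integral_eq_integral[symmetric]) (use int in auto)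
    with N[of j] have "ennreal (LINT x|lborel. norm (f j x)) \<le> ennreal (a j)" by simp
    then show ?thesis using ennreal_le_iff[OF a(1)] by blast
  qed
  have sn: "summable (\<lambda>j. LINT x|lborel. norm (f j x))"
    by (rule summable_comparison_test'[OF a(2), of 0]) (use le in \<open>auto simp: Bochner_Integration.integral_nonneg\<close>)
  show "integrable lborel w" unfolding w_def by (rule integrable_suminf[OF int ae sn])
  fix \<phi> :: "'a \<Rightarrow> complex" and B assume \<phi>: "continuous_on UNIV \<phi>" "\<And>x. norm (\<phi> x) \<le> B"
  have [measurable]: "\<phi> \<in> borel_measurable borel" using \<phi>(1) by (rule borel_measurable_continuous_onI)
  have B0: "B \<ge> 0" using order_trans[OF norm_ge_zero \<phi>(2)] .
  have int2: "integrable lborel (\<lambda>x. f j x * \<phi> x)" for j by (rule integrable_mult_bounded(1)[OF int \<phi>])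
  have ae2: "AE x in lborel. summable (\<lambda>j. norm (f j x * \<phi> x))"
    using ae by eventually_elim (simp add: norm_mult summable_mult2)
  have sn2: "summable (\<lambda>j. LINT x|lborel. norm (f j x * \<phi> x))"
  proof (rule summable_comparison_test'[OF summable_mult2[OF sn, of B], of 0])
    fix j
    have "norm (LINT x|lborel. norm (f j x * \<phi> x)) \<le> (LINT x|lborel. norm (f j x) * B)"
      using int[of j] \<phi>(2) by (intro norm_integral_le) (auto simp: norm_mult mult_left_mono)
    then show "norm (LINT x|lborel. norm (f j x * \<phi> x)) \<le> (LINT x|lborel. norm (f j x)) * B" by simp
  qed
  have "(\<lambda>j. LINT x|lborel. f j x * \<phi> x) sums (LINT x|lborel. (\<Sum>j. f j x * \<phi> x))"
    by (rule sums_integral[OF int2 ae2 sn2])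
  also have "(LINT x|lborel. (\<Sum>j. f j x * \<phi> x)) = (LINT x|lborel. w x * \<phi> x)"
  proof (rule integral_cong_AE)
    show "AE x in lborel. (\<Sum>j. f j x * \<phi> x) = w x * \<phi> x"
      using ae by eventually_elim (simp add: w_def suminf_mult2 summable_norm_cancel)
  qed (simp_all add: w_def)
  finally show "(\<lambda>j. LINT x|lborel. f j x * \<phi> x) sums (LINT x|lborel. w x * \<phi> x)" .
qed

text \<open>The exponent \<open>r\<close> is kept free: at least \<open>p\<close> for the Nikolskii
  step, at least \<open>q\<close> for the embedding of sequence spaces, at most 1 for subadditivity.
  Both boundedness claims and the existence of the trace are instances.\<close>

lemma trace_upper:
  assumes \<Psi>: "LP_cutoff \<Psi>" and p: "0 < p" "p \<le> r" "r \<le> 1" and q: "0 < q" "q \<le> r"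
  defines "n \<equiv> real (DIM('a::euclidean_space \<times> real))"
  shows "trace_bounded TYPE('a) \<Psi> (n / p - n + 1) (ennreal p) (ennreal q) (real DIM('a) * (1 / r - 1)) (ennreal r) \<infinity>"
proof -
  let ?s = "n / p - n + 1" and ?m = "real DIM('a)"
  have p1: "p \<le> 1" and r0: "0 < r" and q1: "q \<le> 1" using p q by auto
  \<comment> \<open>With target exponent 1 the power of 2 disappears: the L_1 norms of the traced
    blocks are bounded by multiples of the terms \<open>b j\<close>, which are summable because q
    \<le> 1.\<close>
  obtain D1 where D1: "D1 > 0" "\<And>j b (g :: 'a \<times> real \<Rightarrow> complex). bandlimited \<Psi> j g \<Longrightarrow> b \<ge> 0 \<Longrightarrow>
     Lp_power p g = ennreal ((2 powr (- ?s * real j) * b) powr p) \<Longrightarrow>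
     Lp_power 1 (\<lambda>x. g (x, 0)) \<le> ennreal (D1 * 2 powr (- real j * ?m * (1 - 1)) * b powr 1)"
    using trace_Nr[OF \<Psi> p(1) p1 order_refl, where 'a='a] unfolding n_def by blast
  obtain D2 where D2: "D2 > 0" "\<And>j b (g :: 'a \<times> real \<Rightarrow> complex). bandlimited \<Psi> j g \<Longrightarrow> b \<ge> 0 \<Longrightarrow>
     Lp_power p g = ennreal ((2 powr (- ?s * real j) * b) powr p) \<Longrightarrow>
     Lp_power r (\<lambda>x. g (x, 0)) \<le> ennreal (D2 * 2 powr (- real j * ?m * (1 - r)) * b powr r)"
    using trace_Nr[OF \<Psi> p, where 'a='a] unfolding n_def by blast
  obtain D3 where D3: "D3 > 0" "\<And>j k (g :: 'a \<Rightarrow> complex). bandlimited \<Psi> j g \<Longrightarrow> Lp_power r g < \<infinity> \<Longrightarrow> k \<le> j + 1 \<Longrightarrow>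
     Lp_power r (\<lambda>x. LINT y|lborel. kernel (LP_Phi \<Psi> k) (x - y) * g y)
      \<le> ennreal (D3 * 2 powr ((real j - real k) * ?m * (1 - r))) * Lp_power r g"
    using conv_est[OF \<Psi> r0 p(3), where 'a='a] by blast
  define c where "c = (D3 * D2) powr (1 / r)"
  have "\<exists>v :: 'a functional. v \<in> besov \<Psi> (?m * (1 / r - 1)) (ennreal r) \<infinity> \<and> has_trace \<Psi> u v \<and>
        besov_norm \<Psi> (?m * (1 / r - 1)) (ennreal r) \<infinity> v \<le> ennreal c * besov_norm \<Psi> ?s (ennreal p) (ennreal q) u"
    if u: "u \<in> besov \<Psi> ?s (ennreal p) (ennreal q)" for u :: "('a \<times> real) functional"
  proof -
    have tu: "tempered_distribution u" using u by (simp add: besov_def)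
    obtain b where b: "\<And>k. b k \<ge> 0" "\<And>k. Lp_power p (LP_block \<Psi> k u) = ennreal ((2 powr (- ?s * real k) * b k) powr p)"
      "summable (\<lambda>k. b k powr q)" "besov_norm \<Psi> ?s (ennreal p) (ennreal q) u = ennreal ((\<Sum>k. b k powr q) powr (1 / q))"
      using besovE[OF u p(1) q(1)] by blast
    define f where "f = (\<lambda>j x. LP_block \<Psi> j u (x :: 'a, 0 :: real))"
    have bf: "bandlimited \<Psi> j (f j)" for j unfolding f_def by (rule bandlimited_trace[OF \<Psi> tu])
    have cf: "continuous_on UNIV (f j)" for j using bf unfolding bandlimited_def by blast
    have [measurable]: "f j \<in> borel_measurable borel" for j using cf by (rule borel_measurable_continuous_onI)
    have N1: "Lp_power 1 (f j) \<le> ennreal (D1 * b j)" for j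
      using D1(2)[OF bandlimited_block[OF \<Psi> tu] b(1) b(2), of j] b(1)[of j] by (simp add: f_def)
    have Nr: "Lp_power r (f j) \<le> ennreal (D2 * 2 powr (- real j * ?m * (1 - r)) * b j powr r)" for j
      using D2(2)[OF bandlimited_block[OF \<Psi> tu] b(1) b(2), of j] by (simp add: f_def)
    have sb: "summable (\<lambda>j. D1 * b j)"
      using summable_powr_le(1)[OF b(1) q(1) q1 b(3)] b(1) by (intro summable_mult) simp
    have D1b: "D1 * b j \<ge> 0" for j using D1(1) b(1) by simp
    define w where "w = (\<lambda>x. \<Sum>j. f j x)"
    note ser = series_integrable[OF cf N1 D1b sb, folded w_def]
    define v where "v = regular_functional w"
    have tv: "tempered_distribution v" "distribution v"
      unfolding v_def by (rule regular_functional_tempered[OF ser(1)])+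
    have tr: "has_trace \<Psi> u v"
      unfolding has_trace_def
    proof (intro conjI allI impI tv(2))
      fix g :: "'a \<Rightarrow> complex" assume g: "test_function g"
      obtain B where "\<And>x. norm (g x) \<le> B" using rapid_bounded[OF test_function_rapid[OF g]] by blast
      from ser(2)[OF rapid_continuous[OF test_function_rapid[OF g]] this]
      show "(\<lambda>j. regular_functional (\<lambda>x'. LP_block \<Psi> j u (x', 0)) g) sums v g"
        by (simp add: v_def regular_functional_def f_def w_def)
    qed
    define h where "h = (\<lambda>k j x. LINT y|lborel. kernel (LP_Phi \<Psi> k) (x - y) * f j y)"
    \<comment> \<open>For such \<open>k\<close> the symbol starts at 11/20 * 2 ^ k, at least 22/10 *
      2 ^ j, beyond the radius 13/10 * 2 ^ j of the ball containing the frequencies of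
      \<open>f j\<close>.\<close>
    have h0: "h k j x = 0" if "k \<ge> j + 2" for k j x
    proof -
      have "LP_Phi \<Psi> k (fst \<xi>) * LP_Phi \<Psi> j \<xi> = 0 * LP_Phi \<Psi> j \<xi>" for \<xi> :: "'a \<times> real"
      proof (rule ccontr)
        assume "LP_Phi \<Psi> k (fst \<xi>) * LP_Phi \<Psi> j \<xi> \<noteq> 0 * LP_Phi \<Psi> j \<xi>"
        then have nz: "LP_Phi \<Psi> k (fst \<xi>) \<noteq> 0" "LP_Phi \<Psi> j \<xi> \<noteq> 0" by auto
        have "(11/20) * 2 ^ k \<le> norm (fst \<xi>)" using LP_Phi_support(2)[OF \<Psi> nz(1)] that by simp
        also have "\<dots> \<le> norm \<xi>" by (rule norm_fst_le')
        also have "\<dots> \<le> 13/10 * 2 ^ j" by (rule LP_Phi_support(1)[OF \<Psi> nz(2)])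
        finally have "(11/20) * 2 ^ k \<le> (13/10) * (2::real) ^ j" .
        moreover have "4 * (2::real) ^ j \<le> 2 ^ k" using power_increasing[OF that, of "2::real"] by (simp add: power_add)
        moreover have "(2::real) ^ j > 0" by simp
        ultimately show False by linarith
      qed
      from trace_conv[OF \<Psi> tu cutoff_Phi[OF \<Psi>] this, of x]
      have "(LINT z|lborel. kernel (LP_Phi \<Psi> k) z * f j (x - z)) = 0" by (simp add: f_def)
      moreover have "(LINT z|lborel. kernel (LP_Phi \<Psi> k) z * f j (x - z))
          = \<bar>- 1 :: real\<bar> ^ DIM('a) *\<^sub>R (LINT z|lborel. kernel (LP_Phi \<Psi> k) (x + (- 1) *\<^sub>R z) * f j (x - (x + (- 1) *\<^sub>R z)))"
      proof (rule lborel_integral_affine)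
        have [measurable]: "(kernel (LP_Phi \<Psi> k) :: 'a \<Rightarrow> complex) \<in> borel_measurable borel"
          by (intro borel_measurable_continuous_onI rapid_continuous rapid_kernel cutoff_Phi \<Psi>)
        show "(\<lambda>z. kernel (LP_Phi \<Psi> k) z * f j (x - z)) \<in> borel_measurable borel" by measurable
      qed simp
      ultimately show ?thesis by (simp add: h_def)
    qed
    \<comment> \<open>The growth in \<open>j\<close> from \<open>conv_est\<close> and the decay in
      \<open>j\<close> from \<open>trace_Nr\<close> cancel exactly; the power of 2 that is left
      depends on \<open>k\<close> alone and is the one demanded by the target space.\<close>
    have hN: "Lp_power r (h k j) \<le> ennreal (2 powr (- real k * ?m * (1 - r)) * (D3 * D2) * b j powr r)" for k j
    proof (cases "k \<le> j + 1")
      case True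
      have "Lp_power r (f j) < \<infinity>" using Nr[of j] by (rule le_less_trans) simp
      from D3(2)[OF bf this True]
      have "Lp_power r (h k j) \<le> ennreal (D3 * 2 powr ((real j - real k) * ?m * (1 - r))) * Lp_power r (f j)" by (simp add: h_def)
      also have "\<dots> \<le> ennreal (D3 * 2 powr ((real j - real k) * ?m * (1 - r))) * ennreal (D2 * 2 powr (- real j * ?m * (1 - r)) * b j powr r)"
        by (intro mult_left_mono Nr) simp
      also have "\<dots> = ennreal ((D3 * 2 powr ((real j - real k) * ?m * (1 - r))) * (D2 * 2 powr (- real j * ?m * (1 - r)) * b j powr r))"
        using D3(1) D2(1) by (intro ennreal_mult[symmetric]) auto
      also have "(D3 * 2 powr ((real j - real k) * ?m * (1 - r))) * (D2 * 2 powr (- real j * ?m * (1 - r)) * b j powr r)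
          = (2 powr ((real j - real k) * ?m * (1 - r)) * 2 powr (- real j * ?m * (1 - r))) * (D3 * D2) * b j powr r"
        by (simp add: mult_ac)
      also have "2 powr ((real j - real k) * ?m * (1 - r)) * 2 powr (- real j * ?m * (1 - r)) = (2::real) powr (- real k * ?m * (1 - r))"
        unfolding powr_add[symmetric] by (simp add: algebra_simps)
      finally show ?thesis .
    next
      case False
      then have "h k j = (\<lambda>x. 0)" using h0 by (auto simp: fun_eq_iff)
      then show ?thesis by (simp add: Lp_power_def)
    qed
    have hm [measurable]: "h k j \<in> borel_measurable borel" for k j
    proof -
      have [measurable]: "(kernel (LP_Phi \<Psi> k) :: 'a \<Rightarrow> complex) \<in> borel_measurable borel"
        by (intro borel_measurable_continuous_onI rapid_continuous rapid_kernel cutoff_Phi \<Psi>)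
      have "(\<lambda>(x, y). kernel (LP_Phi \<Psi> k) (x - y) * f j y) \<in> borel_measurable (lborel \<Otimes>\<^sub>M lborel)" by measurable
      from lborel.borel_measurable_lebesgue_integral[OF this] show ?thesis by (simp add: h_def)
    qed
    have sums: "(\<lambda>j. h k j x) sums LP_block \<Psi> k v x" for k x
    proof -
      have r: "rapid (\<lambda>y. kernel (LP_Phi \<Psi> k) (x - y))"
        by (intro schwartz_rapid schwartz_reflect schwartz_kernel cutoff_Phi \<Psi>)
      obtain B where "\<And>y. norm (kernel (LP_Phi \<Psi> k) (x - y)) \<le> B" using rapid_bounded[OF r] by blast
      moreover have "LP_block \<Psi> k v x = (LINT y|lborel. w y * kernel (LP_Phi \<Psi> k) (x - y))"
        unfolding v_def by (rule LP_block_regular[OF \<Psi> ser(1)])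
      ultimately show ?thesis using ser(2)[OF rapid_continuous[OF r], of B]
        by (simp add: h_def mult.commute[of "kernel _ _"] w_def)
    qed
    define S where "S = (\<Sum>k. b k powr q)"
    have S0: "S \<ge> 0" unfolding S_def by (intro suminf_nonneg b(3)) simp
    note sbr = summable_powr_le[OF b(1) q b(3), folded S_def]
    \<comment> \<open>As no decay in \<open>j\<close> is left, convergence rests on the summability
      of the \<open>r\<close>-th powers of \<open>b\<close>.\<close>
    have "Lp_power r (LP_block \<Psi> k v) \<le> ennreal (2 powr (- real k * ?m * (1 - r)) * (D3 * D2 * S powr (r / q)))" for k
    proof -
      have "Lp_power r (LP_block \<Psi> k v) \<le> (\<integral>\<^sup>+x. (\<Sum>j. ennreal (norm (h k j x) powr r)) \<partial>lborel)"
        unfolding Lp_power_def by (intro nn_integral_mono norm_suminf_powr_le[OF sums r0 p(3)])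
      also have "\<dots> = (\<Sum>j. Lp_power r (h k j))"
        unfolding Lp_power_def by (rule nn_integral_suminf) measurable
      also have "\<dots> \<le> (\<Sum>j. ennreal (2 powr (- real k * ?m * (1 - r)) * (D3 * D2) * b j powr r))"
        by (intro suminf_le hN) auto
      also have "\<dots> = ennreal (\<Sum>j. 2 powr (- real k * ?m * (1 - r)) * (D3 * D2) * b j powr r)"
        using D2(1) D3(1) sbr(1) by (intro suminf_ennreal2) (auto intro!: summable_mult)
      also have "(\<Sum>j. 2 powr (- real k * ?m * (1 - r)) * (D3 * D2) * b j powr r) = 2 powr (- real k * ?m * (1 - r)) * (D3 * D2) * (\<Sum>j. b j powr r)"
        by (rule suminf_mult[OF sbr(1)])
      also have "ennreal \<dots> \<le> ennreal (2 powr (- real k * ?m * (1 - r)) * (D3 * D2) * S powr (r / q))"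
        using sbr(2) D2(1) D3(1) by (intro ennreal_leI mult_left_mono) auto
      finally show ?thesis by (simp add: mult.assoc)
    qed
    from besov_norm_inf_le[OF r0 _ this] have "besov_norm \<Psi> (?m * (1 / r - 1)) (ennreal r) \<infinity> v \<le> ennreal ((D3 * D2 * S powr (r / q)) powr (1 / r))"
      using D2(1) D3(1) by simp
    also have "(D3 * D2 * S powr (r / q)) powr (1 / r) = c * S powr (1 / q)"
      using D2(1) D3(1) S0 r0 by (simp add: c_def powr_mult powr_powr)
    also have "ennreal \<dots> = ennreal c * besov_norm \<Psi> ?s (ennreal p) (ennreal q) u"
      unfolding b(4) S_def[symmetric] by (rule ennreal_mult) (simp_all add: c_def)
    finally have le: "besov_norm \<Psi> (?m * (1 / r - 1)) (ennreal r) \<infinity> v \<le> ennreal c * besov_norm \<Psi> ?s (ennreal p) (ennreal q) u" .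
    also have "\<dots> < \<infinity>" unfolding b(4) by (simp add: ennreal_mult_less_top)
    finally have "v \<in> besov \<Psi> (?m * (1 / r - 1)) (ennreal r) \<infinity>" using tv(1) by (simp add: besov_def)
    then show ?thesis using tr le by blast
  qed
  then show ?thesis unfolding trace_bounded_def by blast
qed

section \<open>Sharpness of the integral-exponent\<close>

text \<open>The model case is \<open>M \<epsilon> x = 1 - \<eta> (\<epsilon> *\<^sub>R x)\<close> with a cut-off function \<open>\<eta>\<close>.\<close>

definition vanishing_multiplier :: "(real \<Rightarrow> 'a::euclidean_space \<Rightarrow> complex) \<Rightarrow> bool" where
  "vanishing_multiplier M \<longleftrightarrow> (\<forall>\<epsilon>\<in>{0<..1}. smooth (M \<epsilon>)) \<and>
     (\<forall>bs\<in>multi_indices. \<exists>C. \<forall>\<epsilon>\<in>{0<..1}. \<forall>x. norm (iter_deriv bs (M \<epsilon>) x) \<le> C * \<epsilon> * (1 + norm x))"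

lemma schwartz_partial_deriv:
  assumes f: "schwartz f" and b: "b \<in> Basis"
  shows "schwartz (partial_deriv b f)"
proof (rule schwartzI)
  show "smooth (partial_deriv b f)" by (rule smooth_partial_deriv[OF schwartz_smooth[OF f] b])
  fix N and bs :: "'a list" assume "bs \<in> multi_indices"
  then have "bs @ [b] \<in> multi_indices" using b by (auto simp: multi_indices_def)
  from schwartzE[OF f this, of N] show "\<exists>C. \<forall>x. (1 + norm x) ^ N * norm (iter_deriv bs (partial_deriv b f) x) \<le> C"
    unfolding iter_deriv_snoc by blast
qed

lemma vanishing_multiplier_partial_deriv:
  assumes M: "vanishing_multiplier M" and b: "b \<in> Basis"
  shows "vanishing_multiplier (\<lambda>\<epsilon>. partial_deriv b (M \<epsilon>))"
  unfolding vanishing_multiplier_def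
proof (intro conjI ballI)
  show "smooth (partial_deriv b (M \<epsilon>))" if "\<epsilon> \<in> {0<..1}" for \<epsilon>
    using M that b smooth_partial_deriv unfolding vanishing_multiplier_def by blast
  fix bs :: "'a list" assume "bs \<in> multi_indices"
  then have "bs @ [b] \<in> multi_indices" using b by (auto simp: multi_indices_def)
  then show "\<exists>C. \<forall>\<epsilon>\<in>{0<..1}. \<forall>x. norm (iter_deriv bs (partial_deriv b (M \<epsilon>)) x) \<le> C * \<epsilon> * (1 + norm x)"
    using M unfolding vanishing_multiplier_def iter_deriv_snoc[symmetric] by blast
qed

text \<open>Leibniz rule, by induction on the innermost derivative: multipliers of this kind and
  Schwartz functions are both closed under partial derivatives. The factor \<open>1 + norm x\<close>
  is absorbed by one more power of decay of \<open>f\<close>.\<close>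

lemma vanishing_multiplier_mult:
  assumes "vanishing_multiplier M" "schwartz f" "bs \<in> multi_indices"
  shows "\<exists>C. \<forall>\<epsilon>\<in>{0<..1}. \<forall>x. (1 + norm x) ^ N * norm (iter_deriv bs (\<lambda>x. M \<epsilon> x * f x) x) \<le> C * \<epsilon>"
  using assms
proof (induction bs arbitrary: M f rule: rev_induct)
  case Nil
  obtain C where C: "\<And>\<epsilon> x. \<epsilon> \<in> {0<..1} \<Longrightarrow> norm (iter_deriv [] (M \<epsilon>) x) \<le> C * \<epsilon> * (1 + norm x)"
    using Nil(1) Nil_multi_indices unfolding vanishing_multiplier_def by meson
  obtain B where B: "B > 0" "\<And>x. (1 + norm x) ^ Suc N * norm (f x) \<le> B"
    using rapidE[OF schwartz_rapid[OF Nil(2)]] by blast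
  have "(1 + norm x) ^ N * norm (M \<epsilon> x * f x) \<le> (C * B) * \<epsilon>" if e: "\<epsilon> \<in> {0<..1}" for \<epsilon> x
  proof -
    have "0 \<le> C * \<epsilon> * (1 + norm x)" using order_trans[OF norm_ge_zero C[OF e]] .
    then have C0: "C * \<epsilon> \<ge> 0" by (simp add: zero_le_mult_iff add_nonneg_nonneg) (smt (verit) norm_ge_zero)
    have "(1 + norm x) ^ N * norm (M \<epsilon> x * f x) = (1 + norm x) ^ N * (norm (M \<epsilon> x) * norm (f x))" by (simp add: norm_mult)
    also have "\<dots> \<le> (1 + norm x) ^ N * ((C * \<epsilon> * (1 + norm x)) * norm (f x))"
      using C[OF e, of x] by (intro mult_left_mono mult_right_mono) auto
    also have "\<dots> = C * \<epsilon> * ((1 + norm x) ^ Suc N * norm (f x))" by (simp add: mult_ac)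
    also have "\<dots> \<le> C * \<epsilon> * B" by (intro mult_left_mono B C0)
    finally show ?thesis by (simp add: mult_ac)
  qed
  then show ?case by (auto intro!: exI[of _ "C * B"])
next
  case (snoc b bs)
  then have b: "b \<in> Basis" and bs: "bs \<in> multi_indices" by (auto simp: multi_indices_def)
  obtain C1 where C1: "\<And>\<epsilon> x. \<epsilon> \<in> {0<..1} \<Longrightarrow> (1 + norm x) ^ N * norm (iter_deriv bs (\<lambda>x. partial_deriv b (M \<epsilon>) x * f x) x) \<le> C1 * \<epsilon>"
    using snoc.IH[OF vanishing_multiplier_partial_deriv[OF snoc.prems(1) b] snoc.prems(2) bs] by blast
  obtain C2 where C2: "\<And>\<epsilon> x. \<epsilon> \<in> {0<..1} \<Longrightarrow> (1 + norm x) ^ N * norm (iter_deriv bs (\<lambda>x. M \<epsilon> x * partial_deriv b f x) x) \<le> C2 * \<epsilon>"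
    using snoc.IH[OF snoc.prems(1) schwartz_partial_deriv[OF snoc.prems(2) b] bs] by blast
  have "(1 + norm x) ^ N * norm (iter_deriv (bs @ [b]) (\<lambda>x. M \<epsilon> x * f x) x) \<le> (C1 + C2) * \<epsilon>" if e: "\<epsilon> \<in> {0<..1}" for \<epsilon> x
  proof -
    have sM: "smooth (M \<epsilon>)" using snoc.prems(1) e by (simp add: vanishing_multiplier_def)
    have sf: "smooth f" by (rule schwartz_smooth[OF snoc.prems(2)])
    have "partial_deriv b (\<lambda>x. M \<epsilon> x * f x) = (\<lambda>x. partial_deriv b (M \<epsilon>) x * f x + M \<epsilon> x * partial_deriv b f x)"
      by (rule ext) (rule partial_deriv_bilinear[OF bounded_bilinear_mult smooth_differentiable[OF sM] smooth_differentiable[OF sf]])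
    then have "iter_deriv (bs @ [b]) (\<lambda>x. M \<epsilon> x * f x) x =
        iter_deriv bs (\<lambda>x. partial_deriv b (M \<epsilon>) x * f x) x + iter_deriv bs (\<lambda>x. M \<epsilon> x * partial_deriv b f x) x"
      unfolding iter_deriv_snoc
      by (simp add: iter_deriv_add[OF smooth_mult[OF smooth_partial_deriv[OF sM b] sf] smooth_mult[OF sM smooth_partial_deriv[OF sf b]] bs])
    then have "(1 + norm x) ^ N * norm (iter_deriv (bs @ [b]) (\<lambda>x. M \<epsilon> x * f x) x) \<le>
       (1 + norm x) ^ N * (norm (iter_deriv bs (\<lambda>x. partial_deriv b (M \<epsilon>) x * f x) x) + norm (iter_deriv bs (\<lambda>x. M \<epsilon> x * partial_deriv b f x) x))"
      by (simp add: mult_left_mono norm_triangle_ineq)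
    then show ?thesis using C1[OF e, of x] C2[OF e, of x] by (simp add: algebra_simps)
  qed
  then show ?case by blast
qed

lemma iter_deriv_const: "bs \<noteq> [] \<Longrightarrow> iter_deriv bs (\<lambda>x. c) x = 0"
proof (cases bs rule: rev_cases)
  case (snoc cs b)
  have "partial_deriv b (\<lambda>x. c) = (\<lambda>x. 0)" by (rule ext) (rule partial_deriv_eq[OF has_derivative_const])
  then show ?thesis using snoc by (simp add: iter_deriv_snoc iter_deriv_zero)
qed simp

text \<open>The cutoff differs from 1 only where \<epsilon> * norm x is at least 1, hence the bound
  without derivatives; each derivative brings a factor \<epsilon>. The neutral terms give the
  expression the shape of \<open>iter_deriv_lincomb\<close> and
  \<open>iter_deriv_scaled\<close>.\<close>

lemma vanishing_multiplier_cutoff: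
  assumes \<Psi>: "LP_cutoff \<Psi>"
  shows "vanishing_multiplier (\<lambda>\<epsilon> x::'a::euclidean_space. 1 * 1 + (- 1) * complex_of_real (LP_Psi \<Psi> 0 (\<epsilon> *\<^sub>R x + 0)))"
proof -
  define \<eta> where "\<eta> = (\<lambda>x::'a. complex_of_real (LP_Psi \<Psi> 0 x))"
  have t\<eta>: "test_function \<eta>"
    unfolding \<eta>_def using LP_Psi_eq_0[OF \<Psi>, of 0]
    by (intro test_functionI[of _ "13/10"] smooth_of_real smooth_LP_Psi \<Psi>) auto
  have s\<eta>: "smooth \<eta>" by (rule test_function_smooth[OF t\<eta>])
  have sM: "smooth (\<lambda>x. \<eta> (\<epsilon> *\<^sub>R x + 0))" for \<epsilon> by (rule smooth_scaled[OF s\<eta>])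
  have "\<exists>C. \<forall>\<epsilon>\<in>{0<..1}. \<forall>x. norm (iter_deriv bs (\<lambda>x. 1 * 1 + (- 1) * \<eta> (\<epsilon> *\<^sub>R x + 0)) x) \<le> C * \<epsilon> * (1 + norm x)"
    if bs: "bs \<in> multi_indices" for bs :: "'a list"
  proof (cases "bs = []")
    case True
    obtain B where B: "\<And>x. norm (\<eta> x) \<le> B" using rapid_bounded[OF test_function_rapid[OF t\<eta>]] by blast
    have B0: "B \<ge> 0" using order_trans[OF norm_ge_zero B] .
    have "norm (1 - \<eta> (\<epsilon> *\<^sub>R x)) \<le> (1 + B) * \<epsilon> * (1 + norm x)" if e: "\<epsilon> \<in> {0<..1}" for \<epsilon> x
    proof (cases "norm (\<epsilon> *\<^sub>R x) < 1")
      case True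
      then have "LP_Psi \<Psi> 0 (\<epsilon> *\<^sub>R x) = 1" by (intro LP_Psi_eq_1[OF \<Psi>]) simp
      then show ?thesis using e B0 by (simp add: \<eta>_def)
    next
      case False
      then have "1 \<le> \<epsilon> * (1 + norm x)" using e by (simp add: algebra_simps)
      moreover have "norm (1 - \<eta> (\<epsilon> *\<^sub>R x)) \<le> 1 + B"
        using norm_triangle_ineq4[of 1 "\<eta> (\<epsilon> *\<^sub>R x)"] B[of "\<epsilon> *\<^sub>R x"] by simp
      moreover have "(1 + B) * 1 \<le> (1 + B) * (\<epsilon> * (1 + norm x))"
        using calculation(1) B0 by (intro mult_left_mono) auto
      ultimately show ?thesis by (simp only: mult.assoc mult_1_right)
    qed
    then show ?thesis using True by (auto intro!: exI[of _ "1 + B"])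
  next
    case False
    obtain C where C: "C > 0" "\<And>x. (1 + norm x) ^ 0 * norm (iter_deriv bs \<eta> x) \<le> C"
      using schwartzE[OF test_function_schwartz[OF t\<eta>] bs] by blast
    have "norm (iter_deriv bs (\<lambda>x. 1 * 1 + (- 1) * \<eta> (\<epsilon> *\<^sub>R x + 0)) x) \<le> C * \<epsilon> * (1 + norm x)" if e: "\<epsilon> \<in> {0<..1}" for \<epsilon> x
    proof -
      have "iter_deriv bs (\<lambda>x. 1 * 1 + (- 1) * \<eta> (\<epsilon> *\<^sub>R x + 0)) x = - (\<epsilon> ^ length bs *\<^sub>R iter_deriv bs \<eta> (\<epsilon> *\<^sub>R x + 0))"
        unfolding iter_deriv_lincomb[OF smooth_const sM bs] iter_deriv_scaled[OF s\<eta> bs]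
        using False by (simp add: iter_deriv_const)
      then have "norm (iter_deriv bs (\<lambda>x. 1 * 1 + (- 1) * \<eta> (\<epsilon> *\<^sub>R x + 0)) x) = \<epsilon> ^ length bs * norm (iter_deriv bs \<eta> (\<epsilon> *\<^sub>R x + 0))"
        using e by (simp add: norm_power)
      also have "\<dots> \<le> \<epsilon> ^ 1 * C"
        using e False C by (intro mult_mono power_decreasing) (auto simp: Suc_le_eq)
      also have "\<dots> \<le> C * \<epsilon> * (1 + norm x)"
        using e C(1) by (simp add: mult_left_mono distrib_left)
      finally show ?thesis .
    qed
    then show ?thesis by blast
  qed
  moreover have "smooth (\<lambda>x. 1 * 1 + (- 1) * \<eta> (\<epsilon> *\<^sub>R x + 0))" for \<epsilon>
    by (intro smooth_add smooth_mult smooth_const sM)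
  ultimately show ?thesis unfolding vanishing_multiplier_def \<eta>_def by blast
qed

text \<open>A trace is prescribed on test functions, but its blocks evaluate it on Schwartz kernels.
  Truncating \<open>f\<close> by a cutoff of width 1 / \<epsilon> changes both functionals by at
  most a multiple of \<epsilon>.\<close>

lemma tempered_eq_regular:
  fixes v :: "'a::euclidean_space functional"
  assumes \<Psi>: "LP_cutoff \<Psi>" and v: "tempered_distribution v" and w: "integrable lborel w"
    and eq: "\<And>f. test_function f \<Longrightarrow> v f = regular_functional w f" and f: "schwartz f"
  shows "v f = regular_functional w f"
proof -
  let ?M = "\<lambda>\<epsilon> x::'a. 1 * 1 + (- 1) * complex_of_real (LP_Psi \<Psi> 0 (\<epsilon> *\<^sub>R x + 0))"
  note M = vanishing_multiplier_cutoff[OF \<Psi>, where 'a='a]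
  have cut: "test_function (\<lambda>x. complex_of_real (LP_Psi \<Psi> 0 (\<epsilon> *\<^sub>R x + 0)) * f x)" if e: "\<epsilon> \<in> {0<..1}" for \<epsilon> :: real
  proof -
    have "test_function (\<lambda>x::'a. complex_of_real (LP_Psi \<Psi> 0 (\<epsilon> *\<^sub>R x + 0)))"
    proof (rule test_functionI[of _ "13/10 / \<epsilon>"])
      show "smooth (\<lambda>x::'a. complex_of_real (LP_Psi \<Psi> 0 (\<epsilon> *\<^sub>R x + 0)))"
        by (intro smooth_of_real smooth_scaled smooth_LP_Psi \<Psi>)
      fix x :: 'a assume "13/10 / \<epsilon> < norm x"
      then have "norm (\<epsilon> *\<^sub>R x + 0) > 13/10 * 2 ^ 0" using e by (simp add: field_simps)
      from LP_Psi_eq_0[OF \<Psi> this] show "complex_of_real (LP_Psi \<Psi> 0 (\<epsilon> *\<^sub>R x + 0)) = 0" by simp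
    qed
    from test_function_mult[OF this schwartz_smooth[OF f]] show ?thesis by (simp add: mult.commute)
  qed
  have key: "\<exists>C. \<forall>\<epsilon>\<in>{0<..1}. norm (z f - z (\<lambda>x. complex_of_real (LP_Psi \<Psi> 0 (\<epsilon> *\<^sub>R x + 0)) * f x)) \<le> C * \<epsilon>"
    if z: "tempered_distribution z" for z :: "'a functional"
  proof -
    obtain K N where K: "K > 0" "\<And>f e. schwartz f \<Longrightarrow>
       (\<And>bs x. bs \<in> multi_indices_upto N \<Longrightarrow> (1 + norm x) ^ N * norm (iter_deriv bs f x) \<le> e) \<Longrightarrow> norm (z f) \<le> K * e"
      using tempered_bound[OF z] by metis
    have "\<forall>bs\<in>(multi_indices_upto N :: 'a list set). \<exists>C. \<forall>\<epsilon>\<in>{0<..1}. \<forall>x. (1 + norm x) ^ N * norm (iter_deriv bs (\<lambda>x. ?M \<epsilon> x * f x) x) \<le> C * \<epsilon>"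
      by (intro ballI vanishing_multiplier_mult[OF M f]) (simp add: multi_indices_upto_def)
    from bchoice[OF this] obtain C where C: "\<And>bs \<epsilon> x. bs \<in> multi_indices_upto N \<Longrightarrow> \<epsilon> \<in> {0<..1} \<Longrightarrow>
       (1 + norm x) ^ N * norm (iter_deriv bs (\<lambda>x. ?M \<epsilon> x * f x) x) \<le> C bs * \<epsilon>" by blast
    define D where "D = (\<Sum>bs\<in>(multi_indices_upto N :: 'a list set). \<bar>C bs\<bar>)"
    have CD: "C bs \<le> D" if "bs \<in> multi_indices_upto N" for bs
    proof -
      have "\<bar>C bs\<bar> \<le> D" unfolding D_def using that by (intro member_le_sum finite_multi_indices_upto) auto
      then show ?thesis by linarith
    qed
    have "norm (z f - z (\<lambda>x. complex_of_real (LP_Psi \<Psi> 0 (\<epsilon> *\<^sub>R x + 0)) * f x)) \<le> (K * D) * \<epsilon>" if e: "\<epsilon> \<in> {0<..1}" for \<epsilon>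
    proof -
      note t = cut[OF e]
      have st: "schwartz (\<lambda>x. complex_of_real (LP_Psi \<Psi> 0 (\<epsilon> *\<^sub>R x + 0)) * f x)"
        by (rule test_function_schwartz[OF t])
      have m: "(\<lambda>x. 1 * f x + (- 1) * (complex_of_real (LP_Psi \<Psi> 0 (\<epsilon> *\<^sub>R x + 0)) * f x)) = (\<lambda>x. ?M \<epsilon> x * f x)"
        by (simp add: algebra_simps)
      have "z f - z (\<lambda>x. complex_of_real (LP_Psi \<Psi> 0 (\<epsilon> *\<^sub>R x + 0)) * f x) = z (\<lambda>x. ?M \<epsilon> x * f x)"
        unfolding m[symmetric] tempered_linear[OF z f st] by simp
      also have "norm \<dots> \<le> K * (D * \<epsilon>)"
      proof (rule K(2))
        show "schwartz (\<lambda>x. ?M \<epsilon> x * f x)" unfolding m[symmetric] by (rule schwartz_lincomb[OF f st])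
        fix bs :: "'a list" and x :: 'a assume bs: "bs \<in> multi_indices_upto N"
        have "C bs * \<epsilon> \<le> D * \<epsilon>" using CD[OF bs] e by (intro mult_right_mono) auto
        then show "(1 + norm x) ^ N * norm (iter_deriv bs (\<lambda>x. ?M \<epsilon> x * f x) x) \<le> D * \<epsilon>"
          using C[OF bs e, of x] by linarith
      qed
      finally show ?thesis by simp
    qed
    then show ?thesis by blast
  qed
  obtain C1 where C1: "\<And>\<epsilon>. \<epsilon> \<in> {0<..1} \<Longrightarrow> norm (v f - v (\<lambda>x. complex_of_real (LP_Psi \<Psi> 0 (\<epsilon> *\<^sub>R x + 0)) * f x)) \<le> C1 * \<epsilon>"
    using key[OF v] by blast
  obtain C2 where C2: "\<And>\<epsilon>. \<epsilon> \<in> {0<..1} \<Longrightarrow> norm (regular_functional w f - regular_functional w (\<lambda>x. complex_of_real (LP_Psi \<Psi> 0 (\<epsilon> *\<^sub>R x + 0)) * f x)) \<le> C2 * \<epsilon>"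
    using key[OF regular_functional_tempered(1)[OF w]] by blast
  have le: "norm (v f - regular_functional w f) \<le> (C1 + C2) * \<epsilon>" if e: "\<epsilon> \<in> {0<..1}" for \<epsilon>
  proof -
    from eq[OF cut[OF e]] C1[OF e] C2[OF e] show ?thesis
      using norm_triangle_ineq4[of "v f - v (\<lambda>x. complex_of_real (LP_Psi \<Psi> 0 (\<epsilon> *\<^sub>R x + 0)) * f x)"
        "regular_functional w f - regular_functional w (\<lambda>x. complex_of_real (LP_Psi \<Psi> 0 (\<epsilon> *\<^sub>R x + 0)) * f x)"]
      by (simp add: distrib_right)
  qed
  have "norm (v f - regular_functional w f) \<le> 0"
  proof (rule field_le_epsilon)
    fix e :: real assume e: "e > 0"
    define \<epsilon> where "\<epsilon> = min 1 (e / (\<bar>C1 + C2\<bar> + 1))"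
    have "\<epsilon> \<in> {0<..1}" using e by (simp add: \<epsilon>_def)
    from le[OF this] have "norm (v f - regular_functional w f) \<le> (\<bar>C1 + C2\<bar> + 1) * \<epsilon>"
      using \<open>\<epsilon> \<in> {0<..1}\<close> by (smt (verit) greaterThanAtMost_iff mult_right_mono)
    also have "\<dots> \<le> (\<bar>C1 + C2\<bar> + 1) * (e / (\<bar>C1 + C2\<bar> + 1))" by (intro mult_left_mono) (auto simp: \<epsilon>_def)
    also have "\<dots> = e" by (simp add: add_nonneg_pos less_imp_neq[THEN not_sym])
    finally show "norm (v f - regular_functional w f) \<le> 0 + e" by simp
  qed
  then show ?thesis by simp
qed

section \<open>Ingredients of the test distributions\<close>

lemma kernel_conv:
  fixes m1 m2 :: "'a::euclidean_space \<Rightarrow> real"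
  assumes m1: "cutoff m1" and m2: "cutoff m2"
  shows "(LINT y|lborel. kernel m1 (y - X) * kernel m2 (x - y)) = kernel (\<lambda>\<xi>. m1 \<xi> * m2 \<xi>) (x - X)"
proof -
  have [measurable]: "kernel m1 \<in> borel_measurable borel" "kernel m2 \<in> borel_measurable borel"
    by (intro borel_measurable_continuous_onI rapid_continuous rapid_kernel m1 m2)+
  have "(LINT y|lborel. kernel m1 (y - X) * kernel m2 (x - y)) = \<bar>1 :: real\<bar> ^ DIM('a) *\<^sub>R (LINT z|lborel. kernel m1 ((X + 1 *\<^sub>R z) - X) * kernel m2 (x - (X + 1 *\<^sub>R z)))"
    by (rule lborel_integral_affine) auto
  also have "\<dots> = (LINT z|lborel. kernel m1 z * osc_int (scaled_symbol m2) ((x - X) + - z))"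
    by (simp add: kernel_def algebra_simps)
  also have "\<dots> = osc_int (\<lambda>\<xi>. osc_int (kernel m1) (- \<xi>) * scaled_symbol m2 \<xi>) (x - X)"
    by (rule conv_osc_int[OF rapid_kernel[OF m1] test_function_rapid[OF test_function_scaled_symbol[OF m2]] bounded_linear_minus[OF bounded_linear_ident]]) simp
  also have "(\<lambda>\<xi>. osc_int (kernel m1) (- \<xi>) * scaled_symbol m2 \<xi>) = scaled_symbol (\<lambda>\<xi>. m1 \<xi> * m2 \<xi>)"
    by (simp add: osc_int_kernel[OF m1] scaled_symbol_def fun_eq_iff)
  finally show ?thesis by (simp add: kernel_def)
qed

lemma Lp_power_rapid_finite:
  assumes f: "rapid f" and p: "0 < p"
  shows "Lp_power p f < \<infinity>"
proof -
  obtain J where J: "J > 0" "\<And>R p M (x::'a). R > 0 \<Longrightarrow> p > 0 \<Longrightarrow> real M * p \<ge> 2 * real DIM('a) \<Longrightarrow>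
     (\<integral>\<^sup>+z. ennreal (decay_weight R M p (x - z)) \<partial>lborel) \<le> ennreal (J / R ^ DIM('a))"
    using nn_integral_decay_weight[where 'a='a] by blast
  obtain M where M: "real M * p \<ge> 2 * real DIM('a)" using exists_large_M[OF p] by blast
  obtain C where C: "C > 0" "\<And>x. (1 + norm x) ^ M * norm (f x) \<le> C" using rapidE[OF f] by blast
  have [measurable]: "(\<lambda>z::'a. decay_weight 1 M p (0 - z)) \<in> borel_measurable borel" by (rule decay_weight_measurable) simp
  have "norm (f x) powr p \<le> C powr p * decay_weight 1 M p (0 - x)" for x
  proof -
    have V: "(1 + norm x) ^ M > 0" by (intro zero_less_power add_pos_nonneg) auto
    then have "norm (f x) \<le> C / (1 + norm x) ^ M" using C(2)[of x] by (simp add: pos_le_divide_eq mult.commute)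
    then have "norm (f x) powr p \<le> (C / (1 + norm x) ^ M) powr p" using p by (intro powr_mono2) auto
    also have "\<dots> = C powr p / ((1 + norm x) ^ M) powr p"
      by (rule powr_divide)
    also have "\<dots> = C powr p * decay_weight 1 M p (0 - x)" by (simp add: decay_weight_def powr_minus divide_inverse)
    finally show ?thesis .
  qed
  from ennreal_leI[OF this] have "ennreal (norm (f x) powr p) \<le> ennreal (C powr p) * ennreal (decay_weight 1 M p (0 - x))" for x
    by (simp only: ennreal_mult powr_ge_zero decay_weight_nonneg)
  then have "Lp_power p f \<le> (\<integral>\<^sup>+x. ennreal (C powr p) * ennreal (decay_weight 1 M p (0 - x)) \<partial>(lborel :: 'a measure))"
    unfolding Lp_power_def by (intro nn_integral_mono)
  also have "\<dots> = ennreal (C powr p) * (\<integral>\<^sup>+x. ennreal (decay_weight 1 M p (0 - x)) \<partial>(lborel :: 'a measure))"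
    by (rule nn_integral_cmult) measurable
  also have "\<dots> \<le> ennreal (C powr p) * ennreal (J / 1 ^ DIM('a))" by (intro mult_left_mono J(2) M p) auto
  also have "\<dots> < \<infinity>" by (simp add: ennreal_mult_less_top)
  finally show ?thesis .
qed

text \<open>The bumps are moved so far apart that near the peak of each of them a single term
  dominates, and the \<open>r\<close>-th powers add up over disjoint balls. Only the positions
  depend on \<open>A\<close>, hence the uniform constant.\<close>

lemma Lp_power_bumps_lower:
  fixes \<kappa> :: "'a::euclidean_space \<Rightarrow> complex"
  assumes \<kappa>: "rapid \<kappa>" and z0: "\<kappa> z0 \<noteq> 0" and r: "0 < r"
  obtains c where "c > 0" "\<And>A :: nat set. finite A \<Longrightarrow> \<exists>X. ennreal (c * real (card A)) \<le> Lp_power r (\<lambda>x. \<Sum>j\<in>A. \<kappa> (x - X j))"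
proof -
  \<comment> \<open>One third, so that near the peak the main term is at least
    \<open>2 * \<delta>\<close> while all other terms together will be at most
    \<open>\<delta>\<close>.\<close>
  define \<delta> where "\<delta> = norm (\<kappa> z0) / 3"
  have d: "\<delta> > 0" using z0 by (simp add: \<delta>_def)
  have ck: "continuous_on UNIV \<kappa>" by (rule rapid_continuous[OF \<kappa>])
  then obtain \<rho> where \<rho>: "\<rho> > 0" "\<And>z. dist z z0 < \<rho> \<Longrightarrow> dist (\<kappa> z) (\<kappa> z0) < \<delta>"
    using d unfolding continuous_on_iff by (metis UNIV_I)
  have big: "norm (\<kappa> z) \<ge> 2 * \<delta>" if "z \<in> ball z0 \<rho>" for z
    using \<rho>(2)[of z] that norm_triangle_ineq2[of "\<kappa> z0" "\<kappa> z"]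
    by (simp add: dist_commute dist_norm norm_minus_commute \<delta>_def)
  define V where "V = measure lborel (ball z0 \<rho>)"
  have V: "V > 0" unfolding V_def by (intro content_ball_pos \<rho>)
  obtain B where B: "B > 0" "\<And>z. (1 + norm z) ^ 1 * norm (\<kappa> z) \<le> B" using rapidE[OF \<kappa>] by blast
  obtain e :: 'a where e: "norm e = 1" using nonempty_Basis norm_Basis by blast
  have "\<exists>X. ennreal (\<delta> powr r * V * real (card A)) \<le> Lp_power r (\<lambda>x. \<Sum>j\<in>A. \<kappa> (x - X j))" if A: "finite A" for A :: "nat set"
  proof -
    \<comment> \<open>From this radius on, first-order decay makes one bump at most
      \<open>\<delta> / (real (card A) + 1)\<close>, small enough to be summed over
      \<open>A\<close>.\<close>
    define R where "R = B * (real (card A) + 1) / \<delta>"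
    have R0: "R \<ge> 0" using B d by (simp add: R_def)
    have small: "norm (\<kappa> z) \<le> \<delta> / (real (card A) + 1)" if "norm z \<ge> R" for z
    proof -
      have "R * norm (\<kappa> z) \<le> B" using B(2)[of z] that mult_right_mono[of R "1 + norm z" "norm (\<kappa> z)"] by simp
      then have "B * ((real (card A) + 1) * norm (\<kappa> z)) \<le> B * \<delta>" using d by (simp add: R_def field_simps)
      then have "(real (card A) + 1) * norm (\<kappa> z) \<le> \<delta>" using B(1) by (simp only: mult_le_cancel_left_pos)
      then show ?thesis by (simp add: pos_le_divide_eq mult.commute)
    qed
    \<comment> \<open>The spacing allows for the offset \<open>z0\<close> of the peak and for two
      radii \<open>\<rho>\<close>: the balls become disjoint, and all other bumps are at distance at
      least \<open>R\<close>.\<close>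
    define L where "L = R + norm z0 + 2 * \<rho>"
    define X where "X = (\<lambda>j. (L * real j) *\<^sub>R e)"
    have sep: "norm (X i - X j) \<ge> L" if "i \<noteq> j" for i j
    proof -
      have "X i - X j = (L * (real i - real j)) *\<^sub>R e" by (simp add: X_def algebra_simps)
      then have "norm (X i - X j) = L * \<bar>real i - real j\<bar>" using R0 \<rho>(1) by (simp add: e abs_mult L_def)
      moreover have "\<bar>real i - real j\<bar> \<ge> 1" using that by linarith
      moreover have "L \<ge> 0" using R0 \<rho>(1) by (simp add: L_def)
      ultimately show ?thesis using mult_left_mono[of 1 "\<bar>real i - real j\<bar>" L] by simp
    qed
    let ?S = "\<lambda>x. \<Sum>j\<in>A. \<kappa> (x - X j)"
    have low: "norm (?S x) \<ge> \<delta>" if i: "i \<in> A" and x: "x \<in> ball (z0 + X i) \<rho>" for i x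
    proof -
      have xi: "x - X i \<in> ball z0 \<rho>" using x by (simp add: dist_norm algebra_simps)
      have nxi: "norm (x - X i) \<le> norm z0 + \<rho>"
        using xi norm_triangle_ineq4[of z0 "z0 - (x - X i)"] by (simp add: dist_norm)
      have sm: "norm (\<kappa> (x - X j)) \<le> \<delta> / (real (card A) + 1)" if "j \<noteq> i" for j
      proof (rule small)
        have "norm (X i - X j) \<le> norm (x - X j) + norm (x - X i)"
          using norm_triangle_ineq4[of "x - X j" "x - X i"] by simp
        then show "R \<le> norm (x - X j)" using sep[of i j] that nxi \<rho>(1) by (simp add: L_def)
      qed
      have "norm (\<Sum>j\<in>A - {i}. \<kappa> (x - X j)) \<le> (\<Sum>j\<in>A - {i}. \<delta> / (real (card A) + 1))"
        by (intro sum_norm_le sm) auto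
      also have "\<dots> \<le> \<delta>"
      proof -
        have "real (card (A - {i})) \<le> real (card A) + 1" using card_mono[OF A, of "A - {i}"] by auto
        then have "real (card (A - {i})) * (\<delta> / (real (card A) + 1)) \<le> (real (card A) + 1) * (\<delta> / (real (card A) + 1))"
          using d by (intro mult_right_mono) auto
        then show ?thesis by simp
      qed
      finally have "norm (\<Sum>j\<in>A - {i}. \<kappa> (x - X j)) \<le> \<delta>" .
      moreover have "?S x = \<kappa> (x - X i) + (\<Sum>j\<in>A - {i}. \<kappa> (x - X j))" using A i by (rule sum.remove)
      ultimately show ?thesis using big[OF xi] norm_diff_ineq[of "\<kappa> (x - X i)" "\<Sum>j\<in>A - {i}. \<kappa> (x - X j)"] by simp
    qed
    have pw: "(\<Sum>i\<in>A. ennreal (\<delta> powr r) * indicator (ball (z0 + X i) \<rho>) x) \<le> ennreal (norm (?S x) powr r)" for x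
    proof (cases "\<exists>i\<in>A. x \<in> ball (z0 + X i) \<rho>")
      case True
      then obtain i where i: "i \<in> A" "x \<in> ball (z0 + X i) \<rho>" by blast
      have "x \<notin> ball (z0 + X j) \<rho>" if "j \<noteq> i" for j
      proof
        assume "x \<in> ball (z0 + X j) \<rho>"
        then have "dist (z0 + X i) (z0 + X j) < \<rho> + \<rho>"
          using i(2) dist_triangle_less_add[of "z0 + X i" x \<rho> "z0 + X j" \<rho>] by (simp add: dist_commute)
        then show False using sep[OF that] R0 norm_ge_zero[of z0] by (simp add: dist_norm norm_minus_commute L_def del: norm_ge_zero)
      qed
      then have "(\<Sum>i\<in>A. ennreal (\<delta> powr r) * indicator (ball (z0 + X i) \<rho>) x) = (\<Sum>k\<in>A. if k = i then ennreal (\<delta> powr r) else 0)"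
        using i(2) by (intro sum.cong) (auto simp: indicator_def)
      also have "\<dots> = ennreal (\<delta> powr r)" using A i(1) by simp
      also have "\<dots> \<le> ennreal (norm (?S x) powr r)" using low[OF i] d r by (intro ennreal_leI powr_mono2) auto
      finally show ?thesis .
    next
      case False
      then have "(\<Sum>i\<in>A. ennreal (\<delta> powr r) * indicator (ball (z0 + X i) \<rho>) x) = 0"
        by (intro sum.neutral) (auto simp: indicator_def)
      then show ?thesis by simp
    qed
    have "ennreal (\<delta> powr r * V * real (card A)) = ennreal (real (card A) * (\<delta> powr r * V))"
      by (simp only: mult.commute)
    also have "\<dots> = ennreal (real (card A)) * (ennreal (\<delta> powr r) * ennreal V)"
      by (simp only: ennreal_mult' of_nat_0_le_iff powr_ge_zero)
    also have "\<dots> = (\<Sum>i\<in>A. ennreal (\<delta> powr r) * ennreal V)"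
      by (subst sum_constant) (rule arg_cong2[where f=times], rule ennreal_of_nat_eq_real_of_nat[symmetric], rule refl)
    also have "\<dots> = (\<Sum>i\<in>A. \<integral>\<^sup>+x. ennreal (\<delta> powr r) * indicator (ball (z0 + X i) \<rho>) x \<partial>lborel)"
    proof (rule sum.cong[OF refl])
      fix i
      have "emeasure lborel (ball (z0 + X i) \<rho>) = ennreal (measure lborel (ball (z0 + X i) \<rho>))"
        using emeasure_lborel_ball_finite[of "z0 + X i" \<rho>] by (intro emeasure_eq_ennreal_measure) auto
      also have "measure lborel (ball (z0 + X i) \<rho>) = V"
        using \<rho>(1) by (simp add: V_def content_ball_conv_unit_ball[of _ "z0 + X i"] content_ball_conv_unit_ball[of _ z0])
      finally show "ennreal (\<delta> powr r) * ennreal V = (\<integral>\<^sup>+x. ennreal (\<delta> powr r) * indicator (ball (z0 + X i) \<rho>) x \<partial>lborel)"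
        by (subst nn_integral_cmult_indicator) auto
    qed
    also have "\<dots> = (\<integral>\<^sup>+x. (\<Sum>i\<in>A. ennreal (\<delta> powr r) * indicator (ball (z0 + X i) \<rho>) x) \<partial>lborel)"
    proof (rule nn_integral_sum[symmetric])
      show "(\<lambda>x. ennreal (\<delta> powr r) * indicator (ball (z0 + X i) \<rho>) x) \<in> borel_measurable lborel" for i
        by (intro borel_measurable_times_ennreal borel_measurable_const borel_measurable_indicator) simp
    qed
    also have "\<dots> \<le> Lp_power r ?S" unfolding Lp_power_def by (intro nn_integral_mono pw)
    finally show ?thesis by blast
  qed
  moreover have "\<delta> powr r * V > 0" using d V by simp
  ultimately show ?thesis by (rule that[rotated])
qed

lemma cutoff_scaled:
  assumes "cutoff m" and c: "c > 0"
  shows "cutoff (\<lambda>\<xi>. m (inverse c *\<^sub>R \<xi>))"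
proof -
  obtain R where R: "\<And>\<xi>. norm \<xi> > R \<Longrightarrow> m \<xi> = 0" using assms(1) by (auto simp: cutoff_def)
  have "m (inverse c *\<^sub>R \<xi>) = 0" if "norm \<xi> > R * c" for \<xi>
    using that c by (intro R) (simp add: field_simps)
  moreover have "smooth (\<lambda>\<xi>. m (inverse c *\<^sub>R \<xi>))"
    using smooth_scaled[of m "inverse c" 0] assms(1) by (simp add: cutoff_def)
  ultimately show ?thesis unfolding cutoff_def by blast
qed

lemma kernel_zero: "kernel (\<lambda>\<xi>. 0) z = 0"
  by (simp add: kernel_def osc_int_def scaled_symbol_def)

text \<open>At last coordinate 0 the exponential does not see the last frequency, which Fubini
  integrates out; 1 / (2 pi) is the quotient of the normalisations in the two dimensions.\<close>

lemma kernel_restrict: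
  fixes g :: "'a::euclidean_space \<Rightarrow> real" and h :: "real \<Rightarrow> real"
  assumes g: "cutoff g" and h: "integrable lborel h" and gh: "cutoff (\<lambda>\<xi>. g (fst \<xi>) * h (snd \<xi>))"
  shows "kernel (\<lambda>\<xi>. g (fst \<xi>) * h (snd \<xi>)) (z, 0) = of_real ((LINT t|lborel. h t) / (2 * pi)) * kernel g z"
proof -
  let ?D = "complex_of_real ((2 * pi) ^ DIM('a))"
  have i: "integrable lborel (\<lambda>\<xi>. exp (\<i> * of_real ((z, 0) \<bullet> \<xi>)) * scaled_symbol (\<lambda>\<xi>. g (fst \<xi>) * h (snd \<xi>)) \<xi>)"
    by (intro rapid_integrable rapid_exp_mult test_function_rapid test_function_scaled_symbol gh)
  have "kernel (\<lambda>\<xi>. g (fst \<xi>) * h (snd \<xi>)) (z, 0) =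
      (LINT \<xi>|(lborel \<Otimes>\<^sub>M lborel). exp (\<i> * of_real ((z, 0) \<bullet> \<xi>)) * scaled_symbol (\<lambda>\<xi>. g (fst \<xi>) * h (snd \<xi>)) \<xi>)"
    by (simp add: kernel_def osc_int_def lborel_prod)
  also have "\<dots> = (LINT a|lborel. (LINT b|lborel. exp (\<i> * of_real ((z, 0) \<bullet> (a, b))) * scaled_symbol (\<lambda>\<xi>. g (fst \<xi>) * h (snd \<xi>)) (a, b)))"
    by (rule lborel_pair.integral_fst'[symmetric]) (use i in \<open>simp add: lborel_prod\<close>)
  also have "\<dots> = (LINT a|lborel. (exp (\<i> * of_real (z \<bullet> a)) * scaled_symbol g a) * of_real ((LINT t|lborel. h t) / (2 * pi)))"
  proof (rule Bochner_Integration.integral_cong[OF refl])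
    fix a
    have "(LINT b|lborel. exp (\<i> * of_real ((z, 0) \<bullet> (a, b))) * scaled_symbol (\<lambda>\<xi>. g (fst \<xi>) * h (snd \<xi>)) (a, b))
        = (LINT b|lborel. (exp (\<i> * of_real (z \<bullet> a)) * scaled_symbol g a / of_real (2 * pi)) * of_real (h b))"
      by (intro Bochner_Integration.integral_cong) (auto simp: scaled_symbol_def inner_prod_def mult_ac)
    also have "\<dots> = (exp (\<i> * of_real (z \<bullet> a)) * scaled_symbol g a / of_real (2 * pi)) * of_real (LINT t|lborel. h t)"
      by simp
    finally show "(LINT b|lborel. exp (\<i> * of_real ((z, 0) \<bullet> (a, b))) * scaled_symbol (\<lambda>\<xi>. g (fst \<xi>) * h (snd \<xi>)) (a, b))
        = (exp (\<i> * of_real (z \<bullet> a)) * scaled_symbol g a) * of_real ((LINT t|lborel. h t) / (2 * pi))" by simp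
  qed
  also have "\<dots> = (LINT a|lborel. exp (\<i> * of_real (z \<bullet> a)) * scaled_symbol g a) * of_real ((LINT t|lborel. h t) / (2 * pi))"
    by (rule integral_mult_left_zero)
  also have "\<dots> = of_real ((LINT t|lborel. h t) / (2 * pi)) * kernel g z"
    by (simp add: kernel_def osc_int_def)
  finally show ?thesis .
qed

text \<open>Beyond 13/20 * 2 ^ j = 13/10 * 2 ^ (j - 1) all cutoffs of smaller index have vanished,
  and below 11/10 * 2 ^ j all others are still 1: here neighbouring symbols do not overlap.\<close>

lemma LP_Phi_annulus:
  assumes \<Psi>: "LP_cutoff \<Psi>" and j: "j > 0" and \<xi>: "13/20 * 2 ^ j < norm \<xi>" "norm \<xi> < 11/10 * 2 ^ j"
  shows "LP_Phi \<Psi> k \<xi> = (if k = j then 1 else 0)"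
proof -
  have P1: "LP_Psi \<Psi> i \<xi> = 1" if "i \<ge> j" for i
  proof -
    have "(2::real) ^ j \<le> 2 ^ i" using that by (intro power_increasing) auto
    then show ?thesis using \<xi> by (intro LP_Psi_eq_1[OF \<Psi>]) linarith
  qed
  have P0: "LP_Psi \<Psi> i \<xi> = 0" if "i < j" for i
  proof -
    have "(2::real) ^ Suc i \<le> 2 ^ j" using that by (intro power_increasing) auto
    then show ?thesis using \<xi> by (intro LP_Psi_eq_0[OF \<Psi>]) simp
  qed
  show ?thesis
  proof (cases k j rule: linorder_cases)
    case less
    then show ?thesis using P0[of k] P0[of "k - 1"] by (auto simp: LP_Phi_def)
  next
    case equal
    then show ?thesis using j P1[of k] P0[of "k - 1"] by (auto simp: LP_Phi_def)
  next
    case greater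
    then have "j \<le> k - 1" by simp
    then show ?thesis using greater P1[of k] P1[of "k - 1"] by (auto simp: LP_Phi_def)
  qed
qed

text \<open>The last frequency lies within 1/10 of 17/20 and the tangential ones within 1/10 of 0,
  which keeps the product inside the annulus free of overlaps. The frequency is thus nearly normal
  to the hyperplane: after dilation it is high in the full space, yet the trace contains low
  frequencies.\<close>

lemma exists_profile:
  assumes \<Psi>: "LP_cutoff \<Psi>"
  obtains g :: "'a::euclidean_space \<Rightarrow> real" and h :: "real \<Rightarrow> real"
  where "cutoff g" "integrable lborel h" "(LINT t|lborel. h t) > 0" "cutoff (\<lambda>\<xi>. g (fst \<xi>) * h (snd \<xi>))"
    "\<forall>\<xi>. norm \<xi> \<le> 1/20 \<longrightarrow> g \<xi> = 1"
    "\<forall>\<xi>. g (fst \<xi>) * h (snd \<xi>) \<noteq> 0 \<longrightarrow> 13/20 < norm \<xi> \<and> norm \<xi> < 11/10"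
proof -
  obtain h :: "real \<Rightarrow> real" where h: "test_function (\<lambda>x. of_real (h x))" "\<And>x. h x \<ge> 0"
    "\<And>x. dist (17/20) x \<ge> 1/10 \<Longrightarrow> h x = 0" "integrable lborel h" "(LINT x|lborel. h x) > 0"
    using exists_bump[OF \<Psi>, of "1/10" "17/20"] by auto
  \<comment> \<open>The factor 20 puts the support inside radius 13/200, below 1/10, and the value 1
    inside radius 11/200, above 1/20.\<close>
  define g where "g = (\<lambda>\<xi>::'a. LP_Psi \<Psi> 0 (20 *\<^sub>R \<xi> + 0))"
  have sg: "smooth g" unfolding g_def by (intro smooth_scaled smooth_LP_Psi \<Psi>)
  have g0: "g \<xi> = 0" if "norm \<xi> > 1/10" for \<xi> unfolding g_def by (rule LP_Psi_eq_0[OF \<Psi>]) (use that in simp)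
  have sh: "smooth h"
    using Ck_compose_linear[OF open_UNIV bounded_linear_Re, of _ "\<lambda>x. complex_of_real (h x)"] test_function_smooth[OF h(1)]
    by (simp add: smooth_Ck)
  have sup: "13/20 < norm \<xi> \<and> norm \<xi> < 11/10" if "g (fst \<xi>) * h (snd \<xi>) \<noteq> 0" for \<xi> :: "'a \<times> real"
  proof -
    have a: "norm (fst \<xi>) \<le> 1/10" "\<bar>17/20 - snd \<xi>\<bar> < 1/10"
      using that g0[of "fst \<xi>"] h(3)[of "snd \<xi>"] by (auto simp: dist_real_def not_le[symmetric])
    moreover have "norm (snd \<xi>) \<le> norm \<xi>" by (metis norm_snd_le prod.collapse)
    moreover have "norm \<xi> \<le> norm (fst \<xi>) + norm (snd \<xi>)" by (metis norm_Pair_le prod.collapse)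
    ultimately show ?thesis unfolding real_norm_def by linarith
  qed
  show ?thesis
  proof (rule that[of g h])
    show "cutoff g" using sg g0 unfolding cutoff_def by blast
    show "integrable lborel h" "(LINT t|lborel. h t) > 0" by (rule h)+
    show "cutoff (\<lambda>\<xi>. g (fst \<xi>) * h (snd \<xi>))" unfolding cutoff_def
    proof (intro conjI exI[of _ "11/10"] allI impI)
      show "smooth (\<lambda>\<xi>. g (fst \<xi>) * h (snd \<xi>))"
        using smooth_affine[OF bounded_linear_fst sg, of 0] smooth_affine[OF bounded_linear_snd sh, of 0]
        by (intro smooth_mult) simp_all
      show "g (fst \<xi>) * h (snd \<xi>) = 0" if "norm \<xi> > 11/10" for \<xi> using sup[of \<xi>] that by auto
    qed
    show "\<forall>\<xi>. norm \<xi> \<le> 1/20 \<longrightarrow> g \<xi> = 1"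
      unfolding g_def by (intro allI impI LP_Psi_eq_1[OF \<Psi>]) simp
    show "\<forall>\<xi>. g (fst \<xi>) * h (snd \<xi>) \<noteq> 0 \<longrightarrow> 13/20 < norm \<xi> \<and> norm \<xi> < 11/10" using sup by blast
  qed
qed

text \<open>
  The test distributions are sums of \<open>N\<close> blocks, one for each frequency \<open>2 ^ j\<close>, whose norms do not
  depend on \<open>j\<close>. Their traces look like multiples of delta distributions at low frequency. Placing these
  at far apart points gives a trace of norm at least \<open>N powr (1 / r)\<close>, up to constants, against
  \<open>N powr (1 / q)\<close> for the distribution.
\<close>

lemma trace_sharp:
  assumes \<Psi>: "LP_cutoff \<Psi>" and p: "0 < p" and q: "0 < q" and r: "0 < (r :: ennreal)"
    and bd: "trace_bounded TYPE('a) \<Psi> (real (DIM('a::euclidean_space \<times> real)) / p - real (DIM('a \<times> real)) + 1)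
      (ennreal p) (ennreal q) t r \<infinity>"
  shows "ennreal q \<le> r"
proof (rule ccontr)
  assume "\<not> ennreal q \<le> r"
  then have rq: "r < ennreal q" by simp
  define \<rho> where "\<rho> = enn2real r"
  have rr: "r = ennreal \<rho>" "0 < \<rho>" "\<rho> < q"
    using rq r q by (cases r; simp add: \<rho>_def ennreal_less_iff)+
  define n where "n = real (DIM('a \<times> real))"
  define m where "m = real DIM('a)"
  have nm: "n = m + 1" by (simp add: n_def m_def)
  define s where "s = n / p - n + 1"
  obtain C where C: "\<And>u :: ('a \<times> real) functional. u \<in> besov \<Psi> s (ennreal p) (ennreal q) \<Longrightarrow> \<exists>v :: 'a functional.
        v \<in> besov \<Psi> t r \<infinity> \<and> has_trace \<Psi> u v \<and> besov_norm \<Psi> t r \<infinity> v \<le> ennreal C * besov_norm \<Psi> s (ennreal p) (ennreal q) u"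
    using bd unfolding trace_bounded_def s_def n_def by blast
  obtain g :: "'a \<Rightarrow> real" and h :: "real \<Rightarrow> real" where gh: "cutoff g" "integrable lborel h" "(LINT t|lborel. h t) > 0"
    "cutoff (\<lambda>\<xi>. g (fst \<xi>) * h (snd \<xi>))" "\<forall>\<xi>. norm \<xi> \<le> 1/20 \<longrightarrow> g \<xi> = 1"
    "\<forall>\<xi>. g (fst \<xi>) * h (snd \<xi>) \<noteq> 0 \<longrightarrow> 13/20 < norm \<xi> \<and> norm \<xi> < 11/10"
    by (rule exists_profile[OF \<Psi>]) (rule that)
  define \<Theta> where "\<Theta> = (\<lambda>\<xi> :: 'a \<times> real. g (fst \<xi>) * h (snd \<xi>))"
  define \<Theta>j where "\<Theta>j = (\<lambda>j :: nat. \<lambda>\<xi>. \<Theta> (inverse (2 ^ j) *\<^sub>R \<xi>))"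
  define gj where "gj = (\<lambda>j :: nat. \<lambda>\<xi>. g (inverse (2 ^ j) *\<^sub>R \<xi>))"
  have c\<Theta>: "cutoff \<Theta>" unfolding \<Theta>_def by (rule gh(4))
  have c\<Theta>j: "cutoff (\<Theta>j j)" for j unfolding \<Theta>j_def by (rule cutoff_scaled[OF c\<Theta>]) simp
  have cgj: "cutoff (gj j)" for j unfolding gj_def by (rule cutoff_scaled[OF gh(1)]) simp
  define c1 where "c1 = (LINT t|lborel. h t) / (2 * pi)"
  have c1: "c1 > 0" using gh(3) by (simp add: c1_def)
  have \<Theta>\<Phi>: "\<Theta>j j \<xi> * LP_Phi \<Psi> k \<xi> = (if k = j then \<Theta>j j \<xi> else 0)" if "j > 0" for j k \<xi>
  proof (cases "\<Theta>j j \<xi> = 0")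
    case False
    then have "13/20 < norm (inverse (2 ^ j) *\<^sub>R \<xi>) \<and> norm (inverse (2 ^ j) *\<^sub>R \<xi>) < 11/10"
      using gh(6)[rule_format, of "inverse (2 ^ j) *\<^sub>R \<xi>"] by (simp add: \<Theta>j_def \<Theta>_def)
    then have "13/20 * 2 ^ j < norm \<xi>" "norm \<xi> < 11/10 * 2 ^ j" by (auto simp: field_simps)
    from LP_Phi_annulus[OF \<Psi> that this] show ?thesis by simp
  qed simp
  \<comment> \<open>From \<open>j = 5\<close> on, dilation moves the ball of radius 13/10 into that
    of radius 1/20, because 26 \<le> 2 ^ 5. To the block of index 0 all these traces then look
    alike.\<close>
  have g\<Phi>: "gj j \<xi> * LP_Phi \<Psi> 0 \<xi> = LP_Phi \<Psi> 0 \<xi>" if "j \<ge> 5" for j \<xi>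
  proof (cases "LP_Phi \<Psi> 0 \<xi> = 0")
    case False
    have "norm \<xi> \<le> 13/10" using LP_Phi_support(1)[OF \<Psi> False] by simp
    moreover have "(2::real) ^ 5 \<le> 2 ^ j" using that by (intro power_increasing) auto
    ultimately have "norm (inverse (2 ^ j) *\<^sub>R \<xi>) \<le> 1/20" by (simp add: field_simps)
    then show ?thesis by (simp add: gj_def gh(5)[rule_format])
  qed simp
  \<comment> \<open>Integrating out the last frequency of a symbol dilated by 2 ^ j produces a
    factor 2 ^ j. The normalisation removes it, so that the trace in \<open>F_tr\<close> is a kernel
    of mass \<open>c1\<close> for every \<open>j\<close>.\<close>
  define F where "F = (\<lambda>j X y. of_real (inverse (2 ^ j)) * kernel (\<Theta>j j) (y - (X :: 'a, 0 :: real)))"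
  have F_eq: "F j X y = of_real ((2 ^ j) ^ DIM('a)) * kernel \<Theta> (2 ^ j *\<^sub>R (y - (X, 0)))" for j X y
    unfolding F_def \<Theta>j_def by (subst kernel_scaled[OF c\<Theta>]) (simp_all add: power_add)
  have F_tr: "F j X (y, 0) = of_real c1 * kernel (gj j) (y - X)" for j X y
  proof -
    have "F j X (y, 0) = of_real ((2 ^ j) ^ DIM('a)) * kernel \<Theta> (2 ^ j *\<^sub>R (y - X), 0)" by (simp add: F_eq)
    also have "kernel \<Theta> (2 ^ j *\<^sub>R (y - X), 0) = of_real c1 * kernel g (2 ^ j *\<^sub>R (y - X))"
      unfolding \<Theta>_def c1_def by (rule kernel_restrict[OF gh(1,2,4)])
    also have "of_real ((2 ^ j) ^ DIM('a)) * (of_real c1 * kernel g (2 ^ j *\<^sub>R (y - X))) = of_real c1 * kernel (gj j) (y - X)"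
      unfolding gj_def by (subst kernel_scaled[OF gh(1)]) simp_all
    finally show ?thesis .
  qed
  have iker: "integrable lborel (\<lambda>y. kernel m' (y - X))" if "cutoff m'" for m' :: "'b::euclidean_space \<Rightarrow> real" and X
    using lborel_integrable_affine[OF rapid_integrable[OF rapid_kernel[OF that]], of 1 "- X"] by simp
  have bdker: "integrable lborel (\<lambda>y. kernel m' (y - X) * kernel m2 (x - y))" if "cutoff m'" "cutoff m2" for m' m2 :: "'b::euclidean_space \<Rightarrow> real" and x X
  proof -
    have rr: "rapid (\<lambda>y. kernel m2 (x - y))" by (intro schwartz_rapid schwartz_reflect schwartz_kernel that)
    obtain B where "\<And>y. norm (kernel m2 (x - y)) \<le> B" using rapid_bounded[OF rr] by blast
    from integrable_mult_bounded(1)[OF iker[OF that(1)] rapid_continuous[OF rr] this] show ?thesis .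
  qed
  define \<kappa> where "\<kappa> = (kernel (LP_Phi \<Psi> 0) :: 'a \<Rightarrow> complex)"
  have r\<kappa>: "rapid \<kappa>" unfolding \<kappa>_def by (rule rapid_kernel[OF cutoff_Phi[OF \<Psi>]])
  \<comment> \<open>A kernel that vanishes identically would have the symbol 0, but the symbol is 1
    at the origin.\<close>
  obtain z0 where z0: "\<kappa> z0 \<noteq> 0"
  proof (rule ccontr)
    assume "\<not> thesis"
    then have "\<kappa> = (\<lambda>z. 0)" using that by blast
    then have "osc_int \<kappa> (- 0) = 0" by (simp add: osc_int_def)
    moreover have "LP_Phi \<Psi> 0 (0 :: 'a) = 1" using LP_Psi_eq_1[OF \<Psi>, of "0::'a" 0] by (simp add: LP_Phi_def)
    ultimately show False using osc_int_kernel[OF cutoff_Phi[OF \<Psi>], of 0 "0::'a"] by (simp add: \<kappa>_def)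
  qed
  obtain c2 where c2: "c2 > 0" "\<And>A :: nat set. finite A \<Longrightarrow> \<exists>X. ennreal (c2 * real (card A)) \<le> Lp_power \<rho> (\<lambda>x. \<Sum>j\<in>A. \<kappa> (x - X j))"
    using Lp_power_bumps_lower[OF r\<kappa> z0 rr(2)] by blast
  define K0 where "K0 = enn2real (Lp_power p (kernel \<Theta>))"
  have K0: "Lp_power p (kernel \<Theta>) = ennreal K0" "K0 \<ge> 0"
    using Lp_power_rapid_finite[OF rapid_kernel[OF c\<Theta>] p] by (auto simp: K0_def less_top)
  \<comment> \<open>The power of 2 is compensated by the smoothness: s * p + m * p - n = 0, so all
    these functions have the same weighted quasi-norm.\<close>
  have NF: "Lp_power p (F j X) = ennreal (2 powr (real j * (m * p - n)) * K0)" for j X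
  proof -
    have [measurable]: "kernel \<Theta> \<in> borel_measurable borel"
      by (intro borel_measurable_continuous_onI rapid_continuous rapid_kernel c\<Theta>)
    let ?J = "\<integral>\<^sup>+x. ennreal (norm (kernel \<Theta> (- (2 ^ j *\<^sub>R (X, 0)) + 2 ^ j *\<^sub>R x)) powr p) \<partial>lborel"
    have 1: "ennreal K0 = ennreal (\<bar>2 ^ j\<bar> ^ DIM('a \<times> real)) * ?J"
      unfolding K0(1)[symmetric] Lp_power_def by (rule lborel_nn_integral_affine) auto
    have pn: "((2::real) ^ j) ^ DIM('a \<times> real) = 2 powr (real j * n)"
      unfolding n_def of_nat_mult[symmetric] by (subst powr_realpow; simp only: power_mult zero_less_numeral)
    have pm: "((2::real) ^ j) ^ DIM('a) = 2 powr (real j * m)"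
      unfolding m_def of_nat_mult[symmetric] by (subst powr_realpow; simp only: power_mult zero_less_numeral)
    have J: "?J = ennreal (2 powr (- (real j * n)) * K0)"
    proof -
      have "ennreal (2 powr (- (real j * n)) * K0) = ennreal (2 powr (- (real j * n))) * (ennreal (2 powr (real j * n)) * ?J)"
        using 1 by (simp add: ennreal_mult' pn del: DIM_prod)
      also have "\<dots> = ennreal (2 powr (- (real j * n)) * 2 powr (real j * n)) * ?J"
        by (simp add: ennreal_mult mult.assoc)
      also have "2 powr (- (real j * n)) * 2 powr (real j * n) = (1::real)" by (simp flip: powr_add)
      finally show ?thesis by simp
    qed
    have "Lp_power p (F j X) = (\<integral>\<^sup>+x. ennreal (2 powr (real j * m * p)) * ennreal (norm (kernel \<Theta> (- (2 ^ j *\<^sub>R (X, 0)) + 2 ^ j *\<^sub>R x)) powr p) \<partial>lborel)"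
      unfolding Lp_power_def
    proof (rule nn_integral_cong)
      fix x
      have "norm (F j X x) powr p = (((2::real) ^ j) ^ DIM('a) * norm (kernel \<Theta> (- (2 ^ j *\<^sub>R (X, 0)) + 2 ^ j *\<^sub>R x))) powr p"
      proof -
        have "2 ^ j *\<^sub>R (x - (X, 0)) = - (2 ^ j *\<^sub>R (X, 0)) + 2 ^ j *\<^sub>R x"
          by (simp add: scaleR_diff_right del: scaleR_Pair)
        then show ?thesis unfolding F_eq norm_mult norm_of_real by (simp del: scaleR_Pair)
      qed
      also have "\<dots> = 2 powr (real j * m * p) * norm (kernel \<Theta> (- (2 ^ j *\<^sub>R (X, 0)) + 2 ^ j *\<^sub>R x)) powr p"
        unfolding pm by (simp add: powr_mult powr_powr)
      finally show "ennreal (norm (F j X x) powr p) = ennreal (2 powr (real j * m * p)) * ennreal (norm (kernel \<Theta> (- (2 ^ j *\<^sub>R (X, 0)) + 2 ^ j *\<^sub>R x)) powr p)"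
        by (simp add: ennreal_mult)
    qed
    also have "\<dots> = ennreal (2 powr (real j * m * p)) * ?J" by (rule nn_integral_cmult) measurable
    also have "\<dots> = ennreal (2 powr (real j * m * p) * (2 powr (- (real j * n)) * K0))"
      unfolding J using K0(2) by (simp add: ennreal_mult)
    also have "2 powr (real j * m * p) * (2 powr (- (real j * n)) * K0) = 2 powr (real j * (m * p - n)) * K0"
      unfolding mult.assoc[symmetric] powr_add[symmetric] by (simp add: algebra_simps)
    finally show ?thesis .
  qed
  \<comment> \<open>The left side grows like N powr (1 / \<rho>), the right side like N powr (1 /
    q); for \<rho> < q this is contradictory for large \<open>N\<close>.\<close>
  have ineq: "(c1 powr \<rho> * c2 * real N) powr (1 / \<rho>) \<le> \<bar>C\<bar> * (real N * K0 powr (q / p)) powr (1 / q)" for N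
  proof -
    \<comment> \<open>\<open>N\<close> different frequencies, each used once, so that every block of
      \<open>u\<close> consists of a single term; the start at 5 is that of
      \<open>g\<Phi>\<close>.\<close>
    define A where "A = {5..<5 + N}"
    have A: "finite A" "card A = N" "\<And>j. j \<in> A \<Longrightarrow> j \<ge> 5" by (auto simp: A_def)
    obtain X where X: "ennreal (c2 * real N) \<le> Lp_power \<rho> (\<lambda>x. \<Sum>j\<in>A. \<kappa> (x - X j))" using c2(2)[OF A(1)] A(2) by auto
    define w where "w = (\<lambda>y. \<Sum>j\<in>A. F j (X j) y)"
    have iF: "integrable lborel (F j (X j))" for j
      unfolding F_def by (intro integrable_mult_right iker c\<Theta>j)
    have iw: "integrable lborel w" unfolding w_def by (intro Bochner_Integration.integrable_sum iF)
    define u where "u = regular_functional w"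
    have bu: "LP_block \<Psi> k u = (if k \<in> A then F k (X k) else (\<lambda>x. 0))" for k
    proof
      fix x
      have "LP_block \<Psi> k u x = (LINT y|lborel. w y * kernel (LP_Phi \<Psi> k) (x - y))"
        unfolding u_def by (rule LP_block_regular[OF \<Psi> iw])
      also have "\<dots> = (LINT y|lborel. (\<Sum>j\<in>A. of_real (inverse (2 ^ j)) * (kernel (\<Theta>j j) (y - (X j, 0)) * kernel (LP_Phi \<Psi> k) (x - y))))"
        unfolding w_def F_def sum_distrib_right by (simp only: mult.assoc)
      also have "\<dots> = (\<Sum>j\<in>A. LINT y|lborel. of_real (inverse (2 ^ j)) * (kernel (\<Theta>j j) (y - (X j, 0)) * kernel (LP_Phi \<Psi> k) (x - y)))"
        by (intro Bochner_Integration.integral_sum integrable_mult_right bdker c\<Theta>j cutoff_Phi \<Psi>)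
      also have "\<dots> = (\<Sum>j\<in>A. of_real (inverse (2 ^ j)) * kernel (\<lambda>\<xi>. \<Theta>j j \<xi> * LP_Phi \<Psi> k \<xi>) (x - (X j, 0)))"
        by (intro sum.cong refl) (simp only: integral_mult_right_zero kernel_conv[OF c\<Theta>j cutoff_Phi[OF \<Psi>]])
      also have "\<dots> = (\<Sum>j\<in>A. if j = k then F k (X k) x else 0)"
      proof (rule sum.cong[OF refl])
        fix j assume "j \<in> A"
        then have "j > 0" using A(3)[of j] by simp
        then show "of_real (inverse (2 ^ j)) * kernel (\<lambda>\<xi>. \<Theta>j j \<xi> * LP_Phi \<Psi> k \<xi>) (x - (X j, 0)) = (if j = k then F k (X k) x else 0)"
          by (simp add: \<Theta>\<Phi> F_def kernel_zero)
      qed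
      also have "\<dots> = (if k \<in> A then F k (X k) else (\<lambda>x. 0)) x" using A(1) by simp
      finally show "LP_block \<Psi> k u x = (if k \<in> A then F k (X k) else (\<lambda>x. 0)) x" .
    qed
    have T: "ennreal (2 powr (s * real k * q)) * ennreal_powr (Lp_norm (ennreal p) (LP_block \<Psi> k u)) q = (if k \<in> A then ennreal (K0 powr (q / p)) else 0)" for k
    proof (cases "k \<in> A")
      case True
      have "s * real k * q + real k * (m * p - n) * (1 / p) * q = 0"
        unfolding s_def nm using p by (simp add: field_simps)
      then have e: "2 powr (s * real k * q) * 2 powr (real k * (m * p - n) * (1 / p) * q) = (1::real)"
        unfolding powr_add[symmetric] by simp
      have "ennreal (2 powr (s * real k * q)) * ennreal_powr (Lp_norm (ennreal p) (LP_block \<Psi> k u)) q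
         = ennreal (2 powr (s * real k * q)) * ennreal (((2 powr (real k * (m * p - n)) * K0) powr (1 / p)) powr q)"
        using True K0(2) by (simp add: bu Lp_norm_Lp_power[OF p] NF ennreal_powr_ennreal)
      also have "((2 powr (real k * (m * p - n)) * K0) powr (1 / p)) powr q = 2 powr (real k * (m * p - n) * (1 / p) * q) * K0 powr (q / p)"
        using K0(2) by (simp add: powr_mult powr_powr)
      also have "ennreal (2 powr (s * real k * q)) * ennreal (2 powr (real k * (m * p - n) * (1 / p) * q) * K0 powr (q / p)) = ennreal (K0 powr (q / p))"
        using e by (simp only: ennreal_mult'[symmetric] powr_ge_zero mult.assoc[symmetric] mult_1_left)
      finally show ?thesis using True by simp
    next
      case False
      then show ?thesis by (simp add: bu Lp_norm_Lp_power[OF p] Lp_power_def ennreal_powr_def)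
    qed
    have "besov_norm \<Psi> s (ennreal p) (ennreal q) u = ennreal_powr (\<Sum>k. if k \<in> A then ennreal (K0 powr (q / p)) else 0) (1 / q)"
      using q by (simp add: besov_norm_def T)
    also have "(\<Sum>k. if k \<in> A then ennreal (K0 powr (q / p)) else 0) = (\<Sum>k\<in>A. ennreal (K0 powr (q / p)))"
      using A(1) by (subst suminf_finite[of A]) auto
    also have "\<dots> = ennreal (real N * K0 powr (q / p))"
      using A(2) by (simp add: ennreal_mult ennreal_of_nat_eq_real_of_nat)
    finally have bnu: "besov_norm \<Psi> s (ennreal p) (ennreal q) u = ennreal ((real N * K0 powr (q / p)) powr (1 / q))"
      by (simp add: ennreal_powr_ennreal)
    have "u \<in> besov \<Psi> s (ennreal p) (ennreal q)"
      unfolding besov_def using regular_functional_tempered(1)[OF iw] bnu by (simp add: u_def)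
    from C[OF this] obtain v :: "'a functional" where v: "v \<in> besov \<Psi> t r \<infinity>" "has_trace \<Psi> u v"
      "besov_norm \<Psi> t r \<infinity> v \<le> ennreal C * besov_norm \<Psi> s (ennreal p) (ennreal q) u" by blast
    have tv: "tempered_distribution v" using v(1) by (simp add: besov_def)
    define W where "W = (\<lambda>y. \<Sum>j\<in>A. of_real c1 * kernel (gj j) (y - X j))"
    have iW: "integrable lborel W"
      unfolding W_def by (intro Bochner_Integration.integrable_sum integrable_mult_right iker cgj)
    \<comment> \<open>Only finitely many blocks of \<open>u\<close> are non-zero, so the series of
      the trace is a finite sum.\<close>
    have vW: "v f = regular_functional W f" if f: "test_function f" for f
    proof -
      have "(\<lambda>k. regular_functional (\<lambda>x'. LP_block \<Psi> k u (x', 0)) f) sums v f"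
        using v(2) f by (simp add: has_trace_def)
      moreover have "(\<lambda>k. regular_functional (\<lambda>x'. LP_block \<Psi> k u (x', 0)) f) sums (\<Sum>k\<in>A. regular_functional (\<lambda>x'. LP_block \<Psi> k u (x', 0)) f)"
        by (rule sums_finite[OF A(1)]) (simp add: bu regular_functional_def)
      ultimately have "v f = (\<Sum>k\<in>A. regular_functional (\<lambda>x'. LP_block \<Psi> k u (x', 0)) f)" by (rule sums_unique2)
      also have "\<dots> = (\<Sum>k\<in>A. LINT x|lborel. of_real c1 * kernel (gj k) (x - X k) * f x)"
        by (intro sum.cong refl) (simp add: bu regular_functional_def F_tr)
      also have "\<dots> = (LINT x|lborel. (\<Sum>k\<in>A. of_real c1 * kernel (gj k) (x - X k) * f x))"
      proof (rule Bochner_Integration.integral_sum[symmetric])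
        obtain B where "\<And>x. norm (f x) \<le> B" using rapid_bounded[OF test_function_rapid[OF f]] by blast
        from integrable_mult_bounded(1)[OF integrable_mult_right[OF iker[OF cgj]] rapid_continuous[OF test_function_rapid[OF f]] this]
        show "integrable lborel (\<lambda>x. of_real c1 * kernel (gj k) (x - X k) * f x)" for k .
      qed
      finally show ?thesis by (simp add: regular_functional_def W_def sum_distrib_right)
    qed
    \<comment> \<open>The kernel of the block is a Schwartz function, so \<open>vW\<close> is first
      extended by \<open>tempered_eq_regular\<close>; by \<open>g\<Phi>\<close> the factors
      \<open>gj j\<close> then disappear from the symbols.\<close>
    have bv: "LP_block \<Psi> 0 v x = of_real c1 * (\<Sum>j\<in>A. \<kappa> (x - X j))" for x
    proof -
      have "LP_block \<Psi> 0 v x = v (\<lambda>y. kernel (LP_Phi \<Psi> 0) (x - y))" by (simp add: LP_block_eq(1)[OF \<Psi> tv])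
      also have "\<dots> = regular_functional W (\<lambda>y. kernel (LP_Phi \<Psi> 0) (x - y))"
        by (intro tempered_eq_regular[OF \<Psi> tv iW vW] schwartz_reflect schwartz_kernel cutoff_Phi \<Psi>)
      also have "\<dots> = (LINT y|lborel. (\<Sum>j\<in>A. of_real c1 * (kernel (gj j) (y - X j) * kernel (LP_Phi \<Psi> 0) (x - y))))"
        unfolding regular_functional_def W_def sum_distrib_right by (simp only: mult.assoc)
      also have "\<dots> = (\<Sum>j\<in>A. LINT y|lborel. of_real c1 * (kernel (gj j) (y - X j) * kernel (LP_Phi \<Psi> 0) (x - y)))"
        by (intro Bochner_Integration.integral_sum integrable_mult_right bdker cgj cutoff_Phi \<Psi>)
      also have "\<dots> = (\<Sum>j\<in>A. of_real c1 * kernel (\<lambda>\<xi>. gj j \<xi> * LP_Phi \<Psi> 0 \<xi>) (x - X j))"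
        by (intro sum.cong refl) (simp only: integral_mult_right_zero kernel_conv[OF cgj cutoff_Phi[OF \<Psi>]])
      also have "\<dots> = (\<Sum>j\<in>A. of_real c1 * \<kappa> (x - X j))"
        by (intro sum.cong refl) (simp add: g\<Phi> A(3) \<kappa>_def)
      finally show ?thesis by (simp add: sum_distrib_left)
    qed
    have "ennreal (c1 powr \<rho> * c2 * real N) \<le> Lp_power \<rho> (LP_block \<Psi> 0 v)"
    proof -
      have [measurable]: "\<kappa> \<in> borel_measurable borel"
        by (intro borel_measurable_continuous_onI rapid_continuous r\<kappa>)
      have "Lp_power \<rho> (LP_block \<Psi> 0 v) = (\<integral>\<^sup>+x. ennreal (c1 powr \<rho>) * ennreal (norm (\<Sum>j\<in>A. \<kappa> (x - X j)) powr \<rho>) \<partial>lborel)"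
        unfolding Lp_power_def bv using c1 by (intro nn_integral_cong) (simp add: norm_mult powr_mult ennreal_mult)
      also have "\<dots> = ennreal (c1 powr \<rho>) * Lp_power \<rho> (\<lambda>x. \<Sum>j\<in>A. \<kappa> (x - X j))"
        unfolding Lp_power_def by (rule nn_integral_cmult) measurable
      finally show ?thesis using mult_left_mono[OF X, of "ennreal (c1 powr \<rho>)"] c2(1)
        by (simp add: mult.assoc flip: ennreal_mult')
    qed
    note low = this
    have fin: "besov_norm \<Psi> t r \<infinity> v < \<infinity>" using v(1) by (simp add: besov_def)
    \<comment> \<open>The block of index 0 alone is tested; its weight is 1, so the estimate is the
      same for every \<open>t\<close>.\<close>
    have "ennreal (2 powr (t * real 0)) * Lp_norm r (LP_block \<Psi> 0 v) \<le> besov_norm \<Psi> t r \<infinity> v"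
      unfolding besov_norm_def by (simp only: if_True refl) (rule SUP_upper, simp)
    then have "ennreal_powr (Lp_power \<rho> (LP_block \<Psi> 0 v)) (1 / \<rho>) \<le> besov_norm \<Psi> t r \<infinity> v"
      by (simp add: rr(1) Lp_norm_Lp_power[OF rr(2)])
    also have "\<dots> \<le> ennreal \<bar>C\<bar> * besov_norm \<Psi> s (ennreal p) (ennreal q) u"
      using v(3) by (rule order_trans) (intro mult_right_mono ennreal_leI, auto)
    also have "\<dots> = ennreal (\<bar>C\<bar> * (real N * K0 powr (q / p)) powr (1 / q))"
      unfolding bnu by (rule ennreal_mult[symmetric]) auto
    finally have up: "ennreal_powr (Lp_power \<rho> (LP_block \<Psi> 0 v)) (1 / \<rho>) \<le> ennreal (\<bar>C\<bar> * (real N * K0 powr (q / p)) powr (1 / q))" .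
    then have "Lp_power \<rho> (LP_block \<Psi> 0 v) \<noteq> top" by (auto simp: ennreal_powr_def top_unique)
    then obtain Z where Z: "Lp_power \<rho> (LP_block \<Psi> 0 v) = ennreal Z" "Z \<ge> 0" by (cases "Lp_power \<rho> (LP_block \<Psi> 0 v)") auto
    have "c1 powr \<rho> * c2 * real N \<le> Z" using low unfolding Z(1) using Z(2) by (simp add: ennreal_le_iff)
    then have "(c1 powr \<rho> * c2 * real N) powr (1 / \<rho>) \<le> Z powr (1 / \<rho>)"
      using c2(1) rr(2) by (intro powr_mono2) auto
    also have "\<dots> \<le> \<bar>C\<bar> * (real N * K0 powr (q / p)) powr (1 / q)"
      using up unfolding Z(1) ennreal_powr_ennreal[OF Z(2)] by (simp add: ennreal_le_iff)
    finally show ?thesis .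
  qed
  define a where "a = (c1 powr \<rho> * c2) powr (1 / \<rho>)"
  define b where "b = \<bar>C\<bar> * (K0 powr (q / p)) powr (1 / q)"
  have a0: "a > 0" using c1 c2(1) by (simp add: a_def)
  have le: "real N powr (1 / \<rho> - 1 / q) \<le> b / a" if "N > 0" for N
  proof -
    have "a * real N powr (1 / \<rho>) \<le> b * real N powr (1 / q)"
      using ineq[of N] c1 c2(1) by (simp add: a_def b_def powr_mult mult_ac)
    then show ?thesis using that a0 by (simp add: powr_diff field_simps)
  qed
  have ex: "1 / \<rho> - 1 / q > 0" using rr q by (simp add: field_simps)
  have "filterlim (\<lambda>N. real N powr (1 / \<rho> - 1 / q)) at_top sequentially"
    using filterlim_compose[OF real_powr_at_top[OF ex] filterlim_real_sequentially] .
  then have "\<forall>\<^sub>F N in sequentially. real N powr (1 / \<rho> - 1 / q) > b / a" by (simp add: filterlim_at_top_dense)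
  moreover have "\<forall>\<^sub>F N in sequentially. N > 0" by (rule eventually_gt_at_top)
  ultimately have "\<forall>\<^sub>F N :: nat in sequentially. False"
  proof eventually_elim
    case (elim N)
    then show False using le[of N] by linarith
  qed
  then show False by simp
qed

theorem theorem1p2:
  fixes n :: nat and p q :: real and \<Psi> :: "real \<Rightarrow> real"
  assumes "n \<ge> 2" and "CARD('m::finite) = n - 1"
    and "0 < p" and "p < 1"
    and "LP_cutoff \<Psi>"
  shows
    "(0 < q \<and> q \<le> 1 \<longrightarrow>
        (\<forall>u :: ((real ^ 'm) \<times> real) functional.
           u \<in> besov \<Psi> (real n / p - real n + 1) (ennreal p) (ennreal q) \<longrightarrow> trace_defined \<Psi> u)) \<and>
     (0 < q \<and> q \<le> p \<longrightarrow>
        trace_bounded TYPE(real ^ 'm) \<Psi> (real n / p - real n + 1) (ennreal p) (ennreal q)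
          ((real n - 1) * (1 / p - 1)) (ennreal p) \<infinity>) \<and>
     (p < q \<and> q \<le> 1 \<longrightarrow>
        trace_bounded TYPE(real ^ 'm) \<Psi> (real n / p - real n + 1) (ennreal p) (ennreal q)
          ((real n - 1) * (1 / q - 1)) (ennreal q) \<infinity>) \<and>
     (p < q \<and> q \<le> 1 \<longrightarrow>
        (\<forall>(t::real) (r::ennreal). 0 < r \<longrightarrow>
           trace_bounded TYPE(real ^ 'm) \<Psi> (real n / p - real n + 1) (ennreal p) (ennreal q) t r \<infinity>
           \<longrightarrow> ennreal q \<le> r))"
proof -
  have n: "real (DIM((real ^ 'm) \<times> real)) = real n" "real (DIM(real ^ 'm)) = real n - 1"
    using assms(1,2) by auto
  note upper = trace_upper[OF assms(5,3), where 'a="real ^ 'm", unfolded n]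
  note sharp = trace_sharp[OF assms(5,3), where 'a="real ^ 'm", unfolded n]
  show ?thesis
  proof (intro conjI impI allI)
    fix u :: "((real ^ 'm) \<times> real) functional"
    assume q: "0 < q \<and> q \<le> 1" and u: "u \<in> besov \<Psi> (real n / p - real n + 1) (ennreal p) (ennreal q)"
    have "trace_bounded TYPE(real ^ 'm) \<Psi> (real n / p - real n + 1) (ennreal p) (ennreal q) ((real n - 1) * (1 / 1 - 1)) (ennreal 1) \<infinity>"
      by (rule upper) (use q assms in auto)
    then show "trace_defined \<Psi> u" using u unfolding trace_bounded_def trace_defined_def by blast
  next
    assume "0 < q \<and> q \<le> p"
    then show "trace_bounded TYPE(real ^ 'm) \<Psi> (real n / p - real n + 1) (ennreal p) (ennreal q)
          ((real n - 1) * (1 / p - 1)) (ennreal p) \<infinity>"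
      by (intro upper) (use assms in auto)
  next
    assume "p < q \<and> q \<le> 1"
    then show "trace_bounded TYPE(real ^ 'm) \<Psi> (real n / p - real n + 1) (ennreal p) (ennreal q)
          ((real n - 1) * (1 / q - 1)) (ennreal q) \<infinity>"
      by (intro upper) (use assms in auto)
  next
    fix t :: real and r :: ennreal
    assume "p < q \<and> q \<le> 1" "0 < r" "trace_bounded TYPE(real ^ 'm) \<Psi> (real n / p - real n + 1) (ennreal p) (ennreal q) t r \<infinity>"
    then show "ennreal q \<le> r" by (intro sharp) (use assms in auto)
  qed
qed

end
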